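(* Let $k$ be a field, $R=k[t,t^{-1}]$, $n\ge 2$, and $G=SL_n(R)$, and let $X=(X_+,X_-)$ be the Euclidean twin building associated to $G$. Let $\Gamma\le G$ be a subgroup whose fixed point complex $Y=(Y_+,Y_-)$ in $X$ satisfies $Y_\epsilon\neq\emptyset$ for each $\epsilon\in\{+,-\}$. Then $\Gamma$ is completely reducible if and only if every $\Gamma$-invariant $R$-submodule of $R^n$ which is an $R$-direct summand of $R^n$ has a $\Gamma$-invariant $R$-complement in $R^n$.
   Context: Let $K=k(t)$, let $\nu_+$ be the valuation on $K$ giving the order at $0$ and $\nu_-$ the valuation giving the order at infinity, with valuation rings $A_+$ and $A_-$. The twin building of $G=SL_n(R)$ is $X=(X_+,X_-)$, where $X_\pm$ is the Euclidean building of $SL_n(K)$ with respect to $\nu_\pm$: its vertices are the homothety classes of $A_\pm$-lattices in $K^n$ (free $A_\pm$-submodules of rank $n$, up to multiplication by $K^*$), and its simplices are the finite sets of vertices having representatives forming a chain $L_0\supsetneq L_1\supsetneq\cdots\supsetneq L_r\supsetneq\pi_\pm L_0$, where $\pi_\pm$ is a uniformizer of $A_\pm$. $G$ acts on $X_+$ and $X_-$ through its action on $K^n$. For a basis $\{f_1,\dots,f_n\}$ of $K^n$, $[[f_1,\dots,f_n]]$ denotes the class of the $A_+$- (respectively $A_-$-) lattice spanned by $f_1,\dots,f_n$. Each $R$-basis $\{f_1,\dots,f_n\}$ of $R^n$ gives a twin apartment $E=(E_+,E_-)$, where the vertices of $E_\pm$ are the $A_\pm$-lattice classes $[[t^{a_1}f_1,\dots,t^{a_n}f_n]]$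 with $a_1,\dots,a_n\in\mathbb Z$; the opposition involution $\mathrm{op}_E$ exchanges the $A_+$-lattice class and the $A_-$-lattice class with the same symbol. A simplex of $X_+$ and a simplex of $X_-$ are opposite if they are exchanged by $\mathrm{op}_E$ for some such twin apartment $E$. The fixed point complex of $\Gamma$ is $Y=(Y_+,Y_-)$, where $Y_\epsilon$ consists of the simplices of $X_\epsilon$ fixed by $\Gamma$. The subgroup $\Gamma$ is completely reducible if $Y_+$ and $Y_-$ are nonempty and, for each $\epsilon\in\{+,-\}$, every simplex of $Y_\epsilon$ has an opposite simplex in $Y_{-\epsilon}$. *)

theory Defs
  imports
    "HOL-Analysis.Analysis"
    "HOL-Computational_Algebra.Computational_Algebra"
    "HOL-Algebra.Group"
begin

type_synonym 'k ratfun = "'k poly fract"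

definition tvar :: "'k::field ratfun" where
  "tvar = Fraction_Field.Fract [:0, 1:] 1"

definition laurent :: "'k::field ratfun set" where
  "laurent = {Fraction_Field.Fract p ([:0, 1:] ^ m) | p m. True}"

datatype pm = SPlus | SMinus

fun opp :: "pm \<Rightarrow> pm" where
  "opp SPlus = SMinus"
| "opp SMinus = SPlus"

text \<open>Extends a valuation \<open>w\<close> on nonzero polynomials to \<open>k(t)\<close>. The value at \<open>0\<close>
  (instead of \<open>\<infinity>\<close>) is set to \<open>0\<close>; this keeps \<open>0\<close> inside the valuation rings below.\<close>

definition ratfun_val :: "('k::field poly \<Rightarrow> int) \<Rightarrow> 'k ratfun \<Rightarrow> int" where
  "ratfun_val w x = (if x = 0 then 0
     else THE m. \<exists>p q. p \<noteq> 0 \<and> q \<noteq> 0 \<and> x = Fraction_Field.Fract p q \<and> m = w p - w q)"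

fun val :: "pm \<Rightarrow> 'k::field ratfun \<Rightarrow> int" where
  "val SPlus = ratfun_val (\<lambda>p. int (Polynomial.order 0 p))"
| "val SMinus = ratfun_val (\<lambda>p. - int (degree p))"

lemma ratfun_val_Fract:
  fixes p q :: "'k::field poly"
  assumes w: "\<And>p q. p \<noteq> 0 \<Longrightarrow> q \<noteq> 0 \<Longrightarrow> w (p * q) = w p + w q"
    and pq: "p \<noteq> 0" "q \<noteq> 0"
  shows "ratfun_val w (Fraction_Field.Fract p q) = w p - w q"
proof -
  have "Fraction_Field.Fract p q \<noteq> 0"
    using pq by (simp add: Zero_fract_def eq_fract)
  moreover have "(THE m. \<exists>p' q'. p' \<noteq> 0 \<and> q' \<noteq> 0 \<and>
      Fraction_Field.Fract p q = Fraction_Field.Fract p' q' \<and> m = w p' - w q') = w p - w q"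
  proof (rule the_equality)
    show "\<exists>p' q'. p' \<noteq> 0 \<and> q' \<noteq> 0 \<and>
        Fraction_Field.Fract p q = Fraction_Field.Fract p' q' \<and> w p - w q = w p' - w q'"
      using pq by blast
  next
    fix m
    assume "\<exists>p' q'. p' \<noteq> 0 \<and> q' \<noteq> 0 \<and>
        Fraction_Field.Fract p q = Fraction_Field.Fract p' q' \<and> m = w p' - w q'"
    then obtain p' q' where A: "p' \<noteq> 0" "q' \<noteq> 0" "p * q' = p' * q" "m = w p' - w q'"
      using pq by (auto simp: eq_fract)
    then have "w p + w q' = w p' + w q" using w pq by metis
    then show "m = w p - w q" using A by simp
  qed
  ultimately show ?thesis by (simp add: ratfun_val_def)
qed

lemma val_Fract:
  fixes p q :: "'k::field poly"
  assumes "p \<noteq> 0" "q \<noteq> 0"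
  shows "val SPlus (Fraction_Field.Fract p q)
           = int (Polynomial.order 0 p) - int (Polynomial.order 0 q)"
    and "val SMinus (Fraction_Field.Fract p q) = int (degree q) - int (degree p)"
  using assms by (simp_all add: ratfun_val_Fract order_mult degree_mult_eq)

definition val_ring :: "pm \<Rightarrow> 'k::field ratfun set" where
  "val_ring e = {x. 0 \<le> val e x}"

fun unif :: "pm \<Rightarrow> 'k::field ratfun" where
  "unif SPlus = tvar"
| "unif SMinus = inverse tvar"

lemma val_unif: "val e (unif e :: 'k::field ratfun) = 1"
proof -
  have "Polynomial.order 0 ([:0, 1:] :: 'k poly) = 1"
    using order_power_n_n[of "0::'k" 1] by simp
  moreover have "Polynomial.order 0 (1 :: 'k poly) = 0"
    by (simp add: order_0I)
  ultimately have "val SPlus (tvar :: 'k ratfun) = 1" "val SMinus (inverse tvar :: 'k ratfun) = 1"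
    unfolding tvar_def inverse_fract by (subst val_Fract; simp)+
  then show ?thesis by (cases e) simp_all
qed


text \<open>Modules over a subring \<open>S\<close> of the field \<open>K\<close>, all realised inside \<open>K\<^sup>n\<close>.\<close>

definition lincombs :: "'a set \<Rightarrow> ('n::finite \<Rightarrow> 'a::field ^ 'n) \<Rightarrow> ('a ^ 'n) set" where
  "lincombs S f = {\<Sum>i\<in>UNIV. c i *s f i | c. range c \<subseteq> S}"

definition basis_over :: "'a set \<Rightarrow> ('n::finite \<Rightarrow> 'a::field ^ 'n) \<Rightarrow> ('a ^ 'n) set \<Rightarrow> bool" where
  "basis_over S f M \<longleftrightarrow> lincombs S f = M \<and>
     (\<forall>c. range c \<subseteq> S \<longrightarrow> (\<Sum>i\<in>UNIV. c i *s f i) = 0 \<longrightarrow> (\<forall>i. c i = 0))"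

definition submodule_over :: "'a set \<Rightarrow> ('a::field ^ 'n::finite) set \<Rightarrow> bool" where
  "submodule_over S M \<longleftrightarrow> 0 \<in> M \<and> (\<forall>x\<in>M. \<forall>y\<in>M. x + y \<in> M) \<and> (\<forall>c\<in>S. \<forall>x\<in>M. c *s x \<in> M)"

definition scale_set :: "'a \<Rightarrow> ('a::field ^ 'n::finite) set \<Rightarrow> ('a ^ 'n) set" where
  "scale_set c L = (\<lambda>x. c *s x) ` L"

definition free_laurent :: "('k::field ratfun ^ 'n::finite) set" where
  "free_laurent = {v. \<forall>i. v $ i \<in> laurent}"

definition complementary :: "('k::field ratfun ^ 'n::finite) set \<Rightarrow> ('k ratfun ^ 'n) set \<Rightarrow> bool" where
  "complementary M N \<longleftrightarrow> M \<inter> N = {0} \<and> {x + y | x y. x \<in> M \<and> y \<in> N} = free_laurent"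

definition direct_summand :: "('k::field ratfun ^ 'n::finite) set \<Rightarrow> bool" where
  "direct_summand M \<longleftrightarrow> submodule_over laurent M \<and> (\<exists>N. submodule_over laurent N \<and> complementary M N)"

definition SL_laurent :: "('k::field ratfun ^ 'n::finite ^ 'n) monoid" where
  "SL_laurent = \<lparr>carrier = {g. (\<forall>i j. g $ i $ j \<in> laurent) \<and> det g = 1},
                 mult = (**), one = mat 1\<rparr>"

definition invariant_under :: "('k::field ratfun ^ 'n::finite ^ 'n) set \<Rightarrow> ('k ratfun ^ 'n) set \<Rightarrow> bool" where
  "invariant_under \<Gamma> M \<longleftrightarrow> (\<forall>g\<in>\<Gamma>. \<forall>x\<in>M. g *v x \<in> M)"


text \<open>A vertex is a homothety class, i.e. a set of lattices, each of which is a set of vectors.\<close>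

type_synonym ('k, 'n) vertex = "('k ratfun ^ 'n) set set"

definition lattice_in :: "pm \<Rightarrow> ('k::field ratfun ^ 'n::finite) set \<Rightarrow> bool" where
  "lattice_in e L \<longleftrightarrow> (\<exists>f. basis_over (val_ring e) f L)"

definition homothety_class :: "('k::field ratfun ^ 'n::finite) set \<Rightarrow> ('k, 'n) vertex" where
  "homothety_class L = {scale_set c L | c. c \<noteq> 0}"

definition simplices :: "pm \<Rightarrow> ('k::field, 'n::finite) vertex set set" where
  "simplices e = {(\<lambda>i. homothety_class (L i)) ` {..r} | L (r::nat).
      (\<forall>i\<le>r. lattice_in e (L i)) \<and> (\<forall>i<r. L (Suc i) \<subset> L i) \<and> scale_set (unif e) (L 0) \<subset> L r}"

definition act_vertex :: "'k::field ratfun ^ 'n::finite ^ 'n \<Rightarrow> ('k, 'n) vertex \<Rightarrow> ('k, 'n) vertex" where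
  "act_vertex g v = (\<lambda>L. (\<lambda>x. g *v x) ` L) ` v"

definition fixed_complex ::
    "('k::field ratfun ^ 'n::finite ^ 'n) set \<Rightarrow> pm \<Rightarrow> ('k, 'n) vertex set set" where
  "fixed_complex \<Gamma> e = {\<sigma> \<in> simplices e. \<forall>g\<in>\<Gamma>. act_vertex g ` \<sigma> = \<sigma>}"

definition lattice_class :: "pm \<Rightarrow> ('n::finite \<Rightarrow> 'k::field ratfun ^ 'n) \<Rightarrow> ('k, 'n) vertex" where
  "lattice_class e f = homothety_class (lincombs (val_ring e) f)"

definition apartment :: "pm \<Rightarrow> ('n::finite \<Rightarrow> 'k::field ratfun ^ 'n) \<Rightarrow> ('k, 'n) vertex set" where
  "apartment e f = {lattice_class e (\<lambda>i. (tvar powi a i) *s f i) | a. True}"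

text \<open>The graph of the opposition involution, restricted to the \<open>e\<close>-half of the twin apartment.\<close>

definition op_graph ::
    "pm \<Rightarrow> ('n::finite \<Rightarrow> 'k::field ratfun ^ 'n) \<Rightarrow> (('k, 'n) vertex \<times> ('k, 'n) vertex) set" where
  "op_graph e f = {(lattice_class e (\<lambda>i. (tvar powi a i) *s f i),
                    lattice_class (opp e) (\<lambda>i. (tvar powi a i) *s f i)) | a. True}"

definition opposite ::
    "pm \<Rightarrow> ('k::field, 'n::finite) vertex set \<Rightarrow> ('k, 'n) vertex set \<Rightarrow> bool" where
  "opposite e \<sigma> \<tau> \<longleftrightarrow> (\<exists>f. basis_over laurent f free_laurent \<and>
     \<sigma> \<subseteq> apartment e f \<and> \<tau> \<subseteq> apartment (opp e) f \<and>
     op_graph e f `` \<sigma> = \<tau> \<and> op_graph (opp e) f `` \<tau> = \<sigma>)"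

definition completely_reducible :: "('k::field ratfun ^ 'n::finite ^ 'n) set \<Rightarrow> bool" where
  "completely_reducible \<Gamma> \<longleftrightarrow>
     (\<forall>e. fixed_complex \<Gamma> e \<noteq> {}) \<and>
     (\<forall>e. \<forall>\<sigma>\<in>fixed_complex \<Gamma> e. \<exists>\<tau>\<in>fixed_complex \<Gamma> (opp e). opposite e \<sigma> \<tau>)"

end

theory Submission
  imports Defs
begin

text \<open>Write \<open>K = k(t)\<close>, \<open>R = k[t,1/t]\<close>, let \<open>A\<^sub>e\<close> be the two valuation rings and \<open>\<pi>\<^sub>e\<close> their
uniformizers, so that the two uniformizers are inverse to each other.

A matrix of determinant \<open>1\<close> preserves the volume of a lattice. Along a chain that represents a
simplex the volumes lie within \<open>n - 1\<close> of each other, and a homothety changes the volume by a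
multiple of \<open>n\<close>; so whoever stabilizes a simplex stabilizes every lattice in every one of its
vertices (\<open>fixed_simplex_lattice\<close>). The statement is therefore about \<open>\<Gamma>\<close>-stable lattices. An
\<open>A\<^sub>+\<close>-lattice and an \<open>A\<^sub>-\<close>-lattice glue with \<open>R\<^sup>n\<close> to a vector bundle on the projective line, on
which \<open>\<Gamma>\<close> acts if both are stable, and two vertices are opposite exactly if this bundle is a twist
of a trivial one.

The engine is a relative and equivariant form of the classification of such bundles. Let \<open>W\<close> be a
stable subspace of \<open>K\<^sup>n\<close> and twist the second lattice until the bundle has sections modulo \<open>W\<close> for
the first time. Then sections that are independent over \<open>k\<close> modulo \<open>W\<close> are independent over \<open>K\<close>,
span a saturated submodule over \<open>R\<close>, and are part of a basis of the \<open>A\<^sub>e\<close>-lattice; all of this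
follows from the vanishing of the cohomology of the line bundle \<open>O(-1)\<close>, which in terms of fields
says \<open>K = R + (A\<^sub>e \<inter> \<pi>\<^sub>e\<^sup>-\<^sup>1 A\<^sub>-\<^sub>e)\<close> and \<open>R \<inter> A\<^sub>e \<inter> \<pi>\<^sub>e\<^sup>-\<^sup>1 A\<^sub>-\<^sub>e = 0\<close> (locale \<open>section_space\<close>). If the
old sections always have a \<open>\<Gamma>\<close>-stable complement in the new ones, then repeating this step yields a
basis of \<open>K\<^sup>n\<close> modulo a given \<open>W0\<close> that is adapted simultaneously to \<open>R\<^sup>n\<close> and to a stable chain of
lattices, and whose \<open>k\<close>-span, level by level along the chain, is \<open>\<Gamma>\<close>-stable
(\<open>adapted_basis_exists\<close>).

This is applied three times. With the trivial group, where complements exist by linear algebra, it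
shows that every saturated submodule of \<open>R\<^sup>n\<close> is a direct summand (\<open>saturated_direct_summand\<close>). If
stable summands have stable complements, take \<open>W0 = 0\<close> and the chain of a fixed simplex: the same
basis, used with coefficients in the other valuation ring, spans the opposite simplex, which is
fixed because the levels are stable (\<open>opposite_fixed_simplex\<close>). If \<open>\<Gamma>\<close> is completely reducible and
\<open>M\<close> is a stable summand, take \<open>W0 = K M\<close>: the \<open>R\<close>-span of the basis is a stable complement of \<open>M\<close>
(\<open>adapted_complement\<close>). Here the complements come from semisimplicity of \<open>R\<^sup>n\<close> under \<open>k[\<Gamma>]\<close>. A fixed
vertex and its fixed opposite give \<open>R\<^sup>n = V \<otimes> R\<close> for a \<open>\<Gamma>\<close>-stable \<open>k\<close>-space \<open>V\<close>; a stable subspace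
of \<open>V\<close> gives a fixed edge, and a fixed edge opposite to it provides the complement
(\<open>constant_fibre_semisimple\<close>).\<close>

section \<open>Arithmetic of the two valuations\<close>

abbreviation cst :: "'k::field \<Rightarrow> 'k ratfun" where
  "cst c \<equiv> to_fract [:c:]"

abbreviation consts_in :: "'k::field ratfun set" where
  "consts_in \<equiv> range cst"

definition subring_of :: "'a::field set \<Rightarrow> bool" where
  "subring_of S \<longleftrightarrow> 0 \<in> S \<and> 1 \<in> S \<and> (\<forall>x\<in>S. \<forall>y\<in>S. x + y \<in> S \<and> x * y \<in> S) \<and> (\<forall>x\<in>S. - x \<in> S)"

lemma subring_ofD:
  assumes "subring_of S"
  shows "0 \<in> S" "1 \<in> S" "x \<in> S \<Longrightarrow> y \<in> S \<Longrightarrow> x + y \<in> S" "x \<in> S \<Longrightarrow> y \<in> S \<Longrightarrow> x * y \<in> S"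
    "x \<in> S \<Longrightarrow> - x \<in> S" "x \<in> S \<Longrightarrow> y \<in> S \<Longrightarrow> x - y \<in> S"
  using assms unfolding subring_of_def by (auto simp: diff_conv_add_uminus simp del: add_uminus_conv_diff)

declare val.simps [simp del]

lemma tvar_to_fract: "tvar = to_fract [:0, 1:]"
  by (simp add: tvar_def to_fract_def)

lemma tvar_neq_0 [simp]: "(tvar :: 'k::field ratfun) \<noteq> 0"
  by (simp add: tvar_to_fract)

lemma Fract_divide: "Fraction_Field.Fract p q = to_fract p / to_fract q"
  by (simp add: to_fract_def)

lemma to_fract_power: "to_fract (p ^ n) = to_fract p ^ n"
  by (induction n) simp_all

lemma ratfun_cases:
  fixes x :: "'k::field ratfun"
  obtains p q where "q \<noteq> 0" "x = to_fract p / to_fract q"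
  by (cases x) (auto simp: Fract_divide)

lemma unif_neq_0 [simp]: "(unif e :: 'k::field ratfun) \<noteq> 0"
  by (cases e) simp_all

lemma unif_opp: "unif (opp e) = inverse (unif e :: 'k::field ratfun)"
  by (cases e) simp_all

lemma opp_opp [simp]: "opp (opp e) = e"
  by (cases e) simp_all

lemma val_divide_poly:
  fixes p q :: "'k::field poly"
  assumes "p \<noteq> 0" "q \<noteq> 0"
  shows "val SPlus (to_fract p / to_fract q) = int (Polynomial.order 0 p) - int (Polynomial.order 0 q)"
    and "val SMinus (to_fract p / to_fract q) = int (degree q) - int (degree p)"
  using val_Fract[OF assms] by (simp_all add: Fract_divide)

lemma val_0 [simp]: "val e (0 :: 'k::field ratfun) = 0"
  by (cases e) (simp_all add: val.simps ratfun_val_def)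

lemma val_mult:
  fixes x y :: "'k::field ratfun"
  assumes "x \<noteq> 0" "y \<noteq> 0"
  shows "val e (x * y) = val e x + val e y"
proof -
  obtain p q where x: "q \<noteq> 0" "x = to_fract p / to_fract q" by (rule ratfun_cases)
  obtain p' q' where y: "q' \<noteq> 0" "y = to_fract p' / to_fract q'" by (rule ratfun_cases)
  have p: "p \<noteq> 0" "p' \<noteq> 0" using assms x y by auto
  have xy: "x * y = to_fract (p * p') / to_fract (q * q')" using x y by simp
  show ?thesis
    unfolding xy unfolding x(2) y(2) using x(1) y(1) p
    by (cases e) (simp_all add: val_divide_poly order_mult degree_mult_eq del: to_fract_mult)
qed

lemma val_1 [simp]: "val e (1 :: 'k::field ratfun) = 0"
  using val_mult[of 1 "1 :: 'k ratfun" e] by simp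

lemma val_inverse: "val e (inverse x :: 'k::field ratfun) = - val e x"
  using val_mult[of x "inverse x" e] by (cases "x = 0") auto

lemma val_unif_powi: "val e (unif e powi m :: 'k::field ratfun) = m"
proof -
  have *: "val e (unif e ^ k :: 'k ratfun) = int k" for k
    by (induction k) (simp_all add: val_mult val_unif)
  show ?thesis by (cases m rule: int_cases2) (simp_all add: power_int_minus val_inverse *)
qed

lemma val_ring_plus_iff:
  "x \<in> val_ring SPlus \<longleftrightarrow> (\<exists>p q. poly q 0 \<noteq> 0 \<and> x = to_fract p / to_fract q)" (is "_ \<longleftrightarrow> ?r")
proof
  assume x: "x \<in> val_ring SPlus"
  show ?r
  proof (cases "x = 0")
    case True then show ?thesis by (intro exI[of _ 0] exI[of _ 1]) simp
  next
    case False
    obtain p q where pq: "q \<noteq> 0" "x = to_fract p / to_fract q" by (rule ratfun_cases)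
    have "p \<noteq> 0" using pq False by auto
    let ?T = "[:- 0, 1:] :: 'a poly"
    define r where "r = Polynomial.order 0 q"
    have ord: "r \<le> Polynomial.order 0 p"
      using x pq \<open>p \<noteq> 0\<close> val_divide_poly(1)[of p q] by (simp add: val_ring_def r_def)
    obtain q' where q': "q = ?T ^ r * q'" "\<not> ?T dvd q'"
      using order_decomp[OF pq(1), of 0] r_def by auto
    have "?T ^ r dvd p" using ord order_divides by blast
    then obtain p' where p': "p = ?T ^ r * p'" by blast
    have "poly q' 0 \<noteq> 0" using q'(2) by (simp add: poly_eq_0_iff_dvd)
    moreover have "x = to_fract p' / to_fract q'"
      unfolding pq(2) p' q'(1) by (simp add: to_fract_power)
    ultimately show ?thesis by blast
  qed
next
  assume ?r
  then obtain p q where pq: "poly q 0 \<noteq> 0" "x = to_fract p / to_fract q" by blast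
  then have "q \<noteq> 0" "Polynomial.order 0 q = 0" by (auto intro: order_0I)
  then show "x \<in> val_ring SPlus"
    using pq by (cases "p = 0") (simp_all add: val_ring_def val_divide_poly(1))
qed

lemma val_ring_minus_iff:
  "x \<in> val_ring SMinus \<longleftrightarrow> (\<exists>p q. q \<noteq> 0 \<and> degree p \<le> degree q \<and> x = to_fract p / to_fract q)" (is "_ \<longleftrightarrow> ?r")
proof
  assume x: "x \<in> val_ring SMinus"
  show ?r
  proof (cases "x = 0")
    case True then show ?thesis by (intro exI[of _ 0] exI[of _ 1]) simp
  next
    case False
    obtain p q where pq: "q \<noteq> 0" "x = to_fract p / to_fract q" by (rule ratfun_cases)
    have "p \<noteq> 0" using pq False by auto
    then show ?thesis using x pq val_divide_poly(2)[of p q] by (auto simp: val_ring_def)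
  qed
next
  assume ?r
  then obtain p q where pq: "q \<noteq> 0" "degree p \<le> degree q" "x = to_fract p / to_fract q" by blast
  then show "x \<in> val_ring SMinus"
    by (cases "p = 0") (simp_all add: val_ring_def val_divide_poly(2))
qed

lemma cst_in_val_ring: "cst c \<in> val_ring e"
proof (cases e)
  case SPlus
  show ?thesis unfolding SPlus val_ring_plus_iff by (intro exI[of _ "[:c:]"] exI[of _ 1]) simp
next
  case SMinus
  show ?thesis unfolding SMinus val_ring_minus_iff by (intro exI[of _ "[:c:]"] exI[of _ 1]) simp
qed

lemma val_ring_add:
  fixes x y :: "'k::field ratfun"
  assumes "x \<in> val_ring e" "y \<in> val_ring e"
  shows "x + y \<in> val_ring e"
proof (cases e)
  case SPlus
  from assms obtain p q p' q' where *: "poly q 0 \<noteq> 0" "x = to_fract p / to_fract q"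
      "poly q' 0 \<noteq> 0" "y = to_fract p' / to_fract q'"
    unfolding SPlus val_ring_plus_iff by blast
  then have "q \<noteq> 0" "q' \<noteq> 0" by auto
  then have "x + y = to_fract (p * q' + p' * q) / to_fract (q * q')"
    using * by (simp add: field_simps)
  then show ?thesis unfolding SPlus val_ring_plus_iff using *
    by (intro exI[of _ "p * q' + p' * q"] exI[of _ "q * q'"]) simp
next
  case SMinus
  from assms obtain p q p' q' where *: "q \<noteq> 0" "degree p \<le> degree q" "x = to_fract p / to_fract q"
      "q' \<noteq> 0" "degree p' \<le> degree q'" "y = to_fract p' / to_fract q'"
    unfolding SMinus val_ring_minus_iff by blast
  then have eq: "x + y = to_fract (p * q' + p' * q) / to_fract (q * q')"
    by (simp add: field_simps)
  have "degree (p * q') \<le> degree (q * q')" "degree (p' * q) \<le> degree (q * q')"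
    using degree_mult_le[of p q'] degree_mult_le[of p' q] *
    by (simp_all add: degree_mult_eq)
  then have "degree (p * q' + p' * q) \<le> degree (q * q')" by (rule degree_add_le)
  moreover have "q * q' \<noteq> 0" using * by simp
  ultimately show ?thesis using eq unfolding SMinus val_ring_minus_iff by blast
qed

lemma val_ring_mult:
  fixes x y :: "'k::field ratfun"
  assumes "x \<in> val_ring e" "y \<in> val_ring e"
  shows "x * y \<in> val_ring e"
  using assms by (cases "x = 0 \<or> y = 0") (auto simp: val_ring_def val_mult)

lemma subring_val_ring: "subring_of (val_ring e :: 'k::field ratfun set)"
proof -
  have "(0 :: 'k ratfun) \<in> val_ring e" "(1 :: 'k ratfun) \<in> val_ring e"
    by (simp_all add: val_ring_def)
  moreover have "- x \<in> val_ring e" if x: "x \<in> val_ring e" for x :: "'k ratfun"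
  proof -
    have "cst (- 1) = to_fract (- 1)" by (simp add: one_pCons)
    also have "\<dots> = (- 1 :: 'k ratfun)" by (simp only: to_fract_uminus to_fract_1)
    finally show ?thesis using val_ring_mult[OF cst_in_val_ring[of "-1"] x] by simp
  qed
  ultimately show ?thesis unfolding subring_of_def by (auto intro: val_ring_add val_ring_mult)
qed

lemmas val_ring_closed = subring_ofD[OF subring_val_ring]

lemma unif_in_val_ring: "unif e \<in> (val_ring e :: 'k::field ratfun set)"
  by (simp add: val_ring_def val_unif)

lemma subring_consts: "subring_of (consts_in :: 'k::field ratfun set)"
proof -
  have 1: "cst 0 = (0 :: 'k ratfun)" "cst 1 = (1 :: 'k ratfun)" by (simp_all flip: one_pCons)
  have 2: "cst a + cst b = (cst (a + b) :: 'k ratfun)" "cst a * cst b = (cst (a * b) :: 'k ratfun)"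
    "- cst a = (cst (- a) :: 'k ratfun)" for a b :: 'k
    by (simp_all flip: to_fract_add to_fract_mult to_fract_uminus)
  show ?thesis unfolding subring_of_def
    using 1 2 by (auto intro: range_eqI range_eqI[where x = 0] range_eqI[where x = 1])
qed

lemma laurent_iff: "x \<in> laurent \<longleftrightarrow> (\<exists>p m. x = to_fract p / tvar ^ m)"
  unfolding laurent_def by (auto simp: Fract_divide tvar_to_fract to_fract_power)

lemma subring_laurent: "subring_of (laurent :: 'k::field ratfun set)"
proof -
  have "x + y \<in> laurent \<and> x * y \<in> laurent" if xy: "x \<in> laurent" "y \<in> laurent" for x y :: "'k ratfun"
  proof -
    obtain p m q l where *: "x = to_fract p / tvar ^ m" "y = to_fract q / tvar ^ l"
      using xy unfolding laurent_iff by blast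
    have "x + y = to_fract (p * [:0, 1:] ^ l + q * [:0, 1:] ^ m) / tvar ^ (m + l)"
      unfolding * by (simp add: to_fract_power tvar_to_fract[symmetric] power_add field_simps)
    moreover have "x * y = to_fract (p * q) / tvar ^ (m + l)"
      unfolding * by (simp add: power_add)
    ultimately show ?thesis unfolding laurent_iff by blast
  qed
  moreover have "- x \<in> laurent" if "x \<in> laurent" for x :: "'k ratfun"
    using that unfolding laurent_iff by (metis minus_divide_left to_fract_uminus)
  moreover have "(0 :: 'k ratfun) \<in> laurent" "(1 :: 'k ratfun) \<in> laurent"
    unfolding laurent_iff
    by (intro exI[of _ 0] exI[of _ "0::nat"], simp, intro exI[of _ 1] exI[of _ "0::nat"], simp)
  ultimately show ?thesis unfolding subring_of_def by blast
qed

lemmas laurent_closed = subring_ofD[OF subring_laurent]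

lemma cst_in_laurent: "cst c \<in> laurent"
  unfolding laurent_iff by (intro exI[of _ "[:c:]"] exI[of _ "0::nat"]) simp

lemma tvar_powi_in_laurent: "(tvar powi m :: 'k::field ratfun) \<in> laurent"
proof (cases m rule: int_cases2)
  case (nonneg n)
  show ?thesis unfolding laurent_iff nonneg
    by (intro exI[of _ "[:0, 1:] ^ n"] exI[of _ "0::nat"]) (simp add: to_fract_power tvar_to_fract)
next
  case (nonpos n)
  show ?thesis unfolding laurent_iff nonpos
    by (intro exI[of _ 1] exI[of _ n]) (simp add: power_int_minus field_simps)
qed

lemma unif_powi_in_laurent: "(unif e powi m :: 'k::field ratfun) \<in> laurent"
  using tvar_powi_in_laurent[of m] tvar_powi_in_laurent[of "- m"]
  by (cases e) (simp_all add: power_int_minus power_int_inverse)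

lemma unif_in_laurent: "(unif e :: 'k::field ratfun) \<in> laurent"
  using unif_powi_in_laurent[of e 1] by simp

lemma laurent_induct:
  fixes x :: "'k::field ratfun"
  assumes x: "x \<in> laurent"
    and add: "\<And>x y. P x \<Longrightarrow> P y \<Longrightarrow> P (x + y)" and mono: "\<And>c m. P (cst c * tvar powi m)"
  shows "P x"
proof -
  obtain p m where x: "x = to_fract p / tvar ^ m" using x unfolding laurent_iff by blast
  have "P (to_fract p / tvar powi m)" for m
  proof (induction p arbitrary: m)
    case 0 then show ?case using mono[of 0 0] by simp
  next
    case (pCons a p)
    have "to_fract (pCons a p) = cst a + tvar * to_fract p"
      by (simp add: tvar_to_fract flip: to_fract_add to_fract_mult)
    then have "to_fract (pCons a p) / tvar powi m
        = cst a * tvar powi (- m) + to_fract p / tvar powi (m - 1)"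
      by (simp add: power_int_minus power_int_diff field_simps)
    then show ?case using add mono pCons.IH by presburger
  qed
  from this[of "int m"] show ?thesis unfolding x by simp
qed

text \<open>The residue field is \<open>k\<close>: the residue of a fraction is its value at \<open>0\<close>, or the quotient of the
coefficients in the degree of the denominator.\<close>

lemma residue:
  fixes x :: "'k::field ratfun"
  assumes "x \<in> val_ring e"
  obtains c y where "y \<in> val_ring e" "x = cst c + unif e * y"
proof (cases e)
  case SPlus
  from assms obtain p q where pq: "poly q 0 \<noteq> 0" "x = to_fract p / to_fract q"
    unfolding SPlus val_ring_plus_iff by blast
  define c where "c = poly p 0 / poly q 0"
  have "poly (p - smult c q) 0 = 0" using pq(1) by (simp add: c_def)
  then obtain h where h: "p - smult c q = [:0, 1:] * h"
    unfolding poly_eq_0_iff_dvd by (auto elim: dvdE simp del: mult_pCons_left)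
  have "p = [:0, 1:] * h + [:c:] * q" using h by (simp add: algebra_simps)
  then have "to_fract p = tvar * to_fract h + cst c * to_fract q"
    unfolding tvar_to_fract by (simp only: flip: to_fract_add to_fract_mult)
  moreover have "to_fract q \<noteq> 0" using pq by auto
  ultimately have "x = cst c + unif e * (to_fract h / to_fract q)"
    unfolding pq SPlus by (simp add: field_simps)
  moreover have "to_fract h / to_fract q \<in> val_ring e"
    unfolding SPlus val_ring_plus_iff using pq by blast
  ultimately show ?thesis using that by blast
next
  case SMinus
  from assms obtain p q where pq: "q \<noteq> 0" "degree p \<le> degree q" "x = to_fract p / to_fract q"
    unfolding SMinus val_ring_minus_iff by blast
  define c where "c = coeff p (degree q) / lead_coeff q"
  define h where "h = p - smult c q"
  have "coeff h (degree q) = 0" "degree h \<le> degree q"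
    using pq by (auto simp: h_def c_def intro!: degree_diff_le order_trans[OF degree_smult_le])
  then have "h = 0 \<or> degree h < degree q" by (metis le_neq_implies_less leading_coeff_0_iff)
  then have deg: "degree ([:0, 1:] * h) \<le> degree q" by auto
  have "p = h + [:c:] * q" by (simp add: h_def)
  then have "to_fract p = to_fract h + cst c * to_fract q"
    by (simp only: flip: to_fract_add to_fract_mult)
  then have "x = cst c + unif e * (to_fract ([:0, 1:] * h) / to_fract q)"
    unfolding pq SMinus to_fract_mult tvar_to_fract[symmetric] using pq(1)
    by (simp add: field_simps)
  moreover have "to_fract ([:0, 1:] * h) / to_fract q \<in> val_ring e"
    unfolding SMinus val_ring_minus_iff using pq deg by blast
  ultimately show ?thesis using that by blast
qed

text \<open>The product formula: the valuations of a Laurent polynomial at all other places are nonnegative.\<close>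

lemma laurent_val_le:
  fixes x :: "'k::field ratfun"
  assumes "x \<in> laurent" "x \<noteq> 0"
  shows "val e x + val (opp e) x \<le> 0"
proof -
  obtain p m where x: "x = to_fract p / tvar ^ m" using assms unfolding laurent_iff by blast
  then have p: "p \<noteq> 0" using assms by auto
  have x': "x = to_fract p / to_fract ([:- 0, 1:] ^ m)"
    unfolding x by (simp add: tvar_to_fract to_fract_power)
  have "val SPlus x + val SMinus x = int (Polynomial.order 0 p) - int (degree p)"
    unfolding x' using p by (simp only: val_divide_poly order_power_n_n degree_linear_power
      pCons_eq_0_iff one_neq_zero power_eq_0_iff simp_thms not_False_eq_True)
  also have "\<dots> \<le> 0" using order_degree[OF p, of 0] by simp
  finally show ?thesis by (cases e) (simp_all add: add.commute)
qed

text \<open>The line bundle \<open>O(-1)\<close> has no global sections.\<close>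

lemma laurent_disjoint:
  fixes x :: "'k::field ratfun"
  assumes "x \<in> laurent" "x \<in> val_ring e" "unif e * x \<in> val_ring (opp e)"
  shows "x = 0"
proof (rule ccontr)
  assume "x \<noteq> 0"
  have "val (opp e) (unif e * x) = val (opp e) x - 1"
    using val_mult[OF _ \<open>x \<noteq> 0\<close>, of "unif e" "opp e"] val_unif[of "opp e", where 'k='k]
    by (simp add: unif_opp val_inverse)
  then show False using laurent_val_le[OF assms(1) \<open>x \<noteq> 0\<close>, of e] assms(2,3)
    by (simp add: val_ring_def)
qed

text \<open>Inverts \<open>q\<close> modulo the powers of the variable, one power at a time.\<close>

lemma coprime_X_power:
  fixes q :: "'k::field poly"
  assumes "poly q 0 \<noteq> 0"
  shows "\<exists>u v. [:0, 1:] ^ s * u + q * v = 1"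
proof (induction s)
  case 0 show ?case by (intro exI[of _ 1] exI[of _ 0]) simp
next
  case (Suc s)
  then obtain u v where uv: "[:0, 1:] ^ s * u + q * v = 1" by blast
  define a where "a = [:poly u 0 / poly q 0:]"
  have "poly (u - a * q) 0 = 0" using assms by (simp add: a_def)
  then obtain u' where "u - a * q = [:0, 1:] * u'"
    unfolding poly_eq_0_iff_dvd by (auto elim: dvdE simp del: mult_pCons_left)
  then have u: "u = a * q + [:0, 1:] * u'" by (simp add: diff_eq_eq add.commute)
  have "[:0, 1:] ^ Suc s * u' + q * (v + [:0, 1:] ^ s * a) = [:0, 1:] ^ s * (a * q + [:0, 1:] * u') + q * v"
    unfolding power_Suc by (simp only: algebra_simps)
  then show ?case using uv unfolding u by metis
qed

text \<open>In the partial fraction expansion of \<open>x\<close>, the polar part at \<open>0\<close> and the polynomial part are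
collected in \<open>r\<close>. What remains is a proper fraction whose denominator does not vanish at \<open>0\<close>.\<close>

lemma partial_fractions_plus:
  fixes x :: "'k::field ratfun"
  obtains r where "r \<in> laurent" "x - r \<in> val_ring SPlus" "tvar * (x - r) \<in> val_ring SMinus"
proof -
  obtain p q where pq: "q \<noteq> 0" "x = to_fract p / to_fract q" by (rule ratfun_cases)
  let ?T = "[:- 0, 1:] :: 'k poly"
  define s where "s = Polynomial.order 0 q"
  obtain q' where q': "q = ?T ^ s * q'" "\<not> ?T dvd q'"
    using order_decomp[OF pq(1), of 0] s_def by auto
  have q0: "poly q' 0 \<noteq> 0" using q'(2) by (simp add: poly_eq_0_iff_dvd)
  then have q'0: "q' \<noteq> 0" by auto
  obtain u v where "?T ^ s * u + q' * v = 1" using coprime_X_power[OF q0, of s] by auto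
  then have uv: "p = ?T ^ s * (p * u) + q' * (p * v)"
    by (metis distrib_left mult.left_commute mult.right_neutral)
  define a1 where "a1 = p * u div q'"
  define a2 where "a2 = p * u mod q'"
  have a: "p * u = a1 * q' + a2" by (simp add: a1_def a2_def)
  have deg: "degree (?T * a2) \<le> degree q'"
  proof (cases "a2 = 0")
    case False
    then have "degree a2 < degree q'" unfolding a2_def using q'0 degree_mod_less'[of q' "p * u"] by blast
    then show ?thesis using False by (simp add: degree_mult_eq del: mult_pCons_left)
  qed simp
  define r where "r = to_fract a1 + to_fract (p * v) / tvar ^ s"
  have *: "to_fract p = tvar ^ s * (to_fract a1 * to_fract q' + to_fract a2) + to_fract q' * to_fract (p * v)"
    unfolding tvar_to_fract using arg_cong[OF uv, of to_fract] unfolding a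
    by (simp add: to_fract_power)
  then have eq: "x - r = to_fract a2 / to_fract q'"
  proof -
    have "P / (T * Q) - (A1 + V / T) = A2 / Q"
      if "P = T * (A1 * Q + A2) + Q * V" "T \<noteq> 0" "Q \<noteq> 0" for P T A1 A2 Q V :: "'k ratfun"
      using that(2,3) unfolding that(1) by (simp add: field_simps)
    from this[OF *] show ?thesis
      unfolding pq(2) q'(1) r_def using q'0
      by (simp add: to_fract_power tvar_to_fract[symmetric])
  qed
  have "to_fract a1 \<in> laurent" "to_fract (p * v) / tvar ^ s \<in> laurent"
    unfolding laurent_iff by (metis div_by_1 power_0) blast
  then have "r \<in> laurent" unfolding r_def by (rule laurent_closed)
  moreover have "x - r \<in> val_ring SPlus" unfolding eq val_ring_plus_iff using q0 by blast
  moreover have "tvar * (x - r) = to_fract (?T * a2) / to_fract q'"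
    unfolding eq to_fract_mult by (simp add: tvar_to_fract)
  then have "tvar * (x - r) \<in> val_ring SMinus"
    unfolding val_ring_minus_iff using deg q'0 by blast
  ultimately show ?thesis using that by blast
qed

text \<open>The vanishing of the first cohomology of \<open>O(-1)\<close>, stated in \<open>K\<close>. The two signs differ by a
factor \<open>t\<close>.\<close>

lemma partial_fractions:
  fixes x :: "'k::field ratfun"
  obtains r where "r \<in> laurent" "x - r \<in> val_ring e" "unif e * (x - r) \<in> val_ring (opp e)"
proof (cases e)
  case SPlus
  then show ?thesis using partial_fractions_plus[of x] that by auto
next
  case SMinus
  obtain r where r: "r \<in> laurent" "x / tvar - r \<in> val_ring SPlus" "tvar * (x / tvar - r) \<in> val_ring SMinus"
    by (rule partial_fractions_plus)
  have "tvar * r \<in> laurent" using r(1) tvar_powi_in_laurent[of 1] laurent_closed(4) by fastforce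
  moreover have "tvar * (x / tvar - r) = x - tvar * r" by (simp add: field_simps)
  moreover have "inverse tvar * (x - tvar * r) = x / tvar - r" by (simp add: field_simps)
  ultimately show ?thesis using r that[of "tvar * r"] SMinus by simp
qed

lemma laurent_polar_part:
  fixes r :: "'k::field ratfun"
  assumes "r \<in> laurent"
  obtains s where "s \<in> laurent" "unif e * s \<in> val_ring (opp e)" "r - s \<in> val_ring e"
proof -
  define P where "P r \<longleftrightarrow> (\<exists>s\<in>laurent. unif e * s \<in> val_ring (opp e) \<and> r - s \<in> val_ring e)"
    for r :: "'k ratfun"
  have "P (x + y)" if "P x" "P y" for x y
  proof -
    from that obtain s s' where *: "s \<in> laurent" "unif e * s \<in> val_ring (opp e)" "x - s \<in> val_ring e"
      "s' \<in> laurent" "unif e * s' \<in> val_ring (opp e)" "y - s' \<in> val_ring e"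
      unfolding P_def by blast
    then show ?thesis unfolding P_def
      using laurent_closed(3)[of s s'] val_ring_closed(3)[OF *(2,5)] val_ring_closed(3)[OF *(3,6)]
      by (intro bexI[of _ "s + s'"]) (simp_all add: algebra_simps)
  qed
  moreover have "P (cst c * tvar powi m)" for c m
  proof -
    obtain m' where m': "(tvar powi m :: 'k ratfun) = unif e powi m'"
      by (cases e) (auto simp: power_int_inverse power_int_minus intro: that[of m] that[of "- m"])
    show ?thesis
    proof (cases "0 \<le> m'")
      case True
      then have "cst c * unif e powi m' \<in> val_ring e"
        by (intro val_ring_mult cst_in_val_ring) (simp add: val_ring_def val_unif_powi)
      then show ?thesis unfolding P_def m' using laurent_closed(1) val_ring_closed(1)
        by (intro bexI[of _ 0]) simp_all
    next
      case False
      have "(unif e powi (m' + 1) :: 'k ratfun) = unif (opp e) powi (- (m' + 1))"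
        by (simp only: unif_opp power_int_minus power_int_inverse inverse_inverse_eq)
      then have "unif e powi (m' + 1) \<in> (val_ring (opp e) :: 'k ratfun set)"
        using False by (simp add: val_ring_def val_unif_powi)
      then have "cst c * unif e powi (m' + 1) \<in> val_ring (opp e)"
        by (intro val_ring_mult cst_in_val_ring)
      then show ?thesis unfolding P_def m'
        using laurent_closed(4)[OF cst_in_laurent unif_powi_in_laurent] val_ring_closed(1)
        by (intro bexI[of _ "cst c * unif e powi m'"]) (simp_all add: power_int_add_1 mult_ac)
    qed
  qed
  ultimately have "P r" using assms by (rule laurent_induct[rotated])
  then show ?thesis using that unfolding P_def by blast
qed

text \<open>By this and \<open>laurent_disjoint\<close>, \<open>K\<close> is the direct sum of \<open>A\<^sub>e\<close> and the space of those Laurent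
polynomials that are purely polar at \<open>e\<close>.\<close>

lemma polar_part:
  fixes x :: "'k::field ratfun"
  obtains s where "s \<in> laurent" "unif e * s \<in> val_ring (opp e)" "x - s \<in> val_ring e"
proof -
  obtain r where r: "r \<in> laurent" "x - r \<in> val_ring e" by (rule partial_fractions)
  obtain s where "s \<in> laurent" "unif e * s \<in> val_ring (opp e)" "r - s \<in> val_ring e"
    using r(1) by (rule laurent_polar_part)
  then show ?thesis using that[of s] val_ring_add[OF r(2), of "r - s"] by simp
qed

section \<open>Submodules of the vector space over the function field\<close>

lemma common_denominator:
  fixes c :: "'i \<Rightarrow> 'a::field"
  assumes S: "subring_of S" and frac: "\<And>x. \<exists>s\<in>S. s \<noteq> 0 \<and> s * x \<in> S" and "finite I"
  shows "\<exists>s\<in>S. s \<noteq> 0 \<and> (\<forall>i\<in>I. s * c i \<in> S)"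
  using \<open>finite I\<close>
proof induction
  case empty then show ?case using subring_ofD(2)[OF S] by (intro bexI[of _ 1]) auto
next
  case (insert i I)
  then obtain s where s: "s \<in> S" "s \<noteq> 0" "\<forall>i\<in>I. s * c i \<in> S" by blast
  obtain u where u: "u \<in> S" "u \<noteq> 0" "u * c i \<in> S" using frac by blast
  have "s * u * c j \<in> S" if "j \<in> insert i I" for j
  proof (cases "j = i")
    case True then show ?thesis using subring_ofD(4)[OF S s(1) u(3)] by (simp add: mult.assoc)
  next
    case False
    then have "s * c j \<in> S" using that s by blast
    from subring_ofD(4)[OF S u(1) this] show ?thesis by (simp add: mult_ac)
  qed
  then show ?case using subring_ofD(4)[OF S s(1) u(1)] s(2) u(2) by (intro bexI[of _ "s * u"]) auto
qed

lemma eventually_in_val_ring: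
  fixes x :: "'k::field ratfun"
  shows "\<forall>\<^sub>F s in sequentially. unif e ^ s * x \<in> val_ring e"
proof (cases "x = 0")
  case True then show ?thesis using val_ring_closed(1) by simp
next
  case False
  have "unif e ^ s * x \<in> val_ring e" if "s \<ge> nat (- val e x)" for s
    using that val_mult[of "unif e ^ s" x e] False val_unif_powi[of e "int s", where 'k='k]
    by (simp add: val_ring_def)
  then show ?thesis unfolding eventually_sequentially by blast
qed

lemma val_ring_frac: "\<exists>s\<in>val_ring e. s \<noteq> 0 \<and> s * (x :: 'k::field ratfun) \<in> val_ring e"
proof -
  obtain s where "unif e ^ s * x \<in> val_ring e"
    using eventually_in_val_ring[of e x] unfolding eventually_sequentially by blast
  moreover have "unif e ^ s \<in> (val_ring e :: 'k ratfun set)"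
    using val_unif_powi[of e "int s", where 'k='k] by (simp add: val_ring_def)
  ultimately show ?thesis by (intro bexI[of _ "unif e ^ s"]) auto
qed

lemma to_fract_in_laurent: "to_fract p \<in> laurent"
  unfolding laurent_iff by (intro exI[of _ p] exI[of _ 0]) simp

lemma laurent_frac: "\<exists>s\<in>laurent. s \<noteq> 0 \<and> s * (x :: 'k::field ratfun) \<in> laurent"
proof -
  obtain p q where pq: "q \<noteq> 0" "x = to_fract p / to_fract q" by (rule ratfun_cases)
  then show ?thesis
    by (intro bexI[of _ "to_fract q"]) (simp_all add: to_fract_in_laurent)
qed


lemma submodule_overD:
  assumes "submodule_over S M"
  shows "0 \<in> M" "x \<in> M \<Longrightarrow> y \<in> M \<Longrightarrow> x + y \<in> M" "c \<in> S \<Longrightarrow> x \<in> M \<Longrightarrow> c *s x \<in> M"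
  using assms unfolding submodule_over_def by auto

lemma submodule_over_sum:
  assumes "submodule_over S M" "\<And>i. i \<in> I \<Longrightarrow> f i \<in> M"
  shows "(\<Sum>i\<in>I. f i) \<in> M"
  using assms(2)
  by (induction I rule: infinite_finite_induct) (auto intro: submodule_overD[OF assms(1)])

lemma submodule_over_minus:
  assumes "submodule_over S M" "subring_of S" "x \<in> M"
  shows "- x \<in> M"
proof -
  have "- 1 \<in> S" using subring_ofD(2,5)[OF assms(2)] by blast
  from submodule_overD(3)[OF assms(1) this assms(3)] show ?thesis by simp
qed

lemma submodule_over_diff:
  assumes "submodule_over S M" "subring_of S" "x \<in> M" "y \<in> M"
  shows "x - y \<in> M"
  using submodule_overD(2)[OF assms(1,3) submodule_over_minus[OF assms(1,2,4)]] by simp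

lemma submodule_over_mono: "submodule_over T M \<Longrightarrow> S \<subseteq> T \<Longrightarrow> submodule_over S M"
  unfolding submodule_over_def by blast

lemma submodule_over_Int: "submodule_over S M \<Longrightarrow> submodule_over S N \<Longrightarrow> submodule_over S (M \<inter> N)"
  unfolding submodule_over_def by blast

lemma subspace_submodule_over: "vec.subspace W \<longleftrightarrow> submodule_over UNIV W"
  unfolding vec.subspace_def submodule_over_def by blast

lemma submodule_over_subspace: "vec.subspace W \<Longrightarrow> submodule_over S W"
  by (rule submodule_over_mono[OF subspace_submodule_over[THEN iffD1]]) simp_all

lemma submodule_free_laurent: "submodule_over laurent free_laurent"
  unfolding submodule_over_def free_laurent_def
  by (auto intro: laurent_closed)

definition msum :: "('a::field ^ 'n::finite) set \<Rightarrow> ('a ^ 'n) set \<Rightarrow> ('a ^ 'n) set" where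
  "msum M N = {x + y | x y. x \<in> M \<and> y \<in> N}"

lemma submodule_msum:
  assumes "submodule_over S M" "submodule_over S N"
  shows "submodule_over S (msum M N)"
  unfolding submodule_over_def
proof (intro conjI ballI)
  have "0 + 0 \<in> msum M N" unfolding msum_def using assms[THEN submodule_overD(1)] by blast
  then show "0 \<in> msum M N" by simp
next
  fix x y assume "x \<in> msum M N" "y \<in> msum M N"
  then obtain a b a' b' where "x = a + b" "y = a' + b'" "a \<in> M" "b \<in> N" "a' \<in> M" "b' \<in> N"
    unfolding msum_def by blast
  then have "x + y = (a + a') + (b + b')" "a + a' \<in> M" "b + b' \<in> N"
    using submodule_overD(2) assms by (auto simp: algebra_simps)
  then show "x + y \<in> msum M N" unfolding msum_def by blast
next
  fix c x assume c: "c \<in> S" and "x \<in> msum M N"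
  then obtain a b where "x = a + b" "a \<in> M" "b \<in> N" unfolding msum_def by blast
  then have "c *s x = c *s a + c *s b" "c *s a \<in> M" "c *s b \<in> N"
    using submodule_overD(3)[OF _ c] assms by (auto simp: vector_add_ldistrib)
  then show "c *s x \<in> msum M N" unfolding msum_def by blast
qed

lemma msum_upper: "submodule_over S M \<Longrightarrow> N \<subseteq> msum M N" "submodule_over S N \<Longrightarrow> M \<subseteq> msum M N"
proof -
  show "N \<subseteq> msum M N" if "submodule_over S M"
  proof
    fix x assume "x \<in> N"
    then have "0 + x \<in> msum M N" unfolding msum_def using submodule_overD(1)[OF that] by blast
    then show "x \<in> msum M N" by simp
  qed
  show "M \<subseteq> msum M N" if "submodule_over S N"
  proof
    fix x assume "x \<in> M"
    then have "x + 0 \<in> msum M N" unfolding msum_def using submodule_overD(1)[OF that] by blast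
    then show "x \<in> msum M N" by simp
  qed
qed

lemma sum_single:
  fixes f :: "'i \<Rightarrow> 'a::field ^ 'n"
  shows "finite A \<Longrightarrow> a \<in> A \<Longrightarrow> (\<Sum>x\<in>A. (if x = a then c else 0) *s f x) = c *s f a"
  by (simp add: if_distrib[of "\<lambda>c. c *s _"] cong: if_cong)

text \<open>The coefficient of \<open>b\<close> ranges over a set that depends on the level of \<open>b\<close> only. Lattices
between \<open>L\<close> and \<open>\<pi> L\<close>, and the complementary polar parts, have this form in an adapted basis.\<close>

definition graded :: "(nat \<Rightarrow> 'a set) \<Rightarrow> ('a::field ^ 'n::finite) set \<Rightarrow> ('a ^ 'n \<Rightarrow> nat) \<Rightarrow> ('a ^ 'n) set" where
  "graded Q B lev = {\<Sum>b\<in>B. s b *s b | s. \<forall>b\<in>B. s b \<in> Q (lev b)}"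

lemma gradedI: "(\<And>b. b \<in> B \<Longrightarrow> s b \<in> Q (lev b)) \<Longrightarrow> x = (\<Sum>b\<in>B. s b *s b) \<Longrightarrow> x \<in> graded Q B lev"
  unfolding graded_def by blast

lemma submodule_graded:
  assumes "\<And>l. 0 \<in> Q l" "\<And>l x y. x \<in> Q l \<Longrightarrow> y \<in> Q l \<Longrightarrow> x + y \<in> Q l"
    "\<And>l c x. c \<in> S \<Longrightarrow> x \<in> Q l \<Longrightarrow> c * x \<in> Q l"
  shows "submodule_over S (graded Q B lev)"
  unfolding submodule_over_def
proof (intro conjI ballI)
  show "0 \<in> graded Q B lev" unfolding graded_def
    using assms(1) by (auto intro!: exI[of _ "\<lambda>_. 0"])
next
  fix x y assume "x \<in> graded Q B lev" "y \<in> graded Q B lev"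
  then obtain s s' where *: "\<forall>b\<in>B. s b \<in> Q (lev b)" "\<forall>b\<in>B. s' b \<in> Q (lev b)"
    "x = (\<Sum>b\<in>B. s b *s b)" "y = (\<Sum>b\<in>B. s' b *s b)" unfolding graded_def by blast
  then have "x + y = (\<Sum>b\<in>B. (s b + s' b) *s b)" by (simp add: vec.scale_left_distrib sum.distrib)
  moreover have "\<forall>b\<in>B. s b + s' b \<in> Q (lev b)" using *(1,2) assms(2) by simp
  ultimately show "x + y \<in> graded Q B lev" by (intro gradedI[where s = "\<lambda>b. s b + s' b"]) auto
next
  fix c x assume c: "c \<in> S" and "x \<in> graded Q B lev"
  then obtain s where *: "\<forall>b\<in>B. s b \<in> Q (lev b)" "x = (\<Sum>b\<in>B. s b *s b)" unfolding graded_def by blast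
  then have "c *s x = (\<Sum>b\<in>B. (c * s b) *s b)" by (simp add: vec.scale_sum_right vector_smult_assoc)
  moreover have "\<forall>b\<in>B. c * s b \<in> Q (lev b)" using *(1) assms(3) c by simp
  ultimately show "c *s x \<in> graded Q B lev" by (intro gradedI[where s = "\<lambda>b. c * s b"]) auto
qed

lemma graded_cong:
  assumes "\<And>b. b \<in> B \<Longrightarrow> Q (lev b) = Q' (lev b)"
  shows "graded Q B lev = graded Q' B lev"
proof -
  have "(\<forall>b\<in>B. s b \<in> Q (lev b)) \<longleftrightarrow> (\<forall>b\<in>B. s b \<in> Q' (lev b))" for s using assms by auto
  then show ?thesis by (simp only: graded_def)
qed

lemma graded_single:
  assumes "finite B" "b \<in> B" "c \<in> Q (lev b)" "\<And>l. 0 \<in> Q l"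
  shows "c *s b \<in> graded Q B lev"
  by (rule gradedI[of B "\<lambda>x. if x = b then c else 0"]) (use assms in \<open>auto simp: sum_single\<close>)

definition combos :: "'a set \<Rightarrow> ('a::field ^ 'n::finite) set \<Rightarrow> ('a ^ 'n) set" where
  "combos S B = {\<Sum>b\<in>B. c b *s b | c. \<forall>b\<in>B. c b \<in> S}"

lemma combosI: "(\<And>b. b \<in> B \<Longrightarrow> c b \<in> S) \<Longrightarrow> x = (\<Sum>b\<in>B. c b *s b) \<Longrightarrow> x \<in> combos S B"
  unfolding combos_def by blast

lemma combos_graded: "combos S B = graded (\<lambda>_. S) B lev"
  by (simp add: combos_def graded_def)

lemma submodule_combos: "subring_of S \<Longrightarrow> submodule_over S (combos S B)"
  unfolding combos_graded[of S B "\<lambda>_. 0"] by (rule submodule_graded) (auto intro: subring_ofD)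

lemma combos_base:
  assumes "subring_of S" "finite B" "b \<in> B"
  shows "b \<in> combos S B"
  using graded_single[OF assms(2,3), of 1 "\<lambda>_. S"] subring_ofD(1,2)[OF assms(1)] by (simp add: combos_graded[of S B "\<lambda>_. 0"])

lemma combos_subset: "submodule_over S M \<Longrightarrow> B \<subseteq> M \<Longrightarrow> combos S B \<subseteq> M"
  unfolding combos_def by (auto intro!: submodule_over_sum submodule_overD(3))

lemma combos_mono: "S \<subseteq> T \<Longrightarrow> combos S B \<subseteq> combos T B"
  unfolding combos_def by blast

lemma combos_UNIV: "finite B \<Longrightarrow> combos UNIV B = vec.span B"
  by (auto simp: combos_def vec.span_finite)

lemma cst_add: "cst (a + b) = cst a + cst b" and cst_mult: "cst (a * b) = cst a * cst b"
  and cst_0: "cst 0 = 0" and cst_1: "cst 1 = 1"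
  by (simp_all flip: to_fract_add to_fract_mult one_pCons)

text \<open>The scalars \<open>k\<close> form a type, so linear algebra over \<open>k\<close> inside \<open>K\<^sup>n\<close> is an instance of the
theory of vector spaces. This is not so for \<open>R\<close> and the valuation rings, which are subsets of \<open>K\<close>.\<close>

lemma vector_space_over_constants: "vector_space (\<lambda>c (x :: 'k::field ratfun ^ 'n::finite). cst c *s x)"
proof
  fix a b :: 'k and x y :: "'k ratfun ^ 'n"
  show "cst a *s (x + y) = cst a *s x + cst a *s y" by (rule vector_add_ldistrib)
  show "cst (a + b) *s x = cst a *s x + cst b *s x" unfolding cst_add by (rule vec.scale_left_distrib)
  show "cst a *s (cst b *s x) = cst (a * b) *s x" unfolding cst_mult by (rule vector_smult_assoc)
  show "cst 1 *s x = x" unfolding cst_1 by simp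
qed
interpretation kvec: vector_space "\<lambda>c (x :: 'k::field ratfun ^ 'n::finite). cst c *s x"
  by (rule vector_space_over_constants)

lemma ksubspace_iff: "kvec.subspace U \<longleftrightarrow> submodule_over consts_in U"
  unfolding kvec.subspace_def submodule_over_def by (simp add: ball_simps)

lemma combos_consts: "finite B \<Longrightarrow> combos consts_in B = kvec.span B"
  unfolding combos_def kvec.span_finite
proof (intro equalityI subsetI)
  fix x assume "x \<in> {\<Sum>b\<in>B. c b *s b |c. \<forall>b\<in>B. c b \<in> consts_in}"
  then obtain c where c: "\<forall>b\<in>B. c b \<in> consts_in" "x = (\<Sum>b\<in>B. c b *s b)" by blast
  then have *: "\<forall>b\<in>B. \<exists>d. c b = cst d" by blast
  obtain d where "\<forall>b\<in>B. c b = cst (d b)" using bchoice[OF *] by blast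
  then have "x = (\<Sum>b\<in>B. cst (d b) *s b)" using c by simp
  then show "x \<in> range (\<lambda>u. \<Sum>v\<in>B. cst (u v) *s v)" by blast
qed auto

lemma consts_val_ring: "consts_in \<subseteq> val_ring e" using cst_in_val_ring by blast
lemma consts_laurent: "consts_in \<subseteq> laurent" using cst_in_laurent by blast

section \<open>Lattices\<close>

definition colmat :: "('n::finite \<Rightarrow> 'a::field ^ 'n) \<Rightarrow> 'a ^ 'n ^ 'n" where
  "colmat f = (\<chi> i j. f j $ i)"

definition std_module :: "'a set \<Rightarrow> ('a ^ 'n::finite) set" where
  "std_module S = {v. \<forall>i. v $ i \<in> S}"

lemma colmat_mult: "colmat f *v x = (\<Sum>i\<in>UNIV. x $ i *s f i)"
  unfolding colmat_def matrix_mult_sum column_def by simp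

lemma colmat_columns: "colmat (\<lambda>j. column j F) = F"
  by (simp add: colmat_def column_def vec_eq_iff)

lemma lincombs_colmat:
  fixes f :: "'n::finite \<Rightarrow> 'a::field ^ 'n"
  shows "lincombs S f = (\<lambda>v. colmat f *v v) ` std_module S"
proof (intro equalityI subsetI)
  fix x assume "x \<in> lincombs S f"
  then obtain c where c: "range c \<subseteq> S" "x = (\<Sum>i\<in>UNIV. c i *s f i)" unfolding lincombs_def by blast
  then show "x \<in> (\<lambda>v. colmat f *v v) ` std_module S"
    by (intro image_eqI[of _ _ "\<chi> i. c i"]) (auto simp: colmat_mult std_module_def)
next
  fix x assume "x \<in> (\<lambda>v. colmat f *v v) ` std_module S"
  then obtain v :: "'a ^ 'n" where "x = colmat f *v v" "\<forall>i. v $ i \<in> S" unfolding std_module_def by blast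
  then show "x \<in> lincombs S f" unfolding lincombs_def colmat_mult by (auto intro!: exI[of _ "($) v"])
qed

lemma inverse_matrix:
  fixes F :: "'a::field ^ 'n::finite ^ 'n"
  assumes "det F \<noteq> 0"
  obtains G where "F ** G = mat 1" "G ** F = mat 1" "det G = inverse (det F)"
proof -
  obtain G where G: "F ** G = mat 1" "G ** F = mat 1"
    using assms unfolding invertible_det_nz[symmetric] invertible_def by blast
  then have "det F * det G = 1" by (metis det_mul det_I)
  then have "det G = inverse (det F)" using assms by (metis inverse_unique)
  then show ?thesis using that G by blast
qed

lemma det_colmat_iff:
  fixes f :: "'n::finite \<Rightarrow> 'a::field ^ 'n"
  shows "det (colmat f) \<noteq> 0 \<longleftrightarrow> (\<forall>c. (\<Sum>i\<in>UNIV. c i *s f i) = 0 \<longrightarrow> (\<forall>i. c i = 0))"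
proof -
  have "det (colmat f) \<noteq> 0 \<longleftrightarrow> (\<forall>x. colmat f *v x = 0 \<longrightarrow> x = 0)"
    unfolding invertible_det_nz[symmetric] invertible_left_inverse matrix_left_invertible_ker ..
  also have "\<dots> \<longleftrightarrow> (\<forall>c. (\<Sum>i\<in>UNIV. c i *s f i) = 0 \<longrightarrow> (\<forall>i. c i = 0))"
  proof (intro iffI allI impI)
    fix c i assume *: "\<forall>x. colmat f *v x = 0 \<longrightarrow> x = 0" "(\<Sum>i\<in>UNIV. c i *s f i) = 0"
    have "colmat f *v (\<chi> i. c i) = 0" using *(2) by (simp add: colmat_mult)
    then have "(\<chi> i. c i) = 0" using *(1) by blast
    then show "c i = 0" by (simp add: vec_eq_iff)
  next
    fix x :: "'a ^ 'n"
    assume *: "\<forall>c. (\<Sum>i\<in>UNIV. c i *s f i) = 0 \<longrightarrow> (\<forall>i. c i = 0)" "colmat f *v x = 0"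
    have "\<forall>i. x $ i = 0" using *(1)[rule_format, of "\<lambda>i. x $ i"] *(2) unfolding colmat_mult by blast
    then show "x = 0" by (simp add: vec_eq_iff)
  qed
  finally show ?thesis .
qed

lemmas det_colmatD = det_colmat_iff[THEN iffD1, rule_format]

lemma coeffs_unique:
  fixes f :: "'n::finite \<Rightarrow> 'a::field ^ 'n"
  assumes "det (colmat f) \<noteq> 0" "(\<Sum>i\<in>UNIV. c i *s f i) = (\<Sum>i\<in>UNIV. d i *s f i)"
  shows "c i = d i"
proof -
  have "(\<Sum>i\<in>UNIV. (c i - d i) *s f i) = 0"
    using assms(2) by (simp add: vec.scale_left_diff_distrib sum_subtractf)
  from det_colmatD[OF assms(1) this, of i] show ?thesis by simp
qed

lemma det_colmat_scaled:
  assumes "det (colmat f) \<noteq> 0" "\<And>i. s i \<noteq> 0"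
  shows "det (colmat (\<lambda>i. s i *s f i)) \<noteq> 0"
  unfolding det_colmat_iff
proof (intro allI impI)
  fix c i assume "(\<Sum>i\<in>UNIV. c i *s (s i *s f i)) = 0"
  then have "(\<Sum>i\<in>UNIV. (c i * s i) *s f i) = 0" by (simp add: vector_smult_assoc)
  from det_colmatD[OF assms(1) this, of i] show "c i = 0" using assms(2) by simp
qed

text \<open>Independence over \<open>S\<close> is independence over its field of fractions, by clearing denominators.\<close>

lemma basis_over_det:
  fixes f :: "'n::finite \<Rightarrow> 'a::field ^ 'n"
  assumes S: "subring_of S" "\<And>x. \<exists>s\<in>S. s \<noteq> 0 \<and> s * x \<in> S"
  shows "basis_over S f M \<longleftrightarrow> det (colmat f) \<noteq> 0 \<and> M = lincombs S f"
proof -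
  have "det (colmat f) \<noteq> 0" if f: "basis_over S f M"
    unfolding det_colmat_iff
  proof (intro allI impI)
    fix c i assume c: "(\<Sum>i\<in>UNIV. c i *s f i) = 0"
    obtain s where s: "s \<in> S" "s \<noteq> 0" "\<forall>i\<in>UNIV. s * c i \<in> S"
      using common_denominator[OF S, of UNIV c] by auto
    have "(\<Sum>i\<in>UNIV. (s * c i) *s f i) = s *s (\<Sum>i\<in>UNIV. c i *s f i)"
      by (simp add: vec.scale_sum_right vector_smult_assoc)
    then have "(\<Sum>i\<in>UNIV. (s * c i) *s f i) = 0" using c by simp
    moreover have "range (\<lambda>i. s * c i) \<subseteq> S" using s(3) by auto
    ultimately have "\<forall>i. s * c i = 0" using f unfolding basis_over_def by blast
    then show "c i = 0" using s(2) by simp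
  qed
  moreover have "basis_over S f (lincombs S f)" if "det (colmat f) \<noteq> 0"
    unfolding basis_over_def using det_colmatD[OF that] by blast
  ultimately show ?thesis unfolding basis_over_def by metis
qed

lemmas basis_over_val_ring = basis_over_det[OF subring_val_ring val_ring_frac]
lemmas basis_over_laurent = basis_over_det[OF subring_laurent laurent_frac]

lemma lattice_in_matrix:
  "lattice_in e L \<longleftrightarrow> (\<exists>F. det F \<noteq> 0 \<and> L = (\<lambda>v. F *v v) ` std_module (val_ring e))"
proof -
  have "(\<exists>f. det (colmat f) \<noteq> 0 \<and> L = (\<lambda>v. colmat f *v v) ` std_module (val_ring e)) \<longleftrightarrow>
      (\<exists>F. det F \<noteq> 0 \<and> L = (\<lambda>v. F *v v) ` std_module (val_ring e))"
  proof (intro iffI)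
    assume "\<exists>F. det F \<noteq> 0 \<and> L = (\<lambda>v. F *v v) ` std_module (val_ring e)"
    then obtain F where "det F \<noteq> 0 \<and> L = (\<lambda>v. F *v v) ` std_module (val_ring e)" ..
    then show "\<exists>f. det (colmat f) \<noteq> 0 \<and> L = (\<lambda>v. colmat f *v v) ` std_module (val_ring e)"
      by (intro exI[of _ "\<lambda>j. column j F"]) (simp add: colmat_columns)
  qed blast
  then show ?thesis unfolding lattice_in_def basis_over_val_ring lincombs_colmat .
qed

lemma submodule_std: "subring_of S \<Longrightarrow> submodule_over S (std_module S)"
  unfolding submodule_over_def std_module_def by (auto intro: subring_ofD)

lemma submodule_image:
  assumes "submodule_over S M"
  shows "submodule_over S ((\<lambda>v. F *v v) ` M)"
  unfolding submodule_over_def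
proof (intro conjI ballI)
  show "0 \<in> (*v) F ` M" using submodule_overD(1)[OF assms] by (intro image_eqI[of _ _ 0]) simp_all
next
  fix x y assume "x \<in> (*v) F ` M" "y \<in> (*v) F ` M"
  then show "x + y \<in> (*v) F ` M" using submodule_overD(2)[OF assms]
    by (auto simp: matrix_vector_right_distrib[symmetric])
next
  fix c x assume "c \<in> S" "x \<in> (*v) F ` M"
  then show "c *s x \<in> (*v) F ` M" using submodule_overD(3)[OF assms]
    by (auto simp: vec.scale[symmetric])
qed

lemma lattice_submodule: "lattice_in e L \<Longrightarrow> submodule_over (val_ring e) L"
  unfolding lattice_in_matrix by (auto intro: submodule_image submodule_std subring_val_ring)

lemma lattice_absorbs:
  fixes x :: "'k::field ratfun ^ 'n::finite"
  assumes "lattice_in e L"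
  shows "\<forall>\<^sub>F s in sequentially. unif e ^ s *s x \<in> L"
proof -
  obtain F where F: "det F \<noteq> 0" "L = (\<lambda>v. F *v v) ` std_module (val_ring e)"
    using assms unfolding lattice_in_matrix by blast
  obtain G where G: "F ** G = mat 1" using inverse_matrix[OF F(1)] by blast
  have "\<forall>\<^sub>F s in sequentially. \<forall>i. unif e ^ s * (G *v x) $ i \<in> val_ring e"
    by (intro eventually_all_finite eventually_in_val_ring)
  then show ?thesis
  proof eventually_elim
    case (elim s)
    have "unif e ^ s *s x = F *v (unif e ^ s *s (G *v x))"
      by (simp add: vec.scale[symmetric] matrix_vector_mul_assoc G)
    then show ?case using elim unfolding F(2) std_module_def by auto
  qed
qed

lemma lattice_bounded:
  fixes \<phi> :: "'k::field ratfun ^ 'n::finite ^ 'n"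
  assumes "lattice_in e L"
  obtains s where "\<And>x i. x \<in> L \<Longrightarrow> unif e ^ s * (\<phi> *v x) $ i \<in> val_ring e"
proof -
  obtain F where F: "det F \<noteq> 0" "L = (\<lambda>v. F *v v) ` std_module (val_ring e)"
    using assms unfolding lattice_in_matrix by blast
  have "\<forall>\<^sub>F s in sequentially. \<forall>i j. unif e ^ s * (\<phi> ** F) $ i $ j \<in> val_ring e"
    by (intro eventually_all_finite eventually_in_val_ring)
  then obtain s where s: "\<And>i j. unif e ^ s * (\<phi> ** F) $ i $ j \<in> val_ring e"
    unfolding eventually_sequentially by blast
  have "unif e ^ s * (\<phi> *v x) $ i \<in> val_ring e" if xL: "x \<in> L" for x i
  proof -
    obtain v :: "'k ratfun ^ 'n" where v: "\<And>j. v $ j \<in> val_ring e" "x = F *v v"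
      using xL unfolding F(2) std_module_def by blast
    have "unif e ^ s * (\<phi> *v x) $ i = (\<Sum>j\<in>UNIV. unif e ^ s * (\<phi> ** F) $ i $ j * v $ j)"
      unfolding v(2) matrix_vector_mul_assoc
      by (simp add: matrix_vector_mult_def sum_distrib_left mult_ac)
    also have "\<dots> \<in> val_ring e"
    proof -
      have "(\<Sum>j\<in>I. unif e ^ s * (\<phi> ** F) $ i $ j * v $ j) \<in> val_ring e" if "finite I" for I
        using that by induction (auto intro!: val_ring_closed(1,3) val_ring_mult s v(1))
      then show ?thesis by simp
    qed
    finally show ?thesis .
  qed
  then show ?thesis using that by blast
qed

text \<open>Such a matrix embeds \<open>K\<^sup>n / W\<close> into \<open>K\<^sup>n\<close> and maps \<open>R\<^sup>n\<close> into \<open>R\<^sup>n\<close>, so that questions modulo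
\<open>W\<close> can be answered in coordinates.\<close>

lemma integral_matrix_with_kernel:
  fixes W :: "('k::field ratfun ^ 'n::finite) set"
  assumes W: "vec.subspace W"
  obtains \<phi> :: "'k ratfun ^ 'n ^ 'n" where "\<And>x. \<phi> *v x = 0 \<longleftrightarrow> x \<in> W"
    "\<And>x i. x \<in> free_laurent \<Longrightarrow> (\<phi> *v x) $ i \<in> laurent"
proof -
  obtain B where B: "B \<subseteq> W" "vec.independent B" "W \<subseteq> vec.span B"
    by (rule vec.maximal_independent_subset[of W])
  obtain C where C: "B \<subseteq> C" "vec.independent C" "UNIV \<subseteq> vec.span C"
    by (rule vec.maximal_independent_subset_extend[OF subset_UNIV B(2)])
  have span: "vec.span B = W" using B W by (metis vec.span_subspace)
  define f where "f x = (if x \<in> B then 0 else x)" for x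
  obtain g where g: "Vector_Spaces.linear (*s) (*s) g" "\<And>x. x \<in> C \<Longrightarrow> g x = f x"
    using vec.linear_independent_extend[OF C(2), of f] by blast
  interpret g: Vector_Spaces.linear "(*s)" "(*s)" g by (rule g)
  have gW: "g x = 0" if "x \<in> W" for x
  proof -
    have "x \<in> vec.span B" using that span by simp
    then show ?thesis
      by (induction rule: vec.span_induct_alt)
        (use C(1) in \<open>auto simp: g.add g.scale g.zero g(2) f_def subset_iff\<close>)
  qed
  have gC: "g y = y" if "y \<in> vec.span (C - B)" for y
    using that by (induction rule: vec.span_induct_alt) (auto simp: g.add g.scale g.zero g(2) f_def)
  have ker: "g x = 0 \<longleftrightarrow> x \<in> W" for x
  proof
    assume gx: "g x = 0"
    have "x \<in> vec.span (B \<union> (C - B))" using C by (simp add: Un_absorb1 subset_iff)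
    then obtain w y where wy: "x = w + y" "w \<in> vec.span B" "y \<in> vec.span (C - B)"
      unfolding vec.span_Un by blast
    then have "y = 0" using gx gW gC span by (simp add: g.add)
    then show "x \<in> W" using wy span by simp
  qed (rule gW)
  obtain s where s: "s \<in> laurent" "s \<noteq> 0" "\<forall>i\<in>UNIV. s * matrix g $ (fst i) $ (snd i) \<in> laurent"
    using common_denominator[OF subring_laurent laurent_frac, of UNIV "\<lambda>i. matrix g $ (fst i) $ (snd i)"]
    by auto
  define \<phi> where "\<phi> = (\<chi> i j. s * matrix g $ i $ j)"
  have phi: "\<phi> *v x = s *s g x" for x
  proof -
    have "\<phi> *v x = s *s (matrix g *v x)"
      by (simp add: \<phi>_def matrix_vector_mult_def vec_eq_iff sum_distrib_left mult.assoc)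
    then show ?thesis by (simp only: matrix_works[OF g(1)])
  qed
  have "(\<phi> *v x) $ i \<in> laurent" if "x \<in> free_laurent" for x i
  proof -
    have "(\<Sum>j\<in>I. s * matrix g $ i $ j * x $ j) \<in> laurent" if "finite I" for I
      using that
    proof induction
      case (insert j I)
      then show ?case using s(3)[rule_format, of "(i, j)"] \<open>x \<in> free_laurent\<close>
        by (auto simp: free_laurent_def intro!: laurent_closed(3,4))
    qed (simp add: laurent_closed(1))
    from this[of UNIV] show ?thesis by (simp add: matrix_vector_mult_def \<phi>_def)
  qed
  moreover have "\<phi> *v x = 0 \<longleftrightarrow> x \<in> W" for x using phi ker s(2) by simp
  ultimately show ?thesis using that by blast
qed

text \<open>After a sufficiently negative twist the coordinates of a section modulo \<open>W\<close> are Laurent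
polynomials whose valuations at the two places would have a positive sum, so they vanish.\<close>

lemma no_sections:
  fixes W :: "('k::field ratfun ^ 'n::finite) set"
  assumes L: "lattice_in e L" and L': "lattice_in (opp e) L'" and W: "vec.subspace W"
  obtains a where "\<And>x. x \<in> free_laurent \<Longrightarrow> x \<in> msum L W \<Longrightarrow> unif e ^ a *s x \<in> msum L' W \<Longrightarrow> x \<in> W"
proof -
  obtain \<phi> :: "'k ratfun ^ 'n ^ 'n" where ker: "\<And>x. \<phi> *v x = 0 \<longleftrightarrow> x \<in> W"
    and int: "\<And>x i. x \<in> free_laurent \<Longrightarrow> (\<phi> *v x) $ i \<in> laurent"
    by (rule integral_matrix_with_kernel[OF W]) blast
  obtain p where p: "\<And>x i. x \<in> L \<Longrightarrow> unif e ^ p * (\<phi> *v x) $ i \<in> val_ring e"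
    using lattice_bounded[OF L, of \<phi>] by blast
  obtain q where q: "\<And>x i. x \<in> L' \<Longrightarrow> unif (opp e) ^ q * (\<phi> *v x) $ i \<in> val_ring (opp e)"
    using lattice_bounded[OF L', of \<phi>] by blast
  have "x \<in> W" if x: "x \<in> free_laurent" "x \<in> msum L W" "unif e ^ (q + p + 1) *s x \<in> msum L' W" for x
  proof -
    obtain l w where l: "l \<in> L" "w \<in> W" "x = l + w" using x(2) unfolding msum_def by blast
    obtain l' w' where l': "l' \<in> L'" "w' \<in> W" "unif e ^ (q + p + 1) *s x = l' + w'"
      using x(3) unfolding msum_def by blast
    have "\<phi> *v w = 0" "\<phi> *v w' = 0" using ker l(2) l'(2) by blast+
    moreover have "unif e ^ (q + p + 1) *s (\<phi> *v x) = \<phi> *v (l' + w')"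
      unfolding l'(3)[symmetric] by (rule vec.scale[symmetric])
    ultimately have 1: "\<phi> *v x = \<phi> *v l" "unif e ^ (q + p + 1) *s (\<phi> *v x) = \<phi> *v l'"
      unfolding l(3) by (simp_all only: matrix_vector_right_distrib add_0_right)
    have "(\<phi> *v x) $ i = 0" for i
    proof -
      define r where "r = unif e ^ p * (\<phi> *v x) $ i"
      have "unif e ^ p \<in> (laurent :: 'k ratfun set)" using unif_powi_in_laurent[of e "int p"] by simp
      then have "r \<in> laurent" unfolding r_def using int[OF x(1)] by (intro laurent_closed(4))
      moreover have "r \<in> val_ring e" unfolding r_def 1(1) by (rule p[OF l(1)])
      moreover have "unif (opp e) ^ q * (\<phi> *v l') $ i = unif e * r"
        unfolding 1(2)[symmetric] r_def unif_opp by (simp add: power_add field_simps)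
      then have "unif e * r \<in> val_ring (opp e)" using q[OF l'(1), of i] by simp
      ultimately have "r = 0" by (rule laurent_disjoint)
      then show ?thesis unfolding r_def by simp
    qed
    then have "\<phi> *v x = 0" by (simp add: vec_eq_iff)
    then show ?thesis using ker by blast
  qed
  then show ?thesis using that by blast
qed

section \<open>Sections of the first twist that has any\<close>

lemma val_neg_if_not_integral:
  assumes "x \<notin> val_ring e"
  shows "val e x < 0"
  using assms by (simp add: val_ring_def)

lemma submodule_shift: "submodule_over (val_ring e) M \<Longrightarrow> x \<in> M \<Longrightarrow> 0 \<le> m \<Longrightarrow> unif e powi m *s x \<in> M"
  by (rule submodule_overD(3)) (auto simp: val_ring_def val_unif_powi)

text \<open>\<open>\<Lambda>\<close> and \<open>\<Lambda>'\<close> stand for the preimages of two lattices of \<open>K\<^sup>n / W\<close>, and \<open>gap\<close> says that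
their bundle twisted by \<open>-1\<close> has no sections. \<open>B\<close> consists of sections of the bundle itself.\<close>

locale section_space =
  fixes e :: pm and W \<Lambda> \<Lambda>' :: "('k::field ratfun ^ 'n::finite) set" and B
  assumes W: "vec.subspace W"
    and \<Lambda>: "submodule_over (val_ring e) \<Lambda>" "W \<subseteq> \<Lambda>"
    and \<Lambda>': "submodule_over (val_ring (opp e)) \<Lambda>'" "W \<subseteq> \<Lambda>'"
    and gap: "\<And>x. x \<in> free_laurent \<Longrightarrow> x \<in> \<Lambda> \<Longrightarrow> unif e *s x \<in> \<Lambda>' \<Longrightarrow> x \<in> W"
    and B: "finite B" "B \<subseteq> free_laurent" "B \<subseteq> \<Lambda>" "B \<subseteq> \<Lambda>'"
    and indep: "\<And>\<gamma>. (\<Sum>b\<in>B. cst (\<gamma> b) *s b) \<in> W \<Longrightarrow> \<forall>b\<in>B. \<gamma> b = 0"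
begin

lemma W_submodule: "submodule_over S W"
  using W by (rule submodule_over_subspace)

text \<open>Reduction modulo \<open>\<pi>\<Lambda>\<close> is injective on the \<open>k\<close>-span of \<open>B\<close>: a section that vanishes at \<open>e\<close> is,
after division by \<open>\<pi>\<close>, a section of the bundle twisted by \<open>-1\<close>.\<close>

lemma residue_indep:
  assumes "y \<in> \<Lambda>" "(\<Sum>b\<in>B. cst (\<gamma> b) *s b) = unif e *s y"
  shows "\<forall>b\<in>B. \<gamma> b = 0"
proof -
  define z where "z = (\<Sum>b\<in>B. cst (\<gamma> b) *s b)"
  have y: "y = inverse (unif e) *s z" using assms(2) by (simp add: z_def vector_smult_assoc)
  have "z \<in> free_laurent" unfolding z_def using B(2)
    by (intro submodule_over_sum[OF submodule_free_laurent] submodule_overD(3)[OF submodule_free_laurent]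
        cst_in_laurent) auto
  then have "y \<in> free_laurent"
    unfolding y using submodule_overD(3)[OF submodule_free_laurent] unif_powi_in_laurent[of e "- 1"] by auto
  moreover have "z \<in> \<Lambda>'" unfolding z_def using B(4)
    by (intro submodule_over_sum[OF \<Lambda>'(1)] submodule_overD(3)[OF \<Lambda>'(1)] cst_in_val_ring) auto
  ultimately have "y \<in> W" using gap assms(1) unfolding y by (simp add: vector_smult_assoc)
  then have "z \<in> W" unfolding z_def assms(2) using W by (rule vec.subspace_scale[rotated])
  then show ?thesis using indep unfolding z_def by blast
qed

text \<open>By \<open>residue_indep\<close> the sections are part of a basis of the lattice \<open>\<Lambda> / W\<close>: scaling the worst
coefficient to a unit would produce a constant relation in the residue field.\<close>

lemma coeffs_integral:
  assumes x: "x \<in> \<Lambda>" and w: "x - (\<Sum>b\<in>B. c b *s b) \<in> W" and "b \<in> B"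
  shows "c b \<in> val_ring e"
proof (rule ccontr)
  assume "c b \<notin> val_ring e"
  define m where "m = Min ((\<lambda>b. val e (c b)) ` B)"
  have m: "m \<le> val e (c b)" if "b \<in> B" for b unfolding m_def using B(1) that by simp
  obtain b0 where b0: "b0 \<in> B" "val e (c b0) = m"
  proof -
    have "m \<in> (\<lambda>b. val e (c b)) ` B" unfolding m_def using B(1) \<open>b \<in> B\<close> by (intro Min_in) auto
    then show ?thesis using that by blast
  qed
  have neg: "m < 0" using m[OF \<open>b \<in> B\<close>] val_neg_if_not_integral[OF \<open>c b \<notin> val_ring e\<close>] by simp
  define d :: "'k ratfun ^ 'n \<Rightarrow> 'k ratfun" where "d b = unif e powi (- m) * c b" for b
  have d: "d b \<in> val_ring e" if "b \<in> B" for b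
    using m[OF that] by (cases "c b = 0") (auto simp: d_def val_ring_def val_mult val_unif_powi)
  have "c b0 \<noteq> 0" using b0 neg by auto
  then have d0: "val e (d b0) = 0" "d b0 \<noteq> 0" using b0 neg by (auto simp: d_def val_mult val_unif_powi)
  have "\<exists>g y. y \<in> val_ring e \<and> d b = cst g + unif e * y" if "b \<in> B" for b
    by (rule residue[OF d[OF that]]) blast
  then obtain \<gamma> y where gy: "\<And>b. b \<in> B \<Longrightarrow> y b \<in> val_ring e \<and> d b = cst (\<gamma> b) + unif e * y b"
    by metis
  define w' where "w' = x - (\<Sum>b\<in>B. c b *s b)"
  define z where "z = unif e powi (- m - 1) *s x - unif e powi (- m - 1) *s w' - (\<Sum>b\<in>B. y b *s b)"
  have 1: "(\<Sum>b\<in>B. d b *s b) = unif e powi (- m) *s (x - w')"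
    by (simp add: w'_def d_def vec.scale_sum_right vector_smult_assoc)
  have 2: "(\<Sum>b\<in>B. d b *s b) = (\<Sum>b\<in>B. cst (\<gamma> b) *s b) + unif e *s (\<Sum>b\<in>B. y b *s b)"
    using gy by (simp add: vec.scale_sum_right vector_smult_assoc vec.scale_left_distrib flip: sum.distrib)
  have "unif e * unif e powi (- m - 1) = (unif e powi (- m) :: 'k ratfun)"
    by (simp add: power_int_diff)
  then have 3: "unif e *s z = unif e powi (- m) *s x - unif e powi (- m) *s w' - unif e *s (\<Sum>b\<in>B. y b *s b)"
    by (simp only: z_def vec.scale_right_diff_distrib vector_smult_assoc)
  have "(\<Sum>b\<in>B. cst (\<gamma> b) *s b) = (\<Sum>b\<in>B. d b *s b) - unif e *s (\<Sum>b\<in>B. y b *s b)"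
    unfolding 2 by simp
  also have "\<dots> = unif e *s z" unfolding 1 3 vec.scale_right_diff_distrib ..
  finally have "(\<Sum>b\<in>B. cst (\<gamma> b) *s b) = unif e *s z" .
  moreover have "z \<in> \<Lambda>" unfolding z_def
  proof (intro submodule_over_diff[OF \<Lambda>(1) subring_val_ring] submodule_over_sum[OF \<Lambda>(1)])
    show "unif e powi (- m - 1) *s x \<in> \<Lambda>" using submodule_shift[OF \<Lambda>(1) x] neg by simp
    show "unif e powi (- m - 1) *s w' \<in> \<Lambda>"
      using submodule_overD(3)[OF W_submodule[of UNIV] UNIV_I] w \<Lambda>(2) unfolding w'_def by blast
    show "y b *s b \<in> \<Lambda>" if "b \<in> B" for b
      using gy[OF that] that B(3) by (intro submodule_overD(3)[OF \<Lambda>(1)]) auto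
  qed
  ultimately have "\<gamma> b0 = 0" using residue_indep b0(1) by blast
  then have "d b0 = unif e * y b0" using gy[OF b0(1)] by simp
  moreover have "y b0 \<noteq> 0" using calculation d0 by auto
  ultimately have "val e (d b0) \<ge> 1" using gy[OF b0(1)] by (simp add: val_mult val_unif val_ring_def)
  then show False using d0 by simp
qed

lemma coeffs_zero:
  assumes "(\<Sum>b\<in>B. c b *s b) \<in> W" "b \<in> B"
  shows "c b = 0"
proof (rule ccontr)
  assume nz: "c b \<noteq> 0"
  define s :: "'k ratfun" where "s = unif e powi (- val e (c b) - 1)"
  have "(\<Sum>b\<in>B. (s * c b) *s b) = s *s (\<Sum>b\<in>B. c b *s b)"
    by (simp add: vec.scale_sum_right vector_smult_assoc)
  then have "0 - (\<Sum>b\<in>B. (s * c b) *s b) \<in> W"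
    using vec.subspace_neg[OF W vec.subspace_scale[OF W assms(1), of s]] by simp
  from coeffs_integral[OF submodule_overD(1)[OF \<Lambda>(1)] this assms(2)]
  have "0 \<le> val e (s * c b)" by (simp add: val_ring_def)
  also have "val e (s * c b) = -1" using nz by (simp add: s_def val_mult val_unif_powi)
  finally show False by simp
qed

text \<open>The sections span a saturated submodule over \<open>R\<close>. By \<open>partial_fractions\<close>, the coefficients can
be changed by Laurent polynomials so that the combination becomes a section of the bundle twisted by
\<open>-1\<close>, hence trivial.\<close>

lemma coeffs_laurent:
  assumes x: "x \<in> free_laurent" and w: "x - (\<Sum>b\<in>B. c b *s b) \<in> W" and "b \<in> B"
  shows "c b \<in> laurent"
proof -
  have "\<exists>r. r \<in> laurent \<and> c b - r \<in> val_ring e \<and> unif e * (c b - r) \<in> val_ring (opp e)" for b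
    by (rule partial_fractions[of "c b" e]) blast
  then obtain r where r: "\<And>b. r b \<in> laurent" "\<And>b. c b - r b \<in> val_ring e"
    "\<And>b. unif e * (c b - r b) \<in> val_ring (opp e)" by metis
  define w' where "w' = x - (\<Sum>b\<in>B. c b *s b)"
  define y where "y = x - (\<Sum>b\<in>B. r b *s b)"
  have y: "y = w' + (\<Sum>b\<in>B. (c b - r b) *s b)"
    by (simp add: y_def w'_def vec.scale_left_diff_distrib sum_subtractf)
  have "y \<in> free_laurent" unfolding y_def using B(2)
    by (intro submodule_over_diff[OF submodule_free_laurent subring_laurent x]
        submodule_over_sum[OF submodule_free_laurent] submodule_overD(3)[OF submodule_free_laurent] r(1)) auto
  moreover have "y \<in> \<Lambda>" unfolding y using w B(3) \<Lambda>(2)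
    by (intro submodule_overD(2)[OF \<Lambda>(1)] submodule_over_sum[OF \<Lambda>(1)] submodule_overD(3)[OF \<Lambda>(1)] r(2))
      (auto simp: w'_def)
  moreover have "unif e *s y \<in> \<Lambda>'"
  proof -
    have "unif e *s y = unif e *s w' + (\<Sum>b\<in>B. (unif e * (c b - r b)) *s b)"
      by (simp only: y vector_add_ldistrib vec.scale_sum_right vector_smult_assoc)
    moreover have "unif e *s w' \<in> \<Lambda>'"
      using \<Lambda>'(2) submodule_overD(3)[OF W_submodule[of UNIV] UNIV_I] w unfolding w'_def by blast
    moreover have "(\<Sum>b\<in>B. (unif e * (c b - r b)) *s b) \<in> \<Lambda>'" using B(4)
      by (intro submodule_over_sum[OF \<Lambda>'(1)] submodule_overD(3)[OF \<Lambda>'(1)] r(3)) auto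
    ultimately show ?thesis using submodule_overD(2)[OF \<Lambda>'(1)] by simp
  qed
  ultimately have "y \<in> W" by (rule gap)
  then have "(\<Sum>b\<in>B. (c b - r b) *s b) \<in> W"
    using y w vec.subspace_diff[OF W, of y w'] unfolding w'_def by simp
  from coeffs_zero[OF this \<open>b \<in> B\<close>] show ?thesis using r(1)[of b] by simp
qed

end

section \<open>Bases adapted to a stable chain of lattices\<close>

text \<open>In an adapted basis of \<open>K\<^sup>n\<close>, \<open>L j\<close> is spanned by the vectors \<open>jump e (lev b) j *s b\<close>: a vector of level \<open>l\<close>
lies in \<open>L 0, ..., L l\<close>, and only its multiple by the uniformizer lies in the later lattices.\<close>

definition jump :: "pm \<Rightarrow> nat \<Rightarrow> nat \<Rightarrow> 'k::field ratfun" where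
  "jump e l j = (if l < j then unif e else 1)"

lemma jump_neq_0 [simp]: "jump e l j \<noteq> 0"
  by (simp add: jump_def)

lemma jump_in:
  fixes e l j defines "t \<equiv> jump e l j :: 'k::field ratfun"
  shows "t \<in> val_ring e" "t \<in> laurent"
  by (auto simp: t_def jump_def unif_in_val_ring val_ring_closed unif_in_laurent laurent_closed)

lemma invariant_Int: "invariant_under \<Gamma> M \<Longrightarrow> invariant_under \<Gamma> N \<Longrightarrow> invariant_under \<Gamma> (M \<inter> N)"
  unfolding invariant_under_def by blast

lemma invariant_msum: "invariant_under \<Gamma> M \<Longrightarrow> invariant_under \<Gamma> N \<Longrightarrow> invariant_under \<Gamma> (msum M N)"
  unfolding invariant_under_def msum_def by (fastforce simp: matrix_vector_right_distrib)

lemma invariant_scaled: "invariant_under \<Gamma> M \<Longrightarrow> invariant_under \<Gamma> {x. s *s x \<in> M}"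
  unfolding invariant_under_def by (simp flip: vec.scale)

lemma submodule_scaled:
  assumes "submodule_over S M"
  shows "submodule_over S {x. s *s x \<in> M}"
  unfolding submodule_over_def
proof (intro conjI ballI CollectI)
  show "s *s 0 \<in> M" using submodule_overD(1)[OF assms] by simp
next
  fix x y assume "x \<in> {x. s *s x \<in> M}" "y \<in> {x. s *s x \<in> M}"
  then show "s *s (x + y) \<in> M"
    unfolding vector_add_ldistrib by (intro submodule_overD(2)[OF assms]) auto
next
  fix c x assume c: "c \<in> S" and "x \<in> {x. s *s x \<in> M}"
  then have "s *s x \<in> M" by simp
  from submodule_overD(3)[OF assms c this] have "c *s (s *s x) \<in> M" .
  then show "s *s (c *s x) \<in> M" by (simp add: vector_smult_assoc mult.commute)
qed

lemma invariant_span: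
  assumes "invariant_under \<Gamma> W0" "vec.subspace W0" "invariant_under \<Gamma> (vec.span B)"
  shows "invariant_under \<Gamma> (vec.span (W0 \<union> B))"
proof -
  have "vec.span (W0 \<union> B) = msum W0 (vec.span B)"
    using assms(2) by (simp add: vec.span_Un msum_def vec.span_eq_iff[THEN iffD2])
  then show ?thesis using invariant_msum[OF assms(1,3)] by simp
qed

lemma free_laurent_spans:
  assumes "vec.subspace W" "free_laurent \<subseteq> W"
  shows "W = (UNIV :: ('k::field ratfun ^ 'n::finite) set)"
proof -
  have "axis i 1 \<in> (free_laurent :: ('k ratfun ^ 'n) set)" for i
    by (auto simp: free_laurent_def axis_def laurent_closed(1,2))
  then have "(\<Sum>i\<in>UNIV. x $ i *s axis i 1) \<in> W" for x :: "'k ratfun ^ 'n"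
    using assms by (intro vec.subspace_sum vec.subspace_scale) auto
  then show ?thesis by (auto simp: basis_expansion)
qed

lemma independent_card_le:
  fixes B :: "('a::field ^ 'n::finite) set"
  assumes "vec.independent B"
  shows "finite B \<and> card B \<le> CARD('n)"
  using vec.independent_card_le_dim[OF subset_UNIV assms] vec.finiteI_independent[OF assms]
  by (simp add: card_cart_basis)

text \<open>Turns integrality of coefficients into independence.\<close>

lemma all_multiples_integral:
  assumes "\<And>s. s * (c :: 'k::field ratfun) \<in> val_ring e"
  shows "c = 0"
proof (rule ccontr)
  assume nz: "c \<noteq> 0"
  have "val e (unif e powi (- val e c - 1) * c) = -1" using nz by (simp add: val_mult val_unif_powi)
  then show False using assms[of "unif e powi (- val e c - 1)"] by (simp add: val_ring_def)
qed

text \<open>The group acts on each level by constant matrices, which respect a condition on the coefficients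
that is the same throughout the level.\<close>

lemma invariant_graded:
  assumes Q: "\<And>l. 0 \<in> Q l" "\<And>l x y. x \<in> Q l \<Longrightarrow> y \<in> Q l \<Longrightarrow> x + y \<in> Q l"
    "\<And>l c x. c \<in> consts_in \<Longrightarrow> x \<in> Q l \<Longrightarrow> c * x \<in> Q l"
    and fin: "finite B" and inv: "\<And>l. invariant_under \<Gamma> (combos consts_in {b\<in>B. lev b = l})"
  shows "invariant_under \<Gamma> (graded Q B lev)"
  unfolding invariant_under_def
proof (intro ballI)
  fix g x assume g: "g \<in> \<Gamma>" and "x \<in> graded Q B lev"
  then obtain s where s: "\<forall>b\<in>B. s b \<in> Q (lev b)" "x = (\<Sum>b\<in>B. s b *s b)"
    unfolding graded_def by blast
  have "g *v x = (\<Sum>b\<in>B. s b *s (g *v b))" unfolding s(2) by (simp add: vec.sum vec.scale)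
  also have "\<dots> \<in> graded Q B lev"
  proof (rule submodule_over_sum[OF submodule_graded[OF Q]])
    fix b assume b: "b \<in> B"
    let ?l = "{b'\<in>B. lev b' = lev b}"
    have "finite ?l" using fin by simp
    then have "g *v b \<in> combos consts_in ?l"
      using inv[of "lev b"] g b combos_base[OF subring_consts, of ?l b]
      unfolding invariant_under_def by simp
    then obtain c where c: "\<forall>b'\<in>?l. c b' \<in> consts_in" "g *v b = (\<Sum>b'\<in>?l. c b' *s b')"
      unfolding combos_def by blast
    have "s b *s (g *v b) = (\<Sum>b'\<in>?l. (c b' * s b) *s b')"
      unfolding c(2) by (simp add: vec.scale_sum_right vector_smult_assoc mult.commute)
    also have "\<dots> = (\<Sum>b'\<in>B. (if lev b' = lev b then c b' * s b else 0) *s b')"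
      using fin by (intro sum.mono_neutral_cong_left) auto
    finally have eq: "s b *s (g *v b) = (\<Sum>b'\<in>B. (if lev b' = lev b then c b' * s b else 0) *s b')" .
    have "(if lev b' = lev b then c b' * s b else 0) \<in> Q (lev b')" if "b' \<in> B" for b'
      using that s(1) b c(1) Q(1) Q(3)[of "c b'" "s b" "lev b"] by auto
    from gradedI[of B "\<lambda>b'. if lev b' = lev b then c b' * s b else 0", OF this eq]
    show "s b *s (g *v b) \<in> graded Q B lev" .
  qed
  finally show "g *v x \<in> graded Q B lev" .
qed

abbreviation stable_subspace :: "('k::field ratfun ^ 'n::finite ^ 'n) set \<Rightarrow> ('k ratfun ^ 'n) set \<Rightarrow> bool" where
  "stable_subspace \<Gamma> U \<equiv> submodule_over consts_in U \<and> invariant_under \<Gamma> U"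

text \<open>By the modular law, a stable complement in all of \<open>R\<^sup>n\<close> can be cut down to \<open>X\<close>.\<close>

lemma stable_complement_within:
  assumes X: "stable_subspace \<Gamma> X" "free_laurent \<inter> W \<subseteq> X" "X \<subseteq> free_laurent" "\<not> X \<subseteq> W"
    and N: "stable_subspace \<Gamma> N" "(free_laurent \<inter> W) \<inter> N \<subseteq> {0}" "free_laurent \<subseteq> msum (free_laurent \<inter> W) N"
  shows "\<exists>C. stable_subspace \<Gamma> C \<and> C \<subseteq> X \<and> C \<noteq> {0} \<and> C \<inter> W \<subseteq> {0}"
proof -
  obtain x where x: "x \<in> X" "x \<notin> W" using X(4) by blast
  then obtain z c where zc: "x = z + c" "z \<in> free_laurent \<inter> W" "c \<in> N" using N(3) X(3) unfolding msum_def by blast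
  have "c = x - z" using zc(1) by simp
  moreover have "x - z \<in> X" using submodule_over_diff[OF _ subring_consts x(1)] zc(2) X(1,2) by blast
  ultimately have "c \<in> X \<inter> N" using zc(3) by simp
  moreover have "c \<noteq> 0" using x(2) zc(1,2) by auto
  moreover have "stable_subspace \<Gamma> (X \<inter> N)" using X(1) N(1) submodule_over_Int invariant_Int by auto
  ultimately show ?thesis using N(2) X(3) by (intro exI[of _ "X \<inter> N"]) blast
qed

text \<open>The chain \<open>L\<close> represents a simplex of sign \<open>e\<close> and \<open>L'\<close> a vertex of the other sign. The
inclusions need not be strict, so that a constant chain describes a vertex. The subspace \<open>W0\<close> is
to be split off, and \<open>complement\<close> is the form in which semisimplicity is used: \<open>X\<close> is a space of
sections that contains all sections in \<open>W\<close>, and \<open>C\<close> is a piece of it that is new.\<close>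

locale stable_chain =
  fixes e :: pm and \<Gamma> :: "('k::field ratfun ^ 'n::finite ^ 'n) set"
    and L :: "nat \<Rightarrow> ('k ratfun ^ 'n) set" and r :: nat and L' W0 :: "('k ratfun ^ 'n) set"
  assumes laurent_inv: "invariant_under \<Gamma> free_laurent"
    and lattice: "\<And>i. i \<le> r \<Longrightarrow> lattice_in e (L i)" "lattice_in (opp e) L'"
    and decreasing: "\<And>i. i < r \<Longrightarrow> L (Suc i) \<subseteq> L i"
    and periodic: "scale_set (unif e) (L 0) \<subseteq> L r"
    and inv: "\<And>i. i \<le> r \<Longrightarrow> invariant_under \<Gamma> (L i)" "invariant_under \<Gamma> L'"
    and W0: "vec.subspace W0" "invariant_under \<Gamma> W0"
    and complement: "\<And>W X. vec.subspace W \<Longrightarrow> invariant_under \<Gamma> W \<Longrightarrow> stable_subspace \<Gamma> X \<Longrightarrow>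
      free_laurent \<inter> W \<subseteq> X \<Longrightarrow> X \<subseteq> free_laurent \<Longrightarrow> \<not> X \<subseteq> W \<Longrightarrow>
      \<exists>C. stable_subspace \<Gamma> C \<and> C \<subseteq> X \<and> C \<noteq> {0} \<and> C \<inter> W \<subseteq> {0}"
begin

text \<open>Modulo \<open>W0\<close>, the family \<open>B\<close> is a basis of a saturated submodule of \<open>R\<^sup>n\<close> and, after scaling by
\<open>jump\<close>, of a saturated submodule of each \<open>L j\<close>.\<close>

definition adapted :: "('k ratfun ^ 'n) set \<Rightarrow> ('k ratfun ^ 'n \<Rightarrow> nat) \<Rightarrow> bool" where
  "adapted B lev \<longleftrightarrow> finite B \<and> B \<subseteq> free_laurent \<and>
     (\<forall>b\<in>B. lev b \<le> r \<and> b \<in> msum (L (lev b)) W0) \<and>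
     (\<forall>x\<in>free_laurent. \<forall>c. x - (\<Sum>b\<in>B. c b *s b) \<in> W0 \<longrightarrow> (\<forall>b\<in>B. c b \<in> laurent)) \<and>
     (\<forall>j\<le>r. \<forall>x\<in>L j. \<forall>c. x - (\<Sum>b\<in>B. c b *s b) \<in> W0 \<longrightarrow> (\<forall>b\<in>B. c b / jump e (lev b) j \<in> val_ring e)) \<and>
     (\<forall>l. invariant_under \<Gamma> (combos consts_in {b\<in>B. lev b = l}))"

lemma adaptedD:
  assumes "adapted B lev"
  shows "finite B" "B \<subseteq> free_laurent" "b \<in> B \<Longrightarrow> lev b \<le> r" "b \<in> B \<Longrightarrow> b \<in> msum (L (lev b)) W0"
    "x \<in> free_laurent \<Longrightarrow> x - (\<Sum>b\<in>B. c b *s b) \<in> W0 \<Longrightarrow> b \<in> B \<Longrightarrow> c b \<in> laurent"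
    "j \<le> r \<Longrightarrow> x \<in> L j \<Longrightarrow> x - (\<Sum>b\<in>B. c b *s b) \<in> W0 \<Longrightarrow> b \<in> B \<Longrightarrow> c b / jump e (lev b) j \<in> val_ring e"
    "invariant_under \<Gamma> (combos consts_in {b\<in>B. lev b = l})"
  using assms unfolding adapted_def by blast+

lemma lattice_sub: "i \<le> r \<Longrightarrow> submodule_over (val_ring e) (L i)"
  by (rule lattice_submodule[OF lattice(1)])

lemma L_mono:
  assumes "i \<le> j" "j \<le> r"
  shows "L j \<subseteq> L i"
  using assms
proof (induction rule: dec_induct)
  case (step n)
  then show ?case using decreasing[of n] by auto
qed simp

text \<open>Periodicity of the chain: passing from level \<open>i\<close> to a later \<open>j\<close> costs at most one factor \<open>\<pi>\<close>.\<close>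

lemma jump_scale:
  assumes "l \<in> L i" "i \<le> r" "j \<le> r" "c / jump e i j \<in> val_ring e"
  shows "c *s l \<in> L j"
proof (cases "i < j")
  case True
  have "l \<in> L 0" using assms L_mono[of 0 i] by auto
  then have "unif e *s l \<in> L j" using periodic L_mono[OF assms(3)] unfolding scale_set_def by auto
  from submodule_overD(3)[OF lattice_sub[OF assms(3)] _ this, of "c / unif e"]
  show ?thesis using assms True by (simp add: jump_def vector_smult_assoc)
next
  case False
  then have "l \<in> L j" using assms L_mono[of j i] by auto
  then show ?thesis using assms False submodule_overD(3)[OF lattice_sub] by (simp add: jump_def)
qed

lemma adapted_indep:
  assumes "adapted B lev" "(\<Sum>b\<in>B. c b *s b) \<in> W0" "b \<in> B"
  shows "c b = 0"
proof (rule all_multiples_integral[of _ e])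
  fix s
  have "(\<Sum>b\<in>B. (s * c b) *s b) = s *s (\<Sum>b\<in>B. c b *s b)"
    by (simp add: vec.scale_sum_right vector_smult_assoc)
  then have "0 - (\<Sum>b\<in>B. (s * c b) *s b) \<in> W0"
    using vec.subspace_neg[OF W0(1) vec.subspace_scale[OF W0(1) assms(2), of s]] by simp
  from adaptedD(6)[where c = "\<lambda>b. s * c b", OF assms(1) le0 submodule_overD(1)[OF lattice_sub[OF le0]] this assms(3)]
  have "s * c b / jump e (lev b) 0 \<in> val_ring e" .
  then show "s * c b \<in> val_ring e" by (simp add: jump_def)
qed

lemma adapted_independent:
  assumes "adapted B lev"
  shows "vec.independent B"
  using adapted_indep[OF assms] adaptedD(1)[OF assms] vec.subspace_0[OF W0(1)]
  unfolding vec.independent_explicit by auto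

lemma adapted_inv:
  assumes ad: "adapted B lev" and S: "subring_of S" "consts_in \<subseteq> S"
  shows "invariant_under \<Gamma> (combos S B)"
  unfolding combos_graded[of S B lev] using S(2)
  by (intro invariant_graded adaptedD(1,7)[OF ad]) (auto intro: subring_ofD[OF S(1)])

lemma adapted_empty: "adapted {} lev"
  unfolding adapted_def by (auto simp: invariant_under_def combos_def)

definition Wspan :: "('k ratfun ^ 'n) set \<Rightarrow> ('k ratfun ^ 'n) set" where
  "Wspan B = vec.span (W0 \<union> B)"

lemma Wspan_iff:
  assumes "finite B"
  shows "x \<in> Wspan B \<longleftrightarrow> (\<exists>c. x - (\<Sum>b\<in>B. c b *s b) \<in> W0)"
proof
  assume "x \<in> Wspan B"
  moreover have "vec.span W0 = W0" using W0(1) by (simp add: vec.span_eq_iff)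
  ultimately obtain w y where "x = w + y" "w \<in> W0" "y \<in> vec.span B"
    unfolding Wspan_def vec.span_Un by auto
  moreover from this(3) obtain c where "y = (\<Sum>b\<in>B. c b *s b)" unfolding vec.span_finite[OF assms] by blast
  ultimately have "x - (\<Sum>b\<in>B. c b *s b) \<in> W0" by simp
  then show "\<exists>c. x - (\<Sum>b\<in>B. c b *s b) \<in> W0" by blast
next
  assume "\<exists>c. x - (\<Sum>b\<in>B. c b *s b) \<in> W0"
  then obtain c where c: "x - (\<Sum>b\<in>B. c b *s b) \<in> W0" by blast
  have "(x - (\<Sum>b\<in>B. c b *s b)) + (\<Sum>b\<in>B. c b *s b) \<in> vec.span (W0 \<union> B)"
    using c by (intro vec.span_add vec.span_sum vec.span_scale vec.span_base) auto
  then show "x \<in> Wspan B" by (simp add: Wspan_def)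
qed

lemma Wspan_subspace: "vec.subspace (Wspan B)"
  unfolding Wspan_def by (rule vec.subspace_span)

lemma Wspan_upper: "W0 \<subseteq> Wspan B" "B \<subseteq> Wspan B"
  unfolding Wspan_def using vec.span_superset[of "W0 \<union> B"] by auto

lemma Wspan_inv:
  assumes "adapted B lev"
  shows "invariant_under \<Gamma> (Wspan B)"
proof -
  have "invariant_under \<Gamma> (combos UNIV B)"
    by (rule adapted_inv[OF assms]) (auto simp: subring_of_def)
  then show ?thesis unfolding Wspan_def combos_UNIV[OF adaptedD(1)[OF assms]]
    by (rule invariant_span[OF W0(2,1)])
qed

text \<open>By \<open>polar_part\<close>, a complement of \<open>jump e l i * A\<^sub>e\<close> in \<open>K\<close> that consists of Laurent polynomials.
Hence \<open>polars B lev i\<close> complements the part of \<open>L i\<close> spanned by \<open>B\<close> in the \<open>K\<close>-span of \<open>B\<close>.\<close>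

definition polar_coeffs :: "nat \<Rightarrow> nat \<Rightarrow> 'k ratfun set" where
  "polar_coeffs i l = {s \<in> laurent. unif e * (s / jump e l i) \<in> val_ring (opp e)}"

abbreviation polars :: "('k ratfun ^ 'n) set \<Rightarrow> ('k ratfun ^ 'n \<Rightarrow> nat) \<Rightarrow> nat \<Rightarrow> ('k ratfun ^ 'n) set" where
  "polars B lev i \<equiv> graded (polar_coeffs i) B lev"

lemma polar_coeffs_closed:
  "0 \<in> polar_coeffs i l" "x \<in> polar_coeffs i l \<Longrightarrow> y \<in> polar_coeffs i l \<Longrightarrow> x + y \<in> polar_coeffs i l"
  "c \<in> consts_in \<Longrightarrow> x \<in> polar_coeffs i l \<Longrightarrow> c * x \<in> polar_coeffs i l"
proof -
  show "0 \<in> polar_coeffs i l" by (simp add: polar_coeffs_def laurent_closed(1) val_ring_closed(1))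
  show "x \<in> polar_coeffs i l \<Longrightarrow> y \<in> polar_coeffs i l \<Longrightarrow> x + y \<in> polar_coeffs i l"
    by (simp add: polar_coeffs_def laurent_closed(3) add_divide_distrib distrib_left val_ring_add)
  assume c: "c \<in> consts_in" and x: "x \<in> polar_coeffs i l"
  have "c * (unif e * (x / jump e l i)) \<in> val_ring (opp e)"
    using c x unfolding polar_coeffs_def by (intro val_ring_mult[of c]) (auto simp: cst_in_val_ring)
  moreover have "c * x \<in> laurent"
    using c x cst_in_laurent by (intro laurent_closed(4)) (auto simp: polar_coeffs_def)
  ultimately show "c * x \<in> polar_coeffs i l" by (simp add: polar_coeffs_def mult_ac)
qed

lemmas submodule_polars = submodule_graded[of "polar_coeffs i" consts_in B lev for i B lev, OF polar_coeffs_closed]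

lemma polars_inv: "adapted B lev \<Longrightarrow> invariant_under \<Gamma> (polars B lev i)"
  by (intro invariant_graded polar_coeffs_closed adaptedD(1,7))

lemma polars_Wspan:
  assumes "B \<subseteq> free_laurent"
  shows "polars B lev i \<subseteq> free_laurent \<inter> Wspan B"
proof
  fix x assume "x \<in> polars B lev i"
  then obtain s where s: "\<forall>b\<in>B. s b \<in> laurent" "x = (\<Sum>b\<in>B. s b *s b)"
    unfolding graded_def polar_coeffs_def by blast
  have "x \<in> free_laurent" unfolding s(2) using s(1) assms
    by (intro submodule_over_sum[OF submodule_free_laurent] submodule_overD(3)[OF submodule_free_laurent]) auto
  moreover have "x \<in> Wspan B" unfolding s(2) using Wspan_upper(2)
    by (intro vec.subspace_sum[OF Wspan_subspace] vec.subspace_scale[OF Wspan_subspace]) auto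
  ultimately show "x \<in> free_laurent \<inter> Wspan B" by blast
qed

lemma polars_disjoint:
  assumes ad: "adapted B lev" and "i \<le> r" "z \<in> polars B lev i" "z \<in> msum (L i) W0"
  shows "z = 0"
proof -
  obtain s where s: "\<forall>b\<in>B. s b \<in> laurent \<and> unif e * (s b / jump e (lev b) i) \<in> val_ring (opp e)"
    "z = (\<Sum>b\<in>B. s b *s b)" using assms(3) unfolding graded_def polar_coeffs_def by blast
  obtain l w where lw: "l \<in> L i" "w \<in> W0" "z = l + w" using assms(4) unfolding msum_def by blast
  have "l - (\<Sum>b\<in>B. s b *s b) \<in> W0"
    using vec.subspace_neg[OF W0(1) lw(2)] unfolding s(2)[symmetric] lw(3) by simp
  then have int: "s b / jump e (lev b) i \<in> val_ring e" if "b \<in> B" for b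
    using adaptedD(6)[OF ad \<open>i \<le> r\<close> lw(1)] that by blast
  have "s b = 0" if b: "b \<in> B" for b
  proof -
    have inv: "inverse (jump e (lev b) i) \<in> (laurent :: 'k ratfun set)"
      using unif_powi_in_laurent[of e "- 1", where 'k='k] by (simp add: jump_def laurent_closed(2))
    have "s b \<in> laurent" using s(1) b by blast
    from laurent_closed(4)[OF this inv] have "s b / jump e (lev b) i \<in> laurent"
      by (simp add: divide_inverse)
    then have "s b / jump e (lev b) i = 0" using laurent_disjoint int[OF b] s b by blast
    then show ?thesis by simp
  qed
  then show ?thesis unfolding s(2) by simp
qed

text \<open>A section lies in the lattice only modulo the span of \<open>B\<close>. Subtracting a Laurent polynomial
combination of \<open>B\<close>, which does not leave \<open>R\<^sup>n\<close>, moves it into the lattice modulo \<open>W0\<close>.\<close>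

lemma polar_correction:
  assumes ad: "adapted B lev" and i: "i \<le> r" and x: "x \<in> msum (L i) (Wspan B)"
  obtains z where "z \<in> polars B lev i" "x - z \<in> msum (L i) W0"
proof -
  note fin = adaptedD(1)[OF ad]
  obtain l w where lw: "l \<in> L i" "w \<in> Wspan B" "x = l + w" using x unfolding msum_def by blast
  obtain c where c: "w - (\<Sum>b\<in>B. c b *s b) \<in> W0" using lw(2) Wspan_iff[OF fin] by blast
  have "\<exists>s. s \<in> laurent \<and> unif e * s \<in> val_ring (opp e) \<and> c b / jump e (lev b) i - s \<in> val_ring e" for b
    by (rule polar_part[of e "c b / jump e (lev b) i"]) blast
  then obtain s where s: "\<And>b. s b \<in> laurent" "\<And>b. unif e * s b \<in> val_ring (opp e)"
    "\<And>b. c b / jump e (lev b) i - s b \<in> val_ring e" by metis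
  define t where "t b = jump e (lev b) i * s b" for b
  define z where "z = (\<Sum>b\<in>B. t b *s b)"
  have "\<forall>b\<in>B. t b \<in> polar_coeffs i (lev b)"
    using s(1,2) jump_in(2)[of e _ i, where 'k='k] by (auto intro!: laurent_closed(4) simp: t_def polar_coeffs_def)
  then have "z \<in> polars B lev i" unfolding z_def by (intro gradedI[where s = t]) auto
  moreover have sub: "submodule_over (val_ring e) (msum (L i) W0)"
    using submodule_msum lattice_sub[OF i] submodule_over_subspace[OF W0(1)] by blast
  have "x - z = l + (w - (\<Sum>b\<in>B. c b *s b)) + (\<Sum>b\<in>B. (c b - t b) *s b)"
    by (simp add: lw(3) z_def vec.scale_left_diff_distrib sum_subtractf)
  moreover have "(\<Sum>b\<in>B. (c b - t b) *s b) \<in> msum (L i) W0"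
  proof (rule submodule_over_sum[OF sub])
    fix b assume b: "b \<in> B"
    obtain l' w' where lw': "l' \<in> L (lev b)" "w' \<in> W0" "b = l' + w'"
      using adaptedD(4)[OF ad b] unfolding msum_def by blast
    have "(c b - t b) / jump e (lev b) i = c b / jump e (lev b) i - s b"
      by (simp add: t_def diff_divide_distrib)
    then have "(c b - t b) *s l' \<in> L i"
      using s(3)[of b] by (intro jump_scale[OF lw'(1) adaptedD(3)[OF ad b] i]) simp
    moreover have "(c b - t b) *s w' \<in> W0" using W0(1) lw'(2) by (rule vec.subspace_scale)
    moreover have "(c b - t b) *s b = (c b - t b) *s l' + (c b - t b) *s w'"
      unfolding lw'(3)[symmetric] vector_add_ldistrib[symmetric] ..
    ultimately show "(c b - t b) *s b \<in> msum (L i) W0" unfolding msum_def by blast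
  qed
  moreover have "l + (w - (\<Sum>b\<in>B. c b *s b)) \<in> msum (L i) W0" unfolding msum_def using lw(1) c by blast
  ultimately show ?thesis using that[of z] submodule_overD(2)[OF sub] by simp
qed

text \<open>Consider the sections modulo \<open>W\<close> of the bundles given by \<open>L j\<close> and \<open>\<pi>\<^sup>-\<^sup>m L'\<close>. They become fewer
as \<open>m\<close> or \<open>j\<close> grows. Here \<open>m\<close> is the largest exponent for which \<open>L 0\<close> has a section outside \<open>W\<close>,
and \<open>i\<close> is the last position that still has one for this exponent.\<close>

lemma first_sections:
  assumes W: "vec.subspace W" "W \<noteq> UNIV"
  obtains m :: int and i where "i \<le> r"
    "\<exists>x\<in>free_laurent. x \<in> msum (L i) W \<and> unif e powi m *s x \<in> msum L' W \<and> x \<notin> W"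
    "\<And>x j. x \<in> free_laurent \<Longrightarrow> i < j \<Longrightarrow> j \<le> r \<Longrightarrow> x \<in> msum (L j) W \<Longrightarrow> unif e powi m *s x \<in> msum L' W \<Longrightarrow> x \<in> W"
    "\<And>x. x \<in> free_laurent \<Longrightarrow> x \<in> msum (L 0) W \<Longrightarrow> unif e powi (m + 1) *s x \<in> msum L' W \<Longrightarrow> x \<in> W"
proof -
  obtain a where a: "\<And>x. x \<in> free_laurent \<Longrightarrow> x \<in> msum (L 0) W \<Longrightarrow> unif e ^ a *s x \<in> msum L' W \<Longrightarrow> x \<in> W"
    using no_sections[OF lattice(1) lattice(2) W(1), of 0] by blast
  define P where "P k j \<longleftrightarrow> (\<exists>x\<in>free_laurent. x \<in> msum (L j) W \<and> unif e powi (int a - int k) *s x \<in> msum L' W \<and> x \<notin> W)"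
    for k j
  have "\<not> P 0 0" using a unfolding P_def by auto
  have "\<exists>k. P k 0"
  proof -
    obtain x where x: "x \<in> free_laurent" "x \<notin> W" using free_laurent_spans[OF W(1)] W(2) by blast
    obtain s where s: "unif e ^ s *s x \<in> L 0"
      using lattice_absorbs[OF lattice(1)[of 0], of x] unfolding eventually_sequentially by blast
    define y where "y = unif e ^ s *s x"
    have y: "y \<in> free_laurent" unfolding y_def
      using x(1) unif_powi_in_laurent[of e "int s"] submodule_overD(3)[OF submodule_free_laurent] by simp
    have yW: "y \<notin> W"
    proof
      assume "y \<in> W"
      then have "inverse (unif e ^ s) *s y \<in> W" by (rule vec.subspace_scale[OF W(1)])
      then show False using x(2) unfolding y_def by (simp add: vector_smult_assoc)
    qed
    obtain k where k: "unif (opp e) ^ k *s (unif e ^ a *s y) \<in> L'"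
      using lattice_absorbs[OF lattice(2), of "unif e ^ a *s y"] unfolding eventually_sequentially by blast
    have eq: "unif e powi (int a - int k) *s y = unif (opp e) ^ k *s (unif e ^ a *s y)"
      by (simp add: unif_opp power_int_diff vector_smult_assoc field_simps)
    have "unif e powi (int a - int k) *s y \<in> msum L' W"
      unfolding eq by (rule msum_upper(2)[OF submodule_over_subspace[OF W(1)], THEN subsetD, OF k])
    moreover have "y \<in> msum (L 0) W"
      unfolding y_def by (rule msum_upper(2)[OF submodule_over_subspace[OF W(1)], THEN subsetD, OF s])
    ultimately show ?thesis using y yW unfolding P_def by blast
  qed
  define k where "k = (LEAST k. P k 0)"
  have k: "P k 0" "\<And>k'. k' < k \<Longrightarrow> \<not> P k' 0"
    using LeastI_ex[OF \<open>\<exists>k. P k 0\<close>] not_less_Least unfolding k_def by auto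
  then obtain k' where k': "k = Suc k'" using \<open>\<not> P 0 0\<close> by (cases k) auto
  define i where "i = Max {j. j \<le> r \<and> P k j}"
  have fin: "finite {j. j \<le> r \<and> P k j}" by simp
  have "{j. j \<le> r \<and> P k j} \<noteq> {}" using k(1) by blast
  from Max_in[OF fin this] have i: "i \<le> r" "P k i" unfolding i_def[symmetric] by simp_all
  have i_max: "\<not> P k j" if "i < j" "j \<le> r" for j
  proof
    assume "P k j"
    then have "j \<le> i" unfolding i_def using fin that(2) by (intro Max_ge) auto
    then show False using that(1) by simp
  qed
  have "int a - int k + 1 = int a - int k'" using k' by simp
  then show ?thesis
    using that[of i "int a - int k"] i i_max k(2)[of k'] k' unfolding P_def by (metis lessI)
qed

text \<open>The induction step. New vectors are sections at the position \<open>(m, i)\<close> of \<open>first_sections\<close>, and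
they get the level \<open>i\<close>.\<close>

lemma adapted_extend:
  assumes ad: "adapted B lev" and W: "Wspan B \<noteq> UNIV"
  obtains B' lev' where "adapted B' lev'" "card B < card B'"
proof -
  let ?W = "Wspan B"
  note fin = adaptedD(1)[OF ad] and Wsub = Wspan_subspace[of B]
  note Wmod = submodule_over_subspace[OF Wsub]
  obtain m i where i: "i \<le> r"
    and ex: "\<exists>x\<in>free_laurent. x \<in> msum (L i) ?W \<and> unif e powi m *s x \<in> msum L' ?W \<and> x \<notin> ?W"
    and gap_j: "\<And>x j. x \<in> free_laurent \<Longrightarrow> i < j \<Longrightarrow> j \<le> r \<Longrightarrow> x \<in> msum (L j) ?W \<Longrightarrow>
        unif e powi m *s x \<in> msum L' ?W \<Longrightarrow> x \<in> ?W"
    and gap: "\<And>x. x \<in> free_laurent \<Longrightarrow> x \<in> msum (L 0) ?W \<Longrightarrow> unif e powi (m + 1) *s x \<in> msum L' ?W \<Longrightarrow> x \<in> ?W"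
    by (rule first_sections[OF Wsub W]) (rule that, assumption+)
  define \<Lambda>' where "\<Lambda>' = {x. unif e powi m *s x \<in> msum L' ?W}"
  define X where "X = free_laurent \<inter> (msum (L i) ?W \<inter> \<Lambda>')"
  have sub_msum: "submodule_over (val_ring e) (msum (L j) ?W)" if "j \<le> r" for j
    using submodule_msum[OF lattice_sub[OF that] Wmod] .
  have sub_\<Lambda>': "submodule_over (val_ring (opp e)) \<Lambda>'"
    unfolding \<Lambda>'_def using submodule_scaled[OF submodule_msum[OF lattice_submodule[OF lattice(2)] Wmod]] .
  have W_msum: "?W \<subseteq> msum (L j) ?W" if "j \<le> r" for j
    using msum_upper(1)[OF lattice_sub[OF that]] .
  have W_\<Lambda>': "?W \<subseteq> \<Lambda>'"
    unfolding \<Lambda>'_def using msum_upper(1)[OF lattice_submodule[OF lattice(2)], of ?W]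
      vec.subspace_scale[OF Wsub] by blast
  have X_sub: "submodule_over consts_in X" unfolding X_def
    by (intro submodule_over_Int submodule_over_mono[OF submodule_free_laurent consts_laurent]
        submodule_over_mono[OF sub_msum[OF i] consts_val_ring] submodule_over_mono[OF sub_\<Lambda>' consts_val_ring])
  have X_inv: "invariant_under \<Gamma> X" unfolding X_def \<Lambda>'_def
    by (intro invariant_Int laurent_inv invariant_msum inv i Wspan_inv[OF ad] invariant_scaled)
  have X_upper: "free_laurent \<inter> ?W \<subseteq> X" unfolding X_def using W_msum[OF i] W_\<Lambda>' by blast
  have "\<not> X \<subseteq> ?W" using ex unfolding X_def \<Lambda>'_def by blast
  moreover have "X \<subseteq> free_laurent" unfolding X_def by blast
  ultimately obtain C where C: "submodule_over consts_in C" "invariant_under \<Gamma> C" "C \<subseteq> X" "C \<noteq> {0}" "C \<inter> ?W \<subseteq> {0}"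
    using complement[OF Wsub Wspan_inv[OF ad] conjI[OF X_sub X_inv] X_upper] by blast
  \<comment> \<open>The corrected sections. The correction in \<open>polars\<close> is unique, so no choice is made and \<open>D\<close>
      inherits stability from \<open>C\<close>.\<close>
  define D where "D = msum C (polars B lev i) \<inter> msum (L i) W0"
  have W0mod: "submodule_over S W0" for S by (rule submodule_over_subspace[OF W0(1)])
  have polW: "polars B lev i \<subseteq> free_laurent \<inter> ?W" by (rule polars_Wspan[OF adaptedD(2)[OF ad]])
  have D_sub: "submodule_over consts_in D" unfolding D_def
    by (intro submodule_over_Int submodule_msum C(1) submodule_polars W0mod
        submodule_over_mono[OF lattice_sub[OF i] consts_val_ring])
  have D_inv: "invariant_under \<Gamma> D" unfolding D_def
    by (intro invariant_Int invariant_msum C(2) polars_inv[OF ad] inv(1)[OF i] W0(2))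
  have D_X: "D \<subseteq> X"
  proof -
    have "msum C (polars B lev i) \<subseteq> X"
      unfolding msum_def using C(3) polW X_upper submodule_overD(2)[OF X_sub] by blast
    then show ?thesis unfolding D_def by blast
  qed
  have D_W: "D \<inter> ?W \<subseteq> {0}"
  proof
    fix x assume x: "x \<in> D \<inter> ?W"
    then obtain c z where cz: "x = c + z" "c \<in> C" "z \<in> polars B lev i" unfolding D_def msum_def by blast
    have "c = x - z" using cz by simp
    then have "c \<in> ?W" using x polW cz(3) vec.subspace_diff[OF Wsub] by blast
    then have "c = 0" using C(5) cz(2) by blast
    then have "x = 0" using polars_disjoint[OF ad i cz(3)] x cz(1) unfolding D_def by simp
    then show "x \<in> {0}" by simp
  qed
  have D_nz: "\<exists>x\<in>D. x \<noteq> 0"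
  proof -
    obtain c where c: "c \<in> C" "c \<noteq> 0" using C(4) submodule_overD(1)[OF C(1)] by blast
    then have "c \<in> msum (L i) ?W" using C(3) unfolding X_def by blast
    then obtain z where z: "z \<in> polars B lev i" "c - z \<in> msum (L i) W0" by (rule polar_correction[OF ad i])
    have "- z \<in> polars B lev i" using submodule_over_minus[OF submodule_polars subring_consts z(1)] .
    then have "c - z \<in> D" unfolding D_def msum_def[of C] using c(1) z(2) by force
    moreover have "c - z \<noteq> 0" using c C(5) z(1) polW by auto
    ultimately show ?thesis by blast
  qed
  obtain B2 where B2: "B2 \<subseteq> D" "kvec.independent B2" "D \<subseteq> kvec.span B2"
    by (rule kvec.maximal_independent_subset[of D])
  have sec: "section_space e ?W (msum (L 0) ?W) \<Lambda>' F" if F: "F \<subseteq> B2" "finite F" for F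
  proof
    show "vec.subspace ?W" "submodule_over (val_ring e) (msum (L 0) ?W)" "?W \<subseteq> msum (L 0) ?W"
      "submodule_over (val_ring (opp e)) \<Lambda>'" "?W \<subseteq> \<Lambda>'" "finite F"
      using Wsub sub_msum W_msum sub_\<Lambda>' W_\<Lambda>' F by blast+
    show "x \<in> ?W" if "x \<in> free_laurent" "x \<in> msum (L 0) ?W" "unif e *s x \<in> \<Lambda>'" for x
      using gap[OF that(1,2)] that(3) unfolding \<Lambda>'_def by (simp add: vector_smult_assoc power_int_add)
    have "F \<subseteq> X" using F B2(1) D_X by blast
    moreover have "msum (L i) ?W \<subseteq> msum (L 0) ?W" using L_mono[of 0 i] i unfolding msum_def by blast
    ultimately show "F \<subseteq> free_laurent" "F \<subseteq> msum (L 0) ?W" "F \<subseteq> \<Lambda>'" unfolding X_def by blast+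
    show "\<forall>b\<in>F. \<gamma> b = 0" if "(\<Sum>b\<in>F. cst (\<gamma> b) *s b) \<in> ?W" for \<gamma>
    proof -
      have "(\<Sum>b\<in>F. cst (\<gamma> b) *s b) \<in> D"
        using F B2(1) by (intro submodule_over_sum[OF D_sub] submodule_overD(3)[OF D_sub]) auto
      then have "(\<Sum>b\<in>F. cst (\<gamma> b) *s b) = 0" using D_W that by blast
      then show ?thesis using kvec.independentD[OF B2(2) F(2,1)] by blast
    qed
  qed
  have "finite B2"
  proof -
    have "card F \<le> CARD('n)" if F: "F \<subseteq> B2" "finite F" for F
    proof -
      interpret section_space e ?W "msum (L 0) ?W" \<Lambda>' F by (rule sec[OF F])
      have "vec.independent F" unfolding vec.independent_explicit
        using F(2) coeffs_zero vec.subspace_0[OF Wsub] by auto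
      then show ?thesis using independent_card_le by blast
    qed
    then show ?thesis by (rule finite_if_finite_subsets_card_bdd[THEN conjunct1])
  qed
  interpret section_space e ?W "msum (L 0) ?W" \<Lambda>' B2 by (rule sec[OF order_refl \<open>finite B2\<close>])
  have combos_D: "combos consts_in B2 = D"
    unfolding combos_consts[OF \<open>finite B2\<close>]
    using B2(1,3) D_sub kvec.span_subspace ksubspace_iff by metis
  have disj: "B \<inter> B2 = {}"
  proof -
    have "0 \<notin> B2" using B2(2) kvec.dependent_zero by blast
    then show ?thesis using B2(1) D_W Wspan_upper(2)[of B] by blast
  qed
  define lev' where "lev' b = (if b \<in> B2 then i else lev b)" for b
  have sum_split: "(\<Sum>b\<in>B \<union> B2. c b *s b) = (\<Sum>b\<in>B. c b *s b) + (\<Sum>b\<in>B2. c b *s b)" for c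
    using fin \<open>finite B2\<close> disj by (rule sum.union_disjoint)
  have in_W: "x - (\<Sum>b\<in>B2. c b *s b) \<in> ?W" if "x - (\<Sum>b\<in>B \<union> B2. c b *s b) \<in> W0" for x c
  proof -
    have "(x - (\<Sum>b\<in>B2. c b *s b)) - (\<Sum>b\<in>B. c b *s b) \<in> W0"
      using that unfolding sum_split by (simp add: algebra_simps)
    then show ?thesis using Wspan_iff[OF fin] by blast
  qed
  have "adapted (B \<union> B2) lev'" unfolding adapted_def
  proof (intro conjI ballI allI impI)
    show "finite (B \<union> B2)" using fin \<open>finite B2\<close> by simp
    show "B \<union> B2 \<subseteq> free_laurent" using adaptedD(2)[OF ad] B(2) by blast
  next
    fix b assume b: "b \<in> B \<union> B2"
    show "lev' b \<le> r" using b adaptedD(3)[OF ad] i unfolding lev'_def by auto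
    show "b \<in> msum (L (lev' b)) W0"
      using b adaptedD(4)[OF ad] B2(1) unfolding lev'_def D_def by auto
  next
    fix x c b assume x: "x \<in> free_laurent" "x - (\<Sum>b\<in>B \<union> B2. c b *s b) \<in> W0" and b: "b \<in> B \<union> B2"
    have c2: "c b \<in> laurent" if "b \<in> B2" for b using coeffs_laurent[OF x(1) in_W[OF x(2)] that] .
    have "x - (\<Sum>b\<in>B2. c b *s b) \<in> free_laurent" using B(2) c2
      by (intro submodule_over_diff[OF submodule_free_laurent subring_laurent x(1)]
          submodule_over_sum[OF submodule_free_laurent] submodule_overD(3)[OF submodule_free_laurent]) auto
    moreover have "(x - (\<Sum>b\<in>B2. c b *s b)) - (\<Sum>b\<in>B. c b *s b) \<in> W0"
      using x(2) unfolding sum_split by (simp add: algebra_simps)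
    ultimately have "c b \<in> laurent" if "b \<in> B" for b using adaptedD(5)[OF ad _ _ that] by blast
    then show "c b \<in> laurent" using c2 b by blast
  next
    fix j x c b assume j: "j \<le> r" and x: "x \<in> L j" "x - (\<Sum>b\<in>B \<union> B2. c b *s b) \<in> W0" and b: "b \<in> B \<union> B2"
    have xj: "x \<in> msum (L j) ?W" using x(1) msum_upper(2)[OF Wmod] by blast
    have x0: "x \<in> msum (L 0) ?W" using xj L_mono[of 0 j] j unfolding msum_def by blast
    have c2_int: "c b \<in> val_ring e" if "b \<in> B2" for b using coeffs_integral[OF x0 in_W[OF x(2)] that] .
    have c2: "c b / jump e i j \<in> val_ring e" if b: "b \<in> B2" for b
    proof (cases "i < j")
      case False then show ?thesis using c2_int[OF b] by (simp add: jump_def)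
    next
      case True
      have "\<exists>g y. y \<in> val_ring e \<and> c b = cst g + unif e * y" if "b \<in> B2" for b
        by (rule residue[OF c2_int[OF that]]) blast
      then obtain \<gamma> y where gy: "\<And>b. b \<in> B2 \<Longrightarrow> y b \<in> val_ring e \<and> c b = cst (\<gamma> b) + unif e * y b"
        by metis
      define s where "s = (\<Sum>b\<in>B2. cst (\<gamma> b) *s b)"
      \<comment> \<open>The constant part \<open>s\<close> of the combination is a section at position \<open>j\<close>, and there are
          none beyond \<open>i\<close>; hence all coefficients are divisible by the uniformizer.\<close>
      have s_eq: "s = x - (x - (\<Sum>b\<in>B2. c b *s b)) - (\<Sum>b\<in>B2. y b *s (unif e *s b))"
        using gy by (simp add: s_def vector_smult_assoc vec.scale_left_distrib mult.commute[of _ "unif e"] flip: sum_subtractf)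
      have "unif e *s b \<in> msum (L j) ?W" if b2: "b \<in> B2" for b
      proof -
        obtain l w where lw: "l \<in> L 0" "w \<in> ?W" "b = l + w" using B(3) b2 unfolding msum_def by blast
        have "unif e *s l \<in> L j" using periodic lw(1) L_mono[OF j order_refl] unfolding scale_set_def by blast
        moreover have "unif e *s w \<in> ?W" using vec.subspace_scale[OF Wsub lw(2)] .
        ultimately show ?thesis unfolding msum_def lw(3) by (auto simp: vector_add_ldistrib)
      qed
      then have "y b *s (unif e *s b) \<in> msum (L j) ?W" if "b \<in> B2" for b
        using gy[OF that] submodule_overD(3)[OF sub_msum[OF j]] that by blast
      then have "s \<in> msum (L j) ?W" unfolding s_eq
        by (intro submodule_over_diff[OF sub_msum[OF j] subring_val_ring] submodule_over_sum[OF sub_msum[OF j]]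
            xj W_msum[OF j, THEN subsetD, OF in_W[OF x(2)]])
      moreover have "s \<in> X" unfolding s_def using B2(1) D_X
        by (intro submodule_over_sum[OF X_sub] submodule_overD(3)[OF X_sub]) auto
      ultimately have "s \<in> ?W" using gap_j[OF _ True j] unfolding X_def \<Lambda>'_def by blast
      then have "\<gamma> b = 0" using indep b unfolding s_def by blast
      then have "c b = unif e * y b" using gy[OF b] by simp
      then show ?thesis using gy[OF b] True by (simp add: jump_def)
    qed
    have "\<exists>l w. l \<in> L i \<and> w \<in> W0 \<and> b = l + w" if "b \<in> B2" for b
      using B2(1) that unfolding D_def msum_def by blast
    then obtain l w where lw: "\<And>b. b \<in> B2 \<Longrightarrow> l b \<in> L i \<and> w b \<in> W0 \<and> b = l b + w b" by metis
    have "x - (\<Sum>b\<in>B2. c b *s l b) \<in> L j"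
      using lw by (intro submodule_over_diff[OF lattice_sub[OF j] subring_val_ring x(1)]
          submodule_over_sum[OF lattice_sub[OF j]] jump_scale[OF _ i j c2]) auto
    moreover have "(x - (\<Sum>b\<in>B2. c b *s l b)) - (\<Sum>b\<in>B. c b *s b) \<in> W0"
    proof -
      have "(\<Sum>b\<in>B2. c b *s b) = (\<Sum>b\<in>B2. c b *s l b) + (\<Sum>b\<in>B2. c b *s w b)"
        unfolding sum.distrib[symmetric] vector_add_ldistrib[symmetric] using lw by (intro sum.cong) auto
      then have eq: "(x - (\<Sum>b\<in>B2. c b *s l b)) - (\<Sum>b\<in>B. c b *s b)
          = (x - (\<Sum>b\<in>B \<union> B2. c b *s b)) + (\<Sum>b\<in>B2. c b *s w b)"
        unfolding sum_split by (simp add: algebra_simps)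
      have "(\<Sum>b\<in>B2. c b *s w b) \<in> W0"
        using lw by (intro vec.subspace_sum[OF W0(1)] vec.subspace_scale[OF W0(1)]) auto
      then show ?thesis unfolding eq by (rule vec.subspace_add[OF W0(1) x(2)])
    qed
    ultimately have "c b / jump e (lev b) j \<in> val_ring e" if "b \<in> B" for b
      using adaptedD(6)[OF ad j _ _ that] by blast
    then show "c b / jump e (lev' b) j \<in> val_ring e" using c2 b disj unfolding lev'_def by auto
  next
    fix l
    show "invariant_under \<Gamma> (combos consts_in {b \<in> B \<union> B2. lev' b = l})"
    proof (cases "l = i")
      case False
      then have "{b \<in> B \<union> B2. lev' b = l} = {b \<in> B. lev b = l}" using disj unfolding lev'_def by auto
      then show ?thesis using adaptedD(7)[OF ad] by simp
    next
      case True
      have eq: "{b \<in> B \<union> B2. lev' b = l} = {b \<in> B. lev b = l} \<union> B2" (is "_ = ?Bl \<union> _")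
        using disj True unfolding lev'_def by auto
      have "combos consts_in (?Bl \<union> B2) = msum (combos consts_in ?Bl) (combos consts_in B2)"
        using fin \<open>finite B2\<close> by (simp add: combos_consts kvec.span_Un msum_def)
      then show ?thesis unfolding eq combos_D
        using invariant_msum[OF adaptedD(7)[OF ad] D_inv] by simp
    qed
  qed
  moreover have "card B < card (B \<union> B2)"
  proof -
    have "B2 \<noteq> {}" using B2(3) D_nz by auto
    then show ?thesis using disj fin \<open>finite B2\<close> by (simp add: card_Un_disjoint card_gt_0_iff)
  qed
  ultimately show ?thesis by (rule that)
qed

text \<open>An adapted family is independent over \<open>K\<close>, so one of maximal size exists, and it cannot be extended.\<close>

theorem adapted_basis_exists:
  obtains B lev where "adapted B lev" "Wspan B = UNIV"
proof -
  define P where "P n \<longleftrightarrow> (\<exists>B lev. adapted B lev \<and> card B = n)" for n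
  have bound: "n \<le> CARD('n)" if "P n" for n
    using that adapted_independent independent_card_le unfolding P_def by blast
  have "P 0" using adapted_empty unfolding P_def by fastforce
  then have "P (GREATEST n. P n)" by (rule GreatestI_nat) (use bound in auto)
  then obtain B lev where B: "adapted B lev" "card B = (GREATEST n. P n)" unfolding P_def by blast
  have "Wspan B = UNIV"
  proof (rule ccontr)
    assume "Wspan B \<noteq> UNIV"
    then obtain B' lev' where B': "adapted B' lev'" "card B < card B'" using adapted_extend[OF B(1)] by blast
    then have "card B' \<le> (GREATEST n. P n)" using bound by (intro Greatest_le_nat) (auto simp: P_def)
    then show False using B' B(2) by simp
  qed
  then show ?thesis using that B(1) by blast
qed

end

section \<open>Direct summands of the free Laurent module\<close>

context stable_chain
begin

lemma adapted_complement:
  assumes ad: "adapted B lev" and full: "Wspan B = UNIV"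
  shows "submodule_over laurent (combos laurent B)" "invariant_under \<Gamma> (combos laurent B)"
    "complementary (free_laurent \<inter> W0) (combos laurent B)"
proof -
  note fin = adaptedD(1)[OF ad] and BR = adaptedD(2)[OF ad]
  show sub: "submodule_over laurent (combos laurent B)"
    by (rule submodule_combos[OF subring_laurent])
  show "invariant_under \<Gamma> (combos laurent B)"
    by (rule adapted_inv[OF ad subring_laurent consts_laurent])
  have N: "combos laurent B \<subseteq> free_laurent" by (rule combos_subset[OF submodule_free_laurent BR])
  have "x = 0" if x: "x \<in> combos laurent B" "x \<in> W0" for x
  proof -
    obtain c where c: "x = (\<Sum>b\<in>B. c b *s b)" using x(1) unfolding combos_def by blast
    then have "c b = 0" if "b \<in> B" for b using adapted_indep[OF ad, of c b] x(2) that by simp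
    then show "x = 0" unfolding c by simp
  qed
  moreover have "0 \<in> combos laurent B" "0 \<in> free_laurent \<inter> W0"
    using submodule_overD(1)[OF sub] submodule_overD(1)[OF submodule_free_laurent] vec.subspace_0[OF W0(1)]
    by auto
  ultimately have "(free_laurent \<inter> W0) \<inter> combos laurent B = {0}" by blast
  moreover have "{x + y |x y. x \<in> free_laurent \<inter> W0 \<and> y \<in> combos laurent B} = free_laurent"
  proof (intro equalityI subsetI)
    fix z assume "z \<in> {x + y |x y. x \<in> free_laurent \<inter> W0 \<and> y \<in> combos laurent B}"
    then show "z \<in> free_laurent" using N submodule_overD(2)[OF submodule_free_laurent] by blast
  next
    fix x assume x: "x \<in> (free_laurent :: ('k ratfun ^ 'n) set)"
    obtain c where c: "x - (\<Sum>b\<in>B. c b *s b) \<in> W0" using full Wspan_iff[OF fin, of x] by blast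
    have y: "(\<Sum>b\<in>B. c b *s b) \<in> combos laurent B"
      using adaptedD(5)[OF ad x c] by (intro combosI[of _ c]) auto
    have "x - (\<Sum>b\<in>B. c b *s b) \<in> free_laurent"
      by (rule submodule_over_diff[OF submodule_free_laurent subring_laurent x N[THEN subsetD, OF y]])
    moreover have "x = (x - (\<Sum>b\<in>B. c b *s b)) + (\<Sum>b\<in>B. c b *s b)" by simp
    ultimately show "x \<in> {x + y |x y. x \<in> free_laurent \<inter> W0 \<and> y \<in> combos laurent B}"
      using c y by blast
  qed
  ultimately show "complementary (free_laurent \<inter> W0) (combos laurent B)" unfolding complementary_def by blast
qed

end

lemma lattice_std: "lattice_in e (std_module (val_ring e) :: ('k::field ratfun ^ 'n::finite) set)"
  unfolding lattice_in_matrix by (intro exI[of _ "mat 1"]) simp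

text \<open>The trivial group stabilizes every lattice and every subspace, and a line spanned by a vector
outside \<open>W\<close> serves as complement. So there is an adapted basis modulo \<open>W\<close>.\<close>

lemma saturated_direct_summand:
  fixes W :: "('k::field ratfun ^ 'n::finite) set"
  assumes W: "vec.subspace W"
  shows "direct_summand (free_laurent \<inter> W)"
proof -
  interpret stable_chain SPlus "{}" "\<lambda>_. std_module (val_ring SPlus)" 0
    "std_module (val_ring (opp SPlus))" W
  proof
    show "lattice_in SPlus (std_module (val_ring SPlus) :: ('k ratfun ^ 'n) set)" by (rule lattice_std)
    show "lattice_in (opp SPlus) (std_module (val_ring (opp SPlus)) :: ('k ratfun ^ 'n) set)" by (rule lattice_std)
    show "scale_set (unif SPlus) (std_module (val_ring SPlus)) \<subseteq> (std_module (val_ring SPlus) :: ('k ratfun ^ 'n) set)"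
      using submodule_overD(3)[OF submodule_std[OF subring_val_ring] unif_in_val_ring] unfolding scale_set_def by blast
    show "vec.subspace W" by (rule W)
    fix W X :: "('k ratfun ^ 'n) set"
    assume W: "vec.subspace W" and X: "stable_subspace {} X" and "\<not> X \<subseteq> W"
    then obtain x where x: "x \<in> X" "x \<notin> W" by blast
    have "y = 0" if y: "y \<in> combos consts_in {x}" "y \<in> W" for y
    proof -
      obtain c where c: "y = c *s x" using y(1) unfolding combos_def by auto
      have "c = 0"
      proof (rule ccontr)
        assume "c \<noteq> 0"
        have "inverse c *s y \<in> W" by (rule vec.subspace_scale[OF W y(2)])
        then show False using x(2) \<open>c \<noteq> 0\<close> by (simp add: c vector_smult_assoc)
      qed
      then show ?thesis using c by simp
    qed
    moreover have "x \<in> combos consts_in {x}" by (rule combos_base[OF subring_consts]) auto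
    moreover have "x \<noteq> 0" using x(2) vec.subspace_0[OF W] by blast
    moreover have "combos consts_in {x} \<subseteq> X" using x(1) X by (intro combos_subset) simp_all
    ultimately show "\<exists>C. stable_subspace {} C \<and> C \<subseteq> X \<and> C \<noteq> {0} \<and> C \<inter> W \<subseteq> {0}"
      by (intro exI[of _ "combos consts_in {x}"])
        (auto simp: invariant_under_def intro: submodule_combos[OF subring_consts])
  qed (auto simp: invariant_under_def)
  obtain B lev where B: "adapted B lev" "Wspan B = UNIV" by (rule adapted_basis_exists)
  show ?thesis unfolding direct_summand_def
    using adapted_complement(1,3)[OF B] submodule_over_Int[OF submodule_free_laurent submodule_over_subspace[OF W]]
    by blast
qed

lemma direct_summand_subset: "direct_summand M \<Longrightarrow> M \<subseteq> free_laurent"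
proof
  fix x assume "direct_summand M" "x \<in> M"
  then obtain N where "submodule_over laurent N" "complementary M N" unfolding direct_summand_def by blast
  then have "x + 0 \<in> free_laurent" using \<open>x \<in> M\<close> submodule_overD(1) unfolding complementary_def by blast
  then show "x \<in> free_laurent" by simp
qed

text \<open>A vector of \<open>R\<^sup>n\<close> in the \<open>K\<close>-span of \<open>M\<close> has a nonzero multiple in \<open>M\<close>, and a complement of
\<open>M\<close> has no torsion.\<close>

lemma direct_summand_saturated:
  fixes M :: "('k::field ratfun ^ 'n::finite) set"
  assumes "direct_summand M"
  shows "free_laurent \<inter> vec.span M = M"
proof (intro equalityI subsetI)
  obtain N where M: "submodule_over laurent M" and N: "submodule_over laurent N" "complementary M N"
    using assms unfolding direct_summand_def by blast
  fix x assume "x \<in> free_laurent \<inter> vec.span M"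
  then have x: "x \<in> free_laurent" "x \<in> vec.span M" by auto
  have "\<exists>s\<in>laurent. s \<noteq> 0 \<and> s *s x \<in> M"
    using x(2)
  proof (induction rule: vec.span_induct_alt)
    case base
    show ?case using laurent_closed(2) submodule_overD(1)[OF M] by (intro bexI[of _ 1]) auto
  next
    case (step c a y)
    obtain s where s: "s \<in> laurent" "s \<noteq> 0" "s *s y \<in> M" using step by blast
    obtain u where u: "u \<in> laurent" "u \<noteq> 0" "u * c \<in> laurent" using laurent_frac by blast
    have "(s * (u * c)) *s a + u *s (s *s y) \<in> M"
      by (intro submodule_overD(2)[OF M] submodule_overD(3)[OF M u(1) s(3)]
          submodule_overD(3)[OF M laurent_closed(4)[OF s(1) u(3)] step(1)])
    moreover have "(s * u) *s (c *s a + y) = (s * (u * c)) *s a + u *s (s *s y)"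
      by (simp add: vector_add_ldistrib vector_smult_assoc mult_ac)
    ultimately have "(s * u) *s (c *s a + y) \<in> M" by simp
    then show ?case using laurent_closed(4)[OF s(1) u(1)] s(2) u(2) by (intro bexI[of _ "s * u"]) auto
  qed
  then obtain s where s: "s \<in> laurent" "s \<noteq> 0" "s *s x \<in> M" by blast
  obtain m n where mn: "x = m + n" "m \<in> M" "n \<in> N"
    using x(1) N(2) unfolding complementary_def by blast
  have eq: "s *s n = s *s x - s *s m" by (simp add: mn vector_add_ldistrib)
  have "s *s n \<in> M" unfolding eq
    by (rule submodule_over_diff[OF M subring_laurent s(3) submodule_overD(3)[OF M s(1) mn(2)]])
  moreover have "s *s n \<in> N" by (rule submodule_overD(3)[OF N(1) s(1) mn(3)])
  ultimately have "s *s n \<in> {0}" using N(2) unfolding complementary_def by blast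
  then have "n = 0" using s(2) by simp
  then show "x \<in> M" using mn by simp
next
  fix x assume "x \<in> M"
  then show "x \<in> free_laurent \<inter> vec.span M"
    using direct_summand_subset[OF assms] vec.span_base by blast
qed

section \<open>Volumes and the lattices of a fixed simplex\<close>

lemma det_in_subring:
  fixes H :: "'a::field ^ 'n::finite ^ 'n"
  assumes S: "subring_of S" and H: "\<And>i j. H $ i $ j \<in> S"
  shows "det H \<in> S"
proof -
  have prod: "(\<Prod>i\<in>I. f i) \<in> S" if "\<And>i. f i \<in> S" "finite I" for f :: "'n \<Rightarrow> 'a" and I
    using that(2) by induction (auto intro: subring_ofD[OF S] that(1))
  have "(\<Sum>p\<in>P. of_int (sign p) * (\<Prod>i\<in>UNIV. H $ i $ p i)) \<in> S" if "finite P" for P :: "('n \<Rightarrow> 'n) set"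
    using that
  proof induction
    case (insert p P)
    have "of_int (sign p) \<in> S" using subring_ofD(2,5)[OF S] by (simp add: sign_def)
    then show ?case using insert prod[of "\<lambda>i. H $ i $ p i" UNIV] H
      by (auto intro!: subring_ofD(3,4)[OF S])
  qed (simp add: subring_ofD[OF S])
  then show ?thesis unfolding det_def by (simp add: finite_permutations)
qed

lemma matrix_std_image_subset:
  fixes F G :: "'a::field ^ 'n::finite ^ 'n"
  assumes S: "subring_of S" and G: "det G \<noteq> 0"
    and sub: "(*v) F ` std_module S \<subseteq> (*v) G ` std_module S"
  obtains H :: "'a ^ 'n ^ 'n" where "F = G ** H" "\<And>i j. H $ i $ j \<in> S"
proof -
  obtain G' where G': "G ** G' = mat 1" "G' ** G = mat 1" using inverse_matrix[OF G] by metis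
  define H where "H = G' ** F"
  have "H $ i $ j \<in> S" for i j
  proof -
    have "axis j 1 \<in> std_module S" unfolding std_module_def axis_def by (auto simp: subring_ofD[OF S])
    then obtain v where v: "v \<in> std_module S" "F *v axis j 1 = G *v v" using sub by blast
    have "H *v axis j 1 = v"
      unfolding H_def by (simp add: matrix_vector_mul_assoc[symmetric] v(2))
        (simp add: matrix_vector_mul_assoc G')
    moreover have "(H *v axis j 1) $ i = H $ i $ j"
      by (simp add: matrix_vector_mult_def axis_def if_distrib[of "\<lambda>c. _ * c"] cong: if_cong)
    ultimately have "H $ i $ j = v $ i" by simp
    then show ?thesis using v(1) unfolding std_module_def by simp
  qed
  moreover have "F = G ** H" unfolding H_def by (simp add: matrix_mul_assoc G')
  ultimately show ?thesis using that by blast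
qed

text \<open>Cramer's rule.\<close>

lemma std_image_unimodular:
  fixes H :: "'k::field ratfun ^ 'n::finite ^ 'n"
  assumes H: "\<And>i j. H $ i $ j \<in> val_ring e" and det: "det H \<noteq> 0" "val e (det H) = 0"
  shows "std_module (val_ring e) \<subseteq> (*v) H ` std_module (val_ring e)"
proof
  fix v :: "'k ratfun ^ 'n" assume v: "v \<in> std_module (val_ring e)"
  define x where "x = (\<chi> k. det (\<chi> i j. if j = k then v $ i else H $ i $ j) / det H)"
  have "H *v x = v" using cramer[OF det(1), of x v] unfolding x_def by blast
  moreover have "x $ k \<in> val_ring e" for k
  proof -
    have 1: "det (\<chi> i j. if j = k then v $ i else H $ i $ j) \<in> val_ring e"
      using v H by (intro det_in_subring[OF subring_val_ring]) (auto simp: std_module_def)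
    have "inverse (det H) \<in> val_ring e" using det by (simp add: val_ring_def val_inverse)
    from val_ring_mult[OF 1 this] show ?thesis unfolding x_def by (simp add: divide_inverse)
  qed
  ultimately show "v \<in> (*v) H ` std_module (val_ring e)" unfolding std_module_def by auto
qed

text \<open>The volume is unique because a change of basis has a unit as determinant; see \<open>has_vol_unique\<close>.\<close>

definition has_vol :: "pm \<Rightarrow> ('k::field ratfun ^ 'n::finite) set \<Rightarrow> int \<Rightarrow> bool" where
  "has_vol e L d \<longleftrightarrow> (\<exists>F. det F \<noteq> 0 \<and> L = (*v) F ` std_module (val_ring e) \<and> d = val e (det F))"

lemma has_vol_mono:
  fixes L L' :: "('k::field ratfun ^ 'n::finite) set"
  assumes "has_vol e L d" "has_vol e L' d'" "L \<subseteq> L'"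
  shows "d' \<le> d" "d = d' \<Longrightarrow> L = L'"
proof -
  obtain F G where F: "det F \<noteq> 0" "L = (*v) F ` std_module (val_ring e)" "d = val e (det F)"
    and G: "det G \<noteq> 0" "L' = (*v) G ` std_module (val_ring e)" "d' = val e (det G)"
    using assms(1,2) unfolding has_vol_def by blast
  obtain H :: "'k ratfun ^ 'n ^ 'n" where H: "F = G ** H" "\<And>i j. H $ i $ j \<in> val_ring e"
    using matrix_std_image_subset[OF subring_val_ring G(1)] assms(3) unfolding F(2) G(2) by metis
  have det: "det F = det G * det H" unfolding H(1) by (rule det_mul)
  then have nz: "det H \<noteq> 0" using F(1) by auto
  have d: "d = d' + val e (det H)" unfolding F(3) G(3) det by (rule val_mult[OF G(1) nz])
  have "0 \<le> val e (det H)"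
    using det_in_subring[OF subring_val_ring H(2)] by (simp add: val_ring_def)
  then show "d' \<le> d" using d by simp
  assume "d = d'"
  then have "std_module (val_ring e) \<subseteq> (*v) H ` std_module (val_ring e)"
    using d H(2) nz by (intro std_image_unimodular) auto
  then have "(*v) G ` std_module (val_ring e) \<subseteq> (*v) G ` ((*v) H ` std_module (val_ring e))" by (rule image_mono)
  also have "\<dots> = (*v) F ` std_module (val_ring e)"
    unfolding H(1) by (simp add: image_image matrix_vector_mul_assoc)
  finally show "L = L'" using assms(3) unfolding F(2) G(2) by blast
qed

lemma has_vol_exists:
  assumes "lattice_in e L"
  shows "\<exists>d. has_vol e L d"
proof -
  obtain F where "det F \<noteq> 0" "L = (*v) F ` std_module (val_ring e)"
    using assms unfolding lattice_in_matrix by blast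
  then have "has_vol e L (val e (det F))" unfolding has_vol_def by blast
  then show ?thesis ..
qed

lemma has_vol_unique:
  assumes "has_vol e L d" "has_vol e L d'"
  shows "d = d'"
  using has_vol_mono(1)[OF assms order_refl] has_vol_mono(1)[OF assms(2,1) order_refl] by simp

lemma has_vol_act:
  assumes "has_vol e L d" "det g = 1"
  shows "has_vol e ((*v) g ` L) d"
proof -
  obtain F where F: "det F \<noteq> 0" "L = (*v) F ` std_module (val_ring e)" "d = val e (det F)"
    using assms(1) unfolding has_vol_def by blast
  have "(*v) g ` L = (*v) (g ** F) ` std_module (val_ring e)"
    unfolding F(2) by (simp add: image_image matrix_vector_mul_assoc)
  then show ?thesis unfolding has_vol_def using F assms(2) by (intro exI[of _ "g ** F"]) (simp add: det_mul)
qed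

lemma has_vol_scale:
  fixes L :: "('k::field ratfun ^ 'n::finite) set"
  assumes "has_vol e L d" "c \<noteq> 0"
  shows "has_vol e (scale_set c L) (d + int CARD('n) * val e c)"
proof -
  obtain F where F: "det F \<noteq> 0" "L = (*v) F ` std_module (val_ring e)" "d = val e (det F)"
    using assms(1) unfolding has_vol_def by blast
  define D :: "'k ratfun ^ 'n ^ 'n" where "D = (\<chi> i j. if i = j then c else 0)"
  have D: "D *v x = c *s x" for x
    unfolding D_def by (simp add: matrix_vector_mult_def vec_eq_iff if_distrib[of "\<lambda>c. c * _"] cong: if_cong)
  have detD: "det D = c ^ CARD('n)" unfolding D_def by (subst det_diagonal) auto
  have "val e (c ^ m) = int m * val e c" for m
    by (induction m) (simp_all add: val_mult assms(2) algebra_simps)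
  then have "val e (det (D ** F)) = d + int CARD('n) * val e c"
    unfolding det_mul detD F(3) using F(1) assms(2) by (simp add: val_mult)
  moreover have "scale_set c L = (*v) (D ** F) ` std_module (val_ring e)"
    unfolding F(2) scale_set_def by (simp add: image_image D matrix_vector_mul_assoc[symmetric])
  moreover have "det (D ** F) \<noteq> 0" using F(1) assms(2) by (simp add: det_mul detD)
  ultimately show ?thesis unfolding has_vol_def by metis
qed

lemma scale_set_compose: "scale_set c (scale_set d L) = scale_set (c * d) L"
  unfolding scale_set_def by (simp add: image_image vector_smult_assoc)

lemma scale_set_1 [simp]: "scale_set 1 L = L"
  unfolding scale_set_def by simp

lemma scale_set_unit:
  assumes "submodule_over (val_ring e) L" "c \<noteq> 0" "val e c = 0"
  shows "scale_set c L = L"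
proof -
  have *: "scale_set u L \<subseteq> L" if "val e u = 0" for u
    unfolding scale_set_def using submodule_overD(3)[OF assms(1), of u] that by (auto simp: val_ring_def)
  have "scale_set c (scale_set (inverse c) L) \<subseteq> scale_set c L"
    using *[of "inverse c"] assms(3) unfolding scale_set_def[of c] by (intro image_mono) (simp add: val_inverse)
  then show ?thesis using *[OF assms(3)] assms(2) by (simp add: scale_set_compose)
qed

lemma act_scale: "(*v) g ` scale_set c L = scale_set c ((*v) g ` L)"
  unfolding scale_set_def by (simp add: image_image vec.scale)

lemma act_homothety: "act_vertex g (homothety_class L) = homothety_class ((*v) g ` L)"
  unfolding act_vertex_def homothety_class_def by (auto simp: act_scale[symmetric])

lemma in_homothety_class: "L \<in> homothety_class L"
  unfolding homothety_class_def using scale_set_1 by (metis (mono_tags, lifting) mem_Collect_eq one_neq_zero)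

lemma homothety_class_eq:
  assumes "homothety_class L = homothety_class M"
  obtains c where "c \<noteq> 0" "L = scale_set c M"
proof -
  have "L \<in> homothety_class M" using in_homothety_class[of L] assms by simp
  then show ?thesis using that unfolding homothety_class_def by blast
qed

lemma homothety_class_scale: "c \<noteq> 0 \<Longrightarrow> homothety_class (scale_set c L) = homothety_class L"
proof -
  assume c: "c \<noteq> 0"
  have "scale_set d L \<in> homothety_class (scale_set c L)" if "d \<noteq> 0" for d
  proof -
    have "scale_set d L = scale_set (d / c) (scale_set c L)" using c by (simp add: scale_set_compose)
    then show ?thesis unfolding homothety_class_def using c that by (intro CollectI exI[of _ "d / c"]) simp
  qed
  moreover have "scale_set d (scale_set c L) \<in> homothety_class L" if "d \<noteq> 0" for d
    unfolding homothety_class_def scale_set_compose using c that by (intro CollectI exI[of _ "d * c"]) simp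
  ultimately show ?thesis unfolding homothety_class_def by blast
qed

text \<open>The volume increases strictly along the chain and by \<open>n\<close> from \<open>L 0\<close> to \<open>\<pi> L 0\<close>.\<close>

lemma chain_vols:
  fixes L :: "nat \<Rightarrow> ('k::field ratfun ^ 'n::finite) set"
  assumes lat: "\<And>i. i \<le> r \<Longrightarrow> lattice_in e (L i)" and dec: "\<And>i. i < r \<Longrightarrow> L (Suc i) \<subset> L i"
    and per: "scale_set (unif e) (L 0) \<subset> L r"
  obtains d where "\<And>i. i \<le> r \<Longrightarrow> has_vol e (L i) (d i)" "\<And>i j. i \<le> r \<Longrightarrow> j \<le> r \<Longrightarrow> d i < d j + int CARD('n)"
    "\<And>i j. i \<le> j \<Longrightarrow> j \<le> r \<Longrightarrow> L j \<subseteq> L i"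
proof -
  obtain d where d: "\<And>i. i \<le> r \<Longrightarrow> has_vol e (L i) (d i)" using has_vol_exists[OF lat] by metis
  have mono: "L j \<subseteq> L i" if "i \<le> j" "j \<le> r" for i j
    using that
  proof (induction rule: dec_induct)
    case (step n)
    then show ?case using dec[of n] by auto
  qed simp
  have dmono: "d i \<le> d j" if "i \<le> j" "j \<le> r" for i j
    using has_vol_mono(1)[OF d d mono[OF that]] that by simp
  have sc: "has_vol e (scale_set (unif e) (L 0)) (d 0 + int CARD('n))"
    using has_vol_scale[OF d[of 0], of "unif e"] by (simp add: val_unif)
  have "d r < d 0 + int CARD('n)"
    using has_vol_mono[OF sc d[of r]] per by (metis order_le_less order_refl psubset_imp_subset psubsetE)
  then have "d i < d j + int CARD('n)" if "i \<le> r" "j \<le> r" for i j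
    using dmono[of i r] dmono[of 0 j] that by simp
  then show ?thesis using that d mono by blast
qed

lemma simplicesE:
  assumes "\<sigma> \<in> simplices e"
  obtains L r where "\<sigma> = (\<lambda>i. homothety_class (L i)) ` {..r}"
    "\<And>i. i \<le> r \<Longrightarrow> lattice_in e (L i)" "\<And>i. i < r \<Longrightarrow> L (Suc i) \<subset> L i"
    "scale_set (unif e) (L 0) \<subset> L r"
proof -
  from assms obtain L r where "\<sigma> = (\<lambda>i. homothety_class (L i)) ` {..r} \<and> (\<forall>i\<le>r. lattice_in e (L i)) \<and>
      (\<forall>i<r. L (Suc i) \<subset> L i) \<and> scale_set (unif e) (L 0) \<subset> L r"
    unfolding simplices_def by (elim CollectE exE) (rule that)
  then show ?thesis by (intro that[of L r]) simp_all
qed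

text \<open>The group acts without changing volumes, hence the types of vertices: an element that maps \<open>L i\<close> to
\<open>c L j\<close> changes the volume by \<open>d j - d i\<close> plus a multiple of \<open>n\<close>, and \<open>\<bar>d j - d i\<bar> < n\<close>. So \<open>c\<close> is a unit,
and comparable lattices of the same volume are equal.\<close>

lemma fixed_simplex_lattice:
  fixes \<Gamma> :: "('k::field ratfun ^ 'n::finite ^ 'n) set"
  assumes \<sigma>: "\<sigma> \<in> fixed_complex \<Gamma> e" and det: "\<And>g. g \<in> \<Gamma> \<Longrightarrow> det g = 1"
    and v: "v \<in> \<sigma>" "M \<in> v"
  shows "invariant_under \<Gamma> M"
proof -
  have "\<sigma> \<in> simplices e" using \<sigma> unfolding fixed_complex_def by blast
  then obtain L r where \<sigma>_eq: "\<sigma> = (\<lambda>i. homothety_class (L i)) ` {..r}"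
    and lat: "\<And>i. i \<le> r \<Longrightarrow> lattice_in e (L i)" and dec: "\<And>i. i < r \<Longrightarrow> L (Suc i) \<subset> L i"
    and per: "scale_set (unif e) (L 0) \<subset> L r"
    by (rule simplicesE) (rule that, assumption+)
  obtain d where d: "\<And>i. i \<le> r \<Longrightarrow> has_vol e (L i) (d i)"
    and dlt: "\<And>i j. i \<le> r \<Longrightarrow> j \<le> r \<Longrightarrow> d i < d j + int CARD('n)"
    and mono: "\<And>i j. i \<le> j \<Longrightarrow> j \<le> r \<Longrightarrow> L j \<subseteq> L i"
    using chain_vols[of r e L, OF lat dec per] by metis
  have stab: "(*v) g ` L i = L i" if i: "i \<le> r" and g: "g \<in> \<Gamma>" for i g
  proof -
    have "act_vertex g (homothety_class (L i)) \<in> \<sigma>"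
      using \<sigma> g i unfolding \<sigma>_eq fixed_complex_def by blast
    then obtain j where j: "j \<le> r" "homothety_class ((*v) g ` L i) = homothety_class (L j)"
      unfolding \<sigma>_eq act_homothety by blast
    obtain c where c: "c \<noteq> 0" "(*v) g ` L i = scale_set c (L j)" by (rule homothety_class_eq[OF j(2)])
    have eq: "d i = d j + int CARD('n) * val e c"
      using has_vol_act[OF d[OF i] det[OF g]] has_vol_scale[OF d[OF j(1)] c(1)] unfolding c(2)
      by (rule has_vol_unique)
    have "val e c = 0"
    proof (rule ccontr)
      assume "val e c \<noteq> 0"
      then consider "val e c \<ge> 1" | "val e c \<le> -1" by linarith
      then show False
      proof cases
        case 1
        then have "int CARD('n) * val e c \<ge> int CARD('n) * 1" by (intro mult_left_mono) auto
        then show False using eq dlt[OF i j(1)] by simp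
      next
        case 2
        then have "int CARD('n) * val e c \<le> int CARD('n) * (-1)" by (intro mult_left_mono) auto
        then show False using eq dlt[OF j(1) i] by simp
      qed
    qed
    then have gL: "(*v) g ` L i = L j" and "d i = d j"
      using c scale_set_unit[OF lattice_submodule[OF lat[OF j(1)]] c(1)] eq by auto
    moreover have "L i = L j"
    proof (cases "i \<le> j")
      case True
      then show ?thesis using has_vol_mono(2)[OF d d mono[OF True j(1)]] i j \<open>d i = d j\<close> by simp
    next
      case False
      then have "j \<le> i" by simp
      then show ?thesis using has_vol_mono(2)[OF d d mono[OF \<open>j \<le> i\<close> i]] i j \<open>d i = d j\<close> by simp
    qed
    ultimately show ?thesis by simp
  qed
  obtain i where i: "i \<le> r" "v = homothety_class (L i)" using v(1) unfolding \<sigma>_eq by blast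
  obtain c where c: "M = scale_set c (L i)" using v(2) unfolding i(2) homothety_class_def by blast
  have "(*v) g ` M = M" if "g \<in> \<Gamma>" for g unfolding c act_scale stab[OF i(1) that] ..
  then show ?thesis unfolding invariant_under_def by blast
qed

lemma invariant_lattice_image:
  assumes L: "lattice_in e L" and det: "det g = 1" and inv: "(*v) g ` L \<subseteq> L"
  shows "(*v) g ` L = L"
proof -
  obtain d where d: "has_vol e L d" using has_vol_exists[OF L] by blast
  show ?thesis by (rule has_vol_mono(2)[OF has_vol_act[OF d det] d inv refl])
qed

lemma fixed_complexI:
  fixes \<Gamma> :: "('k::field ratfun ^ 'n::finite ^ 'n) set"
  assumes det: "\<And>g. g \<in> \<Gamma> \<Longrightarrow> det g = 1"
    and lat: "\<And>i. i \<le> r \<Longrightarrow> lattice_in e (L i)" and dec: "\<And>i. i < r \<Longrightarrow> L (Suc i) \<subset> L i"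
    and per: "scale_set (unif e) (L 0) \<subset> L r" and inv: "\<And>i. i \<le> r \<Longrightarrow> invariant_under \<Gamma> (L i)"
  shows "(\<lambda>i. homothety_class (L i)) ` {..r} \<in> fixed_complex \<Gamma> e"
proof -
  have "act_vertex g (homothety_class (L i)) = homothety_class (L i)" if "g \<in> \<Gamma>" "i \<le> r" for g i
  proof -
    have "(*v) g ` L i \<subseteq> L i" using inv[OF that(2)] that(1) unfolding invariant_under_def by blast
    then show ?thesis unfolding act_homothety using invariant_lattice_image[OF lat[OF that(2)] det[OF that(1)]] by simp
  qed
  then have "act_vertex g ` (\<lambda>i. homothety_class (L i)) ` {..r} = (\<lambda>i. homothety_class (L i)) ` {..r}"
    if "g \<in> \<Gamma>" for g
    using that by (simp add: image_image)
  moreover have "(\<lambda>i. homothety_class (L i)) ` {..r} \<in> simplices e"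
    unfolding simplices_def using lat dec per by blast
  ultimately show ?thesis unfolding fixed_complex_def by blast
qed

section \<open>Opposite simplices\<close>

lemma lincombs_scaled_iff:
  assumes "\<And>i. s i \<noteq> 0"
  shows "x \<in> lincombs S (\<lambda>i. s i *s f i) \<longleftrightarrow> (\<exists>c. x = (\<Sum>i\<in>UNIV. c i *s f i) \<and> (\<forall>i. c i / s i \<in> S))"
proof
  assume "x \<in> lincombs S (\<lambda>i. s i *s f i)"
  then obtain c where "range c \<subseteq> S" "x = (\<Sum>i\<in>UNIV. c i *s (s i *s f i))" unfolding lincombs_def by blast
  then show "\<exists>c. x = (\<Sum>i\<in>UNIV. c i *s f i) \<and> (\<forall>i. c i / s i \<in> S)"
    using assms by (intro exI[of _ "\<lambda>i. c i * s i"]) (auto simp: vector_smult_assoc)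
next
  assume "\<exists>c. x = (\<Sum>i\<in>UNIV. c i *s f i) \<and> (\<forall>i. c i / s i \<in> S)"
  then obtain c where c: "x = (\<Sum>i\<in>UNIV. c i *s f i)" "\<forall>i. c i / s i \<in> S" by blast
  then have "x = (\<Sum>i\<in>UNIV. (c i / s i) *s (s i *s f i))" using assms by (simp add: vector_smult_assoc)
  then show "x \<in> lincombs S (\<lambda>i. s i *s f i)" unfolding lincombs_def
    using c(2) by (intro CollectI exI[of _ "\<lambda>i. c i / s i"]) auto
qed

lemma lincombs_iff: "x \<in> lincombs S f \<longleftrightarrow> (\<exists>c. x = (\<Sum>i\<in>UNIV. c i *s f i) \<and> (\<forall>i. c i \<in> S))"
  using lincombs_scaled_iff[of "\<lambda>_. 1" x S f] by simp

lemma lincombs_single: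
  assumes "0 \<in> S" "c / s i \<in> S" "\<And>i. s i \<noteq> 0"
  shows "c *s f i \<in> lincombs S (\<lambda>i. s i *s f i)"
  unfolding lincombs_scaled_iff[OF assms(3)]
proof (intro exI[of _ "\<lambda>j. if j = i then c else 0"] conjI allI)
  show "c *s f i = (\<Sum>j\<in>UNIV. (if j = i then c else 0) *s f j)" by (simp add: sum_single)
qed (use assms in auto)

lemma lincombs_subset: "submodule_over S M \<Longrightarrow> (\<And>i. f i \<in> M) \<Longrightarrow> lincombs S f \<subseteq> M"
  unfolding lincombs_def by (auto intro!: submodule_over_sum submodule_overD(3))

lemma lincombs_scaled_mono:
  fixes f :: "'n::finite \<Rightarrow> 'k::field ratfun ^ 'n"
  assumes S: "subring_of S" and "\<And>i. s i \<noteq> 0" "\<And>i. u i \<noteq> 0" "\<And>i. s i / u i \<in> S"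
  shows "lincombs S (\<lambda>i. s i *s f i) \<subseteq> lincombs S (\<lambda>i. u i *s f i)"
proof (rule lincombs_subset)
  show "submodule_over S (lincombs S (\<lambda>i. u i *s f i))"
    unfolding lincombs_colmat by (rule submodule_image[OF submodule_std[OF S]])
  show "s i *s f i \<in> lincombs S (\<lambda>i. u i *s f i)" for i
    using lincombs_single[where s = u and c = "s i" and i = i] assms subring_ofD(1)[OF S] by blast
qed

lemma lincombs_scaled_monoD:
  fixes f :: "'n::finite \<Rightarrow> 'k::field ratfun ^ 'n"
  assumes S: "subring_of S" and det: "det (colmat f) \<noteq> 0" and s: "\<And>i. s i \<noteq> 0" and u: "\<And>i. u i \<noteq> 0"
    and sub: "lincombs S (\<lambda>i. s i *s f i) \<subseteq> lincombs S (\<lambda>i. u i *s f i)"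
  shows "s i / u i \<in> S"
proof -
  have "s i *s f i \<in> lincombs S (\<lambda>i. s i *s f i)"
    using lincombs_single[where s = s and c = "s i" and i = i] s subring_ofD(1,2)[OF S] by simp
  then obtain c where c: "s i *s f i = (\<Sum>j\<in>UNIV. c j *s f j)" "\<forall>j. c j / u j \<in> S"
    using sub lincombs_scaled_iff[of u, OF u] by blast
  have "s i *s f i = (\<Sum>j\<in>UNIV. (if j = i then s i else 0) *s f j)" by (simp add: sum_single)
  then have "(\<Sum>j\<in>UNIV. (if j = i then s i else 0) *s f j) = (\<Sum>j\<in>UNIV. c j *s f j)" using c(1) by simp
  from coeffs_unique[OF det this, of i] show ?thesis using c(2) by simp
qed

lemma scale_lincombs: "scale_set c (lincombs S f) = lincombs S (\<lambda>i. c *s f i)"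
proof (intro equalityI subsetI)
  fix x assume "x \<in> scale_set c (lincombs S f)"
  then obtain d where "range d \<subseteq> S" "x = c *s (\<Sum>i\<in>UNIV. d i *s f i)"
    unfolding scale_set_def lincombs_def by blast
  then show "x \<in> lincombs S (\<lambda>i. c *s f i)" unfolding lincombs_def
    by (intro CollectI exI[of _ d]) (simp add: vec.scale_sum_right vector_smult_assoc mult.commute)
next
  fix x assume "x \<in> lincombs S (\<lambda>i. c *s f i)"
  then obtain d where d: "range d \<subseteq> S" "x = (\<Sum>i\<in>UNIV. d i *s (c *s f i))" unfolding lincombs_def by blast
  then have "x = c *s (\<Sum>i\<in>UNIV. d i *s f i)"
    by (simp add: vec.scale_sum_right vector_smult_assoc mult.commute)
  then show "x \<in> scale_set c (lincombs S f)" unfolding scale_set_def lincombs_def using d(1) by blast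
qed

text \<open>The valuation of \<open>t\<close>. Apartments are described by powers of \<open>t\<close>, lattice chains by powers of the
uniformizer.\<close>

fun tsign :: "pm \<Rightarrow> int" where
  "tsign SPlus = 1"
| "tsign SMinus = - 1"

lemma tsign_sq: "tsign e * (tsign e * a) = a" by (cases e) simp_all

lemma tvar_powi: "(tvar powi a :: 'k::field ratfun) = unif e powi (tsign e * a)"
  by (cases e) (simp_all add: power_int_minus power_int_inverse)

lemma unif_powi: "(unif e powi a :: 'k::field ratfun) = tvar powi (tsign e * a)"
  unfolding tvar_powi[of "tsign e * a" e] tsign_sq ..

lemma val_tvar_powi: "val e (tvar powi a :: 'k::field ratfun) = tsign e * a"
  unfolding tvar_powi[of a e] by (rule val_unif_powi)

lemma lattice_class_shift:
  fixes f :: "'n::finite \<Rightarrow> 'k::field ratfun ^ 'n"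
  assumes "\<And>i. b i = a i + m"
  shows "lattice_class e (\<lambda>i. tvar powi b i *s f i) = lattice_class e (\<lambda>i. tvar powi a i *s f i)"
proof -
  have eq: "(\<lambda>i. tvar powi b i *s f i) = (\<lambda>i. tvar powi m *s (tvar powi a i *s f i))"
    by (simp add: assms power_int_add vector_smult_assoc mult.commute)
  show ?thesis
    unfolding lattice_class_def eq scale_lincombs[symmetric] by (rule homothety_class_scale) simp
qed

lemma lattice_class_eqD:
  fixes f :: "'n::finite \<Rightarrow> 'k::field ratfun ^ 'n"
  assumes det: "det (colmat f) \<noteq> 0"
    and eq: "lattice_class e (\<lambda>i. tvar powi b i *s f i) = lattice_class e (\<lambda>i. tvar powi a i *s f i)"
  obtains m where "\<And>i. b i = a i + m"
proof -
  obtain c where c: "c \<noteq> 0" "lincombs (val_ring e) (\<lambda>i. tvar powi b i *s f i) =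
      scale_set c (lincombs (val_ring e) (\<lambda>i. tvar powi a i *s f i))"
    using eq unfolding lattice_class_def by (rule homothety_class_eq)
  have eq: "lincombs (val_ring e) (\<lambda>i. tvar powi b i *s f i) =
      lincombs (val_ring e) (\<lambda>i. (c * tvar powi a i) *s f i)"
    unfolding c(2) scale_lincombs by (simp add: vector_smult_assoc)
  have "b i = a i + tsign e * val e c" for i
  proof -
    have "tvar powi b i / (c * tvar powi a i) \<in> val_ring e" "c * tvar powi a i / tvar powi b i \<in> val_ring e"
      using lincombs_scaled_monoD[OF subring_val_ring det, where s = "\<lambda>i. tvar powi b i" and u = "\<lambda>i. c * tvar powi a i"]
        lincombs_scaled_monoD[OF subring_val_ring det, where s = "\<lambda>i. c * tvar powi a i" and u = "\<lambda>i. tvar powi b i"] c(1) eq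
      by auto
    then have "val e (c * tvar powi a i) = val e (tvar powi b i :: 'k ratfun)"
      using c(1) by (simp add: val_ring_def divide_inverse val_mult val_inverse)
    then have "val e c + tsign e * a i = tsign e * b i" using c(1) by (simp add: val_mult val_tvar_powi)
    then have "tsign e * (tsign e * b i) = tsign e * val e c + tsign e * (tsign e * a i)"
      by (metis distrib_left)
    then show ?thesis unfolding tsign_sq by simp
  qed
  then show ?thesis using that by blast
qed

text \<open>The class of a lattice determines the exponents up to a common shift, so the opposition involution
is single valued.\<close>

lemma op_graph_image:
  fixes f :: "'n::finite \<Rightarrow> 'k::field ratfun ^ 'n"
  assumes det: "det (colmat f) \<noteq> 0"
  shows "op_graph e f `` ((\<lambda>j. lattice_class e (\<lambda>i. tvar powi a j i *s f i)) ` J)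
    = (\<lambda>j. lattice_class (opp e) (\<lambda>i. tvar powi a j i *s f i)) ` J"
proof (intro equalityI subsetI)
  fix w assume "w \<in> op_graph e f `` ((\<lambda>j. lattice_class e (\<lambda>i. tvar powi a j i *s f i)) ` J)"
  then obtain j b where j: "j \<in> J" "w = lattice_class (opp e) (\<lambda>i. tvar powi b i *s f i)"
    "lattice_class e (\<lambda>i. tvar powi b i *s f i) = lattice_class e (\<lambda>i. tvar powi a j i *s f i)"
    unfolding op_graph_def by auto
  obtain m where "\<And>i. b i = a j i + m" using lattice_class_eqD[OF det j(3)] by blast
  then have "w = lattice_class (opp e) (\<lambda>i. tvar powi a j i *s f i)" unfolding j(2) by (rule lattice_class_shift)
  then show "w \<in> (\<lambda>j. lattice_class (opp e) (\<lambda>i. tvar powi a j i *s f i)) ` J" using j(1) by blast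
next
  fix w assume "w \<in> (\<lambda>j. lattice_class (opp e) (\<lambda>i. tvar powi a j i *s f i)) ` J"
  then show "w \<in> op_graph e f `` ((\<lambda>j. lattice_class e (\<lambda>i. tvar powi a j i *s f i)) ` J)"
    unfolding op_graph_def by auto
qed

lemma opposite_twisted:
  fixes f :: "'n::finite \<Rightarrow> 'k::field ratfun ^ 'n"
  assumes "basis_over laurent f free_laurent"
  shows "opposite e ((\<lambda>j. lattice_class e (\<lambda>i. tvar powi a j i *s f i)) ` J)
    ((\<lambda>j. lattice_class (opp e) (\<lambda>i. tvar powi a j i *s f i)) ` J)"
proof -
  have det: "det (colmat f) \<noteq> 0" using assms unfolding basis_over_laurent by blast
  show ?thesis unfolding opposite_def
    using assms op_graph_image[OF det, of e a J] op_graph_image[OF det, of "opp e" a J]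
    by (intro exI[of _ f]) (auto simp: apartment_def)
qed

lemma basis_enumeration:
  fixes B :: "('a::field ^ 'n::finite) set"
  assumes B: "vec.independent B" "vec.span B = UNIV"
  obtains h :: "'n \<Rightarrow> 'a ^ 'n" where "bij_betw h UNIV B" "det (colmat h) \<noteq> 0"
proof -
  have fin: "finite B" by (rule vec.finiteI_independent[OF B(1)])
  have "card B = CARD('n)" using vec.basis_card_eq_dim[of B UNIV] B by (simp add: card_cart_basis)
  then obtain h :: "'n \<Rightarrow> 'a ^ 'n" where h: "bij_betw h UNIV B"
    using finite_same_card_bij[of "UNIV :: 'n set" B] fin by auto
  have "det (colmat h) \<noteq> 0" unfolding det_colmat_iff
  proof (intro allI impI)
    fix c i assume c: "(\<Sum>i\<in>UNIV. c i *s h i) = 0"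
    have inj: "inv_into UNIV h (h i) = i" for i using h by (simp add: bij_betw_def)
    have "(\<Sum>b\<in>B. c (inv_into UNIV h b) *s b) = (\<Sum>i\<in>UNIV. c (inv_into UNIV h (h i)) *s h i)"
      by (rule sum.reindex_bij_betw[OF h, symmetric])
    then have "(\<Sum>b\<in>B. c (inv_into UNIV h b) *s b) = 0" using c by (simp add: inj)
    moreover have "h i \<in> B" using h by (auto simp: bij_betw_def)
    ultimately have "c (inv_into UNIV h (h i)) = 0"
      using vec.independentD[OF B(1) fin order_refl, of "\<lambda>b. c (inv_into UNIV h b)"] by blast
    then show "c i = 0" by (simp add: inj)
  qed
  then show ?thesis using that h by blast
qed

lemma graded_lincombs:
  fixes B :: "('a::field ^ 'n::finite) set"
  assumes h: "bij_betw h (UNIV :: 'n set) B" and s: "\<And>l. s l \<noteq> 0"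
  shows "graded (\<lambda>l. {x. x / s l \<in> S}) B lev = lincombs S (\<lambda>i. s (lev (h i)) *s h i)"
proof (intro equalityI subsetI)
  fix x assume "x \<in> graded (\<lambda>l. {x. x / s l \<in> S}) B lev"
  then obtain c where c: "\<forall>b\<in>B. c b / s (lev b) \<in> S" "x = (\<Sum>b\<in>B. c b *s b)" unfolding graded_def by blast
  have "x = (\<Sum>i\<in>UNIV. c (h i) *s h i)" unfolding c(2) by (rule sum.reindex_bij_betw[OF h, symmetric])
  moreover have "c (h i) / s (lev (h i)) \<in> S" for i using c(1) h by (auto simp: bij_betw_def)
  ultimately show "x \<in> lincombs S (\<lambda>i. s (lev (h i)) *s h i)"
    unfolding lincombs_scaled_iff[of "\<lambda>i. s (lev (h i))", OF s]
    by (intro exI[of _ "\<lambda>i. c (h i)"]) simp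
next
  fix x assume "x \<in> lincombs S (\<lambda>i. s (lev (h i)) *s h i)"
  then obtain c where c: "x = (\<Sum>i\<in>UNIV. c i *s h i)" "\<forall>i. c i / s (lev (h i)) \<in> S"
    unfolding lincombs_scaled_iff[of "\<lambda>i. s (lev (h i))", OF s] by blast
  have inj: "inv_into UNIV h (h i) = i" for i using h by (simp add: bij_betw_def)
  have "(\<Sum>b\<in>B. c (inv_into UNIV h b) *s b) = (\<Sum>i\<in>UNIV. c (inv_into UNIV h (h i)) *s h i)"
    by (rule sum.reindex_bij_betw[OF h, symmetric])
  then have "x = (\<Sum>b\<in>B. c (inv_into UNIV h b) *s b)" unfolding c(1) by (simp add: inj)
  moreover have "c (inv_into UNIV h b) \<in> {x. x / s (lev b) \<in> S}" if "b \<in> B" for b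
  proof -
    obtain i where "b = h i" using h \<open>b \<in> B\<close> by (auto simp: bij_betw_def)
    then show ?thesis using c(2) by (simp add: inj)
  qed
  ultimately show "x \<in> graded (\<lambda>l. {x. x / s l \<in> S}) B lev" by (intro gradedI)
qed

lemma lattice_lincombs: "det (colmat f) \<noteq> 0 \<Longrightarrow> lattice_in e (lincombs (val_ring e) f)"
  unfolding lattice_in_def basis_over_val_ring by blast

definition jump_exp :: "pm \<Rightarrow> nat \<Rightarrow> nat \<Rightarrow> int" where
  "jump_exp e l j = (if l < j then tsign e else 0)"

lemma jump_tvar: "(jump e l j :: 'k::field ratfun) = tvar powi jump_exp e l j"
  using unif_powi[of e 1, where 'k='k] by (simp add: jump_def jump_exp_def)

lemma unif_not_opp: "(unif e :: 'k::field ratfun) \<notin> val_ring (opp e)"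
  using val_unif[of "opp e", where 'k='k] by (simp add: val_ring_def unif_opp val_inverse)

context stable_chain
begin

text \<open>Given an adapted basis of all of \<open>K\<^sup>n\<close>, let \<open>T e j\<close> be spanned by the vectors \<open>jump e (lev b) j *s b\<close>
over \<open>A\<^sub>e\<close>. Then \<open>L j = T e j\<close>, and \<open>T (opp e) j\<close> represents the opposite vertex. The uniformizer at
\<open>e\<close> has a pole at the other place, so the opposite chain increases with \<open>j\<close> and has to be reversed.\<close>

lemma opposite_fixed_simplex:
  assumes W0: "W0 = {0}" and det1: "\<And>g. g \<in> \<Gamma> \<Longrightarrow> det g = 1"
    and dec: "\<And>i. i < r \<Longrightarrow> L (Suc i) \<subset> L i" and per: "scale_set (unif e) (L 0) \<subset> L r"
  shows "\<exists>\<tau>\<in>fixed_complex \<Gamma> (opp e). opposite e ((\<lambda>i. homothety_class (L i)) ` {..r}) \<tau>"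
proof -
  obtain B lev where ad: "adapted B lev" and full: "Wspan B = UNIV" by (rule adapted_basis_exists)
  note fin = adaptedD(1)[OF ad]
  have "vec.span (W0 \<union> B) = UNIV" using full unfolding Wspan_def .
  then have "vec.span B = UNIV" by (simp add: W0)
  then obtain h :: "'n \<Rightarrow> 'k ratfun ^ 'n" where h: "bij_betw h UNIV B" and det: "det (colmat h) \<noteq> 0"
    using basis_enumeration[OF adapted_independent[OF ad]] by blast
  define Q where "Q e' j l = {x :: 'k ratfun. x / jump e l j \<in> val_ring e'}" for e' j l
  define T where "T e' j = graded (Q e' j) B lev" for e' j
  have T_eq: "T e' j = lincombs (val_ring e') (\<lambda>i. tvar powi jump_exp e (lev (h i)) j *s h i)" for e' j
    unfolding T_def Q_def graded_lincombs[of h B "\<lambda>l. jump e l j", OF h jump_neq_0] by (simp only: jump_tvar)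
  have Q_closed: "0 \<in> Q e' j l" "x \<in> Q e' j l \<Longrightarrow> y \<in> Q e' j l \<Longrightarrow> x + y \<in> Q e' j l"
    "c \<in> val_ring e' \<Longrightarrow> x \<in> Q e' j l \<Longrightarrow> c * x \<in> Q e' j l" for e' j l x y c
    using val_ring_mult[of c e' "x / jump e l j"]
    by (simp_all add: Q_def val_ring_closed(1) add_divide_distrib val_ring_add)
  have T_inv: "invariant_under \<Gamma> (T e' j)" for e' j
    unfolding T_def
    by (intro invariant_graded Q_closed(1,2) Q_closed(3)[OF consts_val_ring[THEN subsetD]] fin adaptedD(7)[OF ad])
  have T_lat: "lattice_in e' (T e' j)" for e' j
    unfolding T_eq by (intro lattice_lincombs det_colmat_scaled det) simp
  have expand: "\<exists>c. x = (\<Sum>b\<in>B. c b *s b)" for x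
    using full Wspan_iff[OF fin, of x] by (auto simp: W0)
  have L_eq: "L j = T e j" if j: "j \<le> r" for j
  proof (intro equalityI subsetI)
    fix x assume x: "x \<in> L j"
    obtain c where c: "x = (\<Sum>b\<in>B. c b *s b)" using expand by blast
    then have "x - (\<Sum>b\<in>B. c b *s b) \<in> W0" using W0 by simp
    then have "c b \<in> Q e j (lev b)" if "b \<in> B" for b
      using adaptedD(6)[OF ad j x _ that] unfolding Q_def by blast
    then show "x \<in> T e j" unfolding T_def using c by (intro gradedI)
  next
    fix x assume "x \<in> T e j"
    then obtain c where c: "\<forall>b\<in>B. c b \<in> Q e j (lev b)" "x = (\<Sum>b\<in>B. c b *s b)"
      unfolding T_def graded_def by blast
    have "c b *s b \<in> L j" if b: "b \<in> B" for b
    proof (rule jump_scale[OF _ adaptedD(3)[OF ad b] j])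
      show "b \<in> L (lev b)" using adaptedD(4)[OF ad b] unfolding W0 msum_def by auto
      show "c b / jump e (lev b) j \<in> val_ring e" using c(1) b unfolding Q_def by blast
    qed
    then show "x \<in> L j" unfolding c(2) by (rule submodule_over_sum[OF lattice_sub[OF j]])
  qed
  have T_coeff: "c / jump e (lev b) j \<in> val_ring e'" if x: "c *s b \<in> T e' j" and b: "b \<in> B" for c b e' j
  proof -
    obtain d where d: "\<forall>b\<in>B. d b \<in> Q e' j (lev b)" "c *s b = (\<Sum>b\<in>B. d b *s b)"
      using x unfolding T_def graded_def by blast
    have "c *s b = (\<Sum>b'\<in>B. (if b' = b then c else 0) *s b')"
      using b fin by (simp add: sum_single)
    then have "(\<Sum>b'\<in>B. ((if b' = b then c else 0) - d b') *s b') \<in> W0"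
      using d(2) W0 by (simp add: vec.scale_left_diff_distrib sum_subtractf)
    from adapted_indep[OF ad this b] have "c = d b" by simp
    then show ?thesis using d(1) b unfolding Q_def by blast
  qed
  have T_base: "c *s b \<in> T e' j" if "c / jump e (lev b) j \<in> val_ring e'" "b \<in> B" for c b e' j
    unfolding T_def using that by (intro graded_single fin Q_closed(1)) (simp_all add: Q_def)
  have T_mono: "T e' i \<subseteq> T e' j" if step: "\<And>l. jump e l i / jump e l j \<in> (val_ring e' :: 'k ratfun set)" for e' i j
  proof
    fix x assume "x \<in> T e' i"
    then obtain c where c: "\<forall>b\<in>B. c b \<in> Q e' i (lev b)" "x = (\<Sum>b\<in>B. c b *s b)"
      unfolding T_def graded_def by blast
    have "c b \<in> Q e' j (lev b)" if b: "b \<in> B" for b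
    proof -
      have "c b / jump e (lev b) i * (jump e (lev b) i / jump e (lev b) j) \<in> val_ring e'"
        using c(1) b unfolding Q_def by (intro val_ring_mult step) auto
      then show ?thesis unfolding Q_def by simp
    qed
    then show "x \<in> T e' j" unfolding T_def c(2) by (intro gradedI) auto
  qed
  define e' where "e' = opp e"
  \<comment> \<open>Both chains are strict at \<open>j\<close> for the same reason: there is a basis vector of level \<open>j\<close>.\<close>
  have T_up: "T e' j \<subset> T e' (Suc j)" if j: "j < r" for j
  proof -
    have "\<exists>b\<in>B. lev b = j"
    proof (rule ccontr)
      assume "\<not> (\<exists>b\<in>B. lev b = j)"
      then have "\<forall>b\<in>B. jump e (lev b) j = (jump e (lev b) (Suc j) :: 'k ratfun)"
        by (auto simp: jump_def less_Suc_eq)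
      then have "T e j = T e (Suc j)" unfolding T_def by (intro graded_cong) (simp add: Q_def)
      then show False using dec[OF j] L_eq[of j] L_eq[of "Suc j"] j by simp
    qed
    then obtain b where b: "b \<in> B" "lev b = j" by blast
    have "unif e *s b \<in> T e' (Suc j)" using b by (intro T_base) (auto simp: jump_def val_ring_closed(2))
    moreover have "unif e *s b \<notin> T e' j"
      using T_coeff[of "unif e" b e' j] b unif_not_opp[of e] by (auto simp: jump_def e'_def)
    moreover have "T e' j \<subseteq> T e' (Suc j)"
      by (rule T_mono) (auto simp: jump_def val_ring_closed(2) e'_def unif_opp[symmetric] inverse_eq_divide[symmetric] unif_in_val_ring)
    ultimately show ?thesis by blast
  qed
  have T_per: "scale_set (unif e') (T e' r) \<subset> T e' 0"
  proof -
    have "\<exists>b\<in>B. lev b = r"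
    proof (rule ccontr)
      assume no: "\<not> (\<exists>b\<in>B. lev b = r)"
      have "L r \<subseteq> scale_set (unif e) (L 0)"
      proof
        fix x assume "x \<in> L r"
        then obtain c where c: "\<forall>b\<in>B. c b \<in> Q e r (lev b)" "x = (\<Sum>b\<in>B. c b *s b)"
          unfolding L_eq[OF order_refl] T_def graded_def by blast
        have "c b / unif e \<in> Q e 0 (lev b)" if "b \<in> B" for b
        proof -
          have "lev b < r" using adaptedD(3)[OF ad that] no that by (meson le_neq_implies_less)
          moreover have "c b / jump e (lev b) r \<in> val_ring e" using c(1) that unfolding Q_def by blast
          ultimately show ?thesis by (simp add: Q_def jump_def)
        qed
        then have "(\<Sum>b\<in>B. (c b / unif e) *s b) \<in> L 0" unfolding L_eq[OF le0] T_def by (rule gradedI) auto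
        moreover have "x = unif e *s (\<Sum>b\<in>B. (c b / unif e) *s b)"
          unfolding c(2) by (simp add: vec.scale_sum_right vector_smult_assoc)
        ultimately show "x \<in> scale_set (unif e) (L 0)" unfolding scale_set_def by blast
      qed
      then show False using per by blast
    qed
    then obtain b where b: "b \<in> B" "lev b = r" by blast
    have "b \<in> T e' 0" using b T_base[of 1 b 0 e'] by (simp add: jump_def val_ring_closed(2))
    moreover have "b \<notin> scale_set (unif e') (T e' r)"
    proof
      assume "b \<in> scale_set (unif e') (T e' r)"
      then obtain x where x: "b = unif e' *s x" "x \<in> T e' r" unfolding scale_set_def by blast
      then have "x = unif e *s b" by (simp add: e'_def unif_opp vector_smult_assoc)
      then show False using T_coeff[of "unif e" b e' r] b x(2) unif_not_opp[of e] by (auto simp: jump_def e'_def)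
    qed
    moreover have "scale_set (unif e') (T e' r) \<subseteq> T e' 0"
    proof
      fix x assume "x \<in> scale_set (unif e') (T e' r)"
      then obtain c where c: "\<forall>b\<in>B. c b \<in> Q e' r (lev b)" "x = unif e' *s (\<Sum>b\<in>B. c b *s b)"
        unfolding scale_set_def T_def graded_def by blast
      have "x = (\<Sum>b\<in>B. (unif e' * c b) *s b)"
        unfolding c(2) by (simp add: vec.scale_sum_right vector_smult_assoc)
      moreover have "unif e' * c b \<in> Q e' 0 (lev b)" if "b \<in> B" for b
      proof -
        have "unif e' * c b = (if lev b < r then 1 else unif e') * (c b / jump e (lev b) r)"
          by (simp add: jump_def e'_def unif_opp field_simps)
        moreover have "\<dots> \<in> val_ring e'" using c(1) that
          by (intro val_ring_mult) (auto simp: Q_def unif_in_val_ring val_ring_closed(2))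
        ultimately show ?thesis by (simp add: Q_def jump_def)
      qed
      ultimately show "x \<in> T e' 0" unfolding T_def by (intro gradedI)
    qed
    ultimately show ?thesis by blast
  qed
  have fixed: "(\<lambda>i. homothety_class (T e' (r - i))) ` {..r} \<in> fixed_complex \<Gamma> e'"
  proof (rule fixed_complexI[OF det1])
    show "lattice_in e' (T e' (r - i))" for i by (rule T_lat)
    show "invariant_under \<Gamma> (T e' (r - i))" for i by (rule T_inv)
    show "T e' (r - Suc i) \<subset> T e' (r - i)" if "i < r" for i
      using T_up[of "r - Suc i"] that by (simp add: Suc_diff_Suc)
    show "scale_set (unif e') (T e' (r - 0)) \<subset> T e' (r - r)" using T_per by simp
  qed
  have img: "(\<lambda>i. r - i) ` {..r} = {..r}"
  proof (intro equalityI subsetI)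
    fix j assume "j \<in> {..r}"
    then show "j \<in> (\<lambda>i. r - i) ` {..r}" by (intro image_eqI[of _ _ "r - j"]) auto
  qed auto
  have "(\<lambda>i. homothety_class (T e' (r - i))) ` {..r} = (\<lambda>j. homothety_class (T e' j)) ` (\<lambda>i. r - i) ` {..r}"
    by (simp only: image_image)
  also have "\<dots> = (\<lambda>j. homothety_class (T e' j)) ` {..r}" unfolding img ..
  also have "\<dots> = (\<lambda>j. lattice_class (opp e) (\<lambda>i. tvar powi jump_exp e (lev (h i)) j *s h i)) ` {..r}"
    unfolding T_eq lattice_class_def e'_def ..
  finally have \<tau>: "(\<lambda>j. lattice_class (opp e) (\<lambda>i. tvar powi jump_exp e (lev (h i)) j *s h i)) ` {..r} \<in> fixed_complex \<Gamma> (opp e)"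
    using fixed unfolding e'_def by simp
  have \<sigma>: "(\<lambda>i. homothety_class (L i)) ` {..r} = (\<lambda>j. lattice_class e (\<lambda>i. tvar powi jump_exp e (lev (h i)) j *s h i)) ` {..r}"
    unfolding lattice_class_def T_eq[symmetric] using L_eq by (intro image_cong) auto
  have "basis_over laurent h free_laurent"
    unfolding basis_over_laurent
  proof (intro conjI det equalityI subsetI)
    fix x :: "'k ratfun ^ 'n" assume x: "x \<in> free_laurent"
    obtain c where c: "x = (\<Sum>b\<in>B. c b *s b)" using expand by blast
    then have "x - (\<Sum>b\<in>B. c b *s b) \<in> W0" using W0 by simp
    then have "c b \<in> laurent" if "b \<in> B" for b using adaptedD(5)[OF ad x _ that] by blast
    then have "x \<in> graded (\<lambda>l. {x. x / 1 \<in> laurent}) B lev" using c by (intro gradedI) auto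
    then show "x \<in> lincombs laurent h"
      using graded_lincombs[of h B "\<lambda>_. 1" laurent lev, OF h] by simp
  next
    fix x assume "x \<in> lincombs laurent h"
    moreover have "h i \<in> free_laurent" for i using h adaptedD(2)[OF ad] by (auto simp: bij_betw_def)
    ultimately show "x \<in> free_laurent" using lincombs_subset[OF submodule_free_laurent] by blast
  qed
  from opposite_twisted[OF this, of e "\<lambda>j i. jump_exp e (lev (h i)) j" "{..r}"]
  show ?thesis unfolding \<sigma> by (rule bexI[OF _ \<tau>])
qed

end

section \<open>Semisimplicity of completely reducible groups\<close>

lemma submodule_scale_set: "submodule_over S M \<Longrightarrow> submodule_over S (scale_set c M)"
  unfolding submodule_over_def scale_set_def
proof (intro conjI ballI)
  assume M: "0 \<in> M \<and> (\<forall>x\<in>M. \<forall>y\<in>M. x + y \<in> M) \<and> (\<forall>c\<in>S. \<forall>x\<in>M. c *s x \<in> M)"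
  show "0 \<in> (*s) c ` M" using M by (intro image_eqI[of _ _ 0]) auto
  fix x assume "x \<in> (*s) c ` M"
  then obtain x' where x: "x = c *s x'" "x' \<in> M" by blast
  show "x + y \<in> (*s) c ` M" if y: "y \<in> (*s) c ` M" for y
  proof -
    obtain y' where "y = c *s y'" "y' \<in> M" using y by blast
    then show ?thesis using M x by (intro image_eqI[of _ _ "x' + y'"]) (simp_all add: vector_add_ldistrib)
  qed
  show "d *s x \<in> (*s) c ` M" if "d \<in> S" for d
    using that M x by (intro image_eqI[of _ _ "d *s x'"]) (auto simp: vector_smult_assoc mult.commute)
qed

lemma invariant_scale_set: "invariant_under \<Gamma> M \<Longrightarrow> invariant_under \<Gamma> (scale_set c M)"
  unfolding invariant_under_def scale_set_def by (auto simp: vec.scale)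

lemma unif_scale_strict:
  fixes L :: "('k::field ratfun ^ 'n::finite) set"
  assumes "lattice_in e L"
  shows "scale_set (unif e) L \<subset> L"
proof -
  have "scale_set (unif e) L \<subseteq> L"
    using submodule_overD(3)[OF lattice_submodule[OF assms] unif_in_val_ring] unfolding scale_set_def by blast
  moreover have "scale_set (unif e) L \<noteq> L"
  proof
    assume eq: "scale_set (unif e) L = L"
    obtain d where d: "has_vol e L d" using has_vol_exists[OF assms] by blast
    have "has_vol e L (d + int CARD('n) * val e (unif e :: 'k ratfun))" using has_vol_scale[OF d unif_neq_0[of e]] unfolding eq .
    from has_vol_unique[OF d this] show False by (simp add: val_unif)
  qed
  ultimately show ?thesis by blast
qed

lemma fixed_lattice_exists:
  assumes "fixed_complex \<Gamma> e \<noteq> {}" "\<And>g. g \<in> \<Gamma> \<Longrightarrow> det g = 1"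
  obtains L where "lattice_in e L" "invariant_under \<Gamma> L"
proof -
  obtain \<sigma> where \<sigma>: "\<sigma> \<in> fixed_complex \<Gamma> e" using assms(1) by blast
  then have "\<sigma> \<in> simplices e" unfolding fixed_complex_def by blast
  then obtain L r where *: "\<sigma> = (\<lambda>i. homothety_class (L i)) ` {..r}" "\<And>i. i \<le> r \<Longrightarrow> lattice_in e (L i)"
      "\<And>i. i < r \<Longrightarrow> L (Suc i) \<subset> L i" "scale_set (unif e) (L 0) \<subset> L r"
    by (rule simplicesE) (rule that, assumption+)
  have "homothety_class (L 0) \<in> \<sigma>" unfolding *(1) by auto
  from fixed_simplex_lattice[OF \<sigma> assms(2) this in_homothety_class] have "invariant_under \<Gamma> (L 0)" by blast
  then show ?thesis using that *(2)[of 0] by blast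
qed

text \<open>The exponents are normalized so that \<open>L\<close> itself, and not only its homothety class, is spanned by the
scaled basis. The opposite simplex is fixed, so its lattices are stable.\<close>

lemma opposite_stable_basis:
  fixes \<Gamma> :: "('k::field ratfun ^ 'n::finite ^ 'n) set"
  assumes CR: "completely_reducible \<Gamma>" and det1: "\<And>g. g \<in> \<Gamma> \<Longrightarrow> det g = 1"
    and \<sigma>: "\<sigma> \<in> fixed_complex \<Gamma> e"
  obtains f :: "'n \<Rightarrow> 'k ratfun ^ 'n" where "basis_over laurent f free_laurent"
    "\<And>L. homothety_class L \<in> \<sigma> \<Longrightarrow> \<exists>a. L = lincombs (val_ring e) (\<lambda>i. unif e powi a i *s f i) \<and>
       invariant_under \<Gamma> (lincombs (val_ring (opp e)) (\<lambda>i. unif e powi a i *s f i))"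
proof -
  obtain \<tau> where \<tau>: "\<tau> \<in> fixed_complex \<Gamma> (opp e)" "opposite e \<sigma> \<tau>"
    using CR \<sigma> unfolding completely_reducible_def by blast
  obtain f where f: "basis_over laurent f free_laurent" "\<sigma> \<subseteq> apartment e f" "op_graph e f `` \<sigma> = \<tau>"
    using \<tau>(2) unfolding opposite_def by blast
  have "\<exists>a. L = lincombs (val_ring e) (\<lambda>i. unif e powi a i *s f i) \<and>
       invariant_under \<Gamma> (lincombs (val_ring (opp e)) (\<lambda>i. unif e powi a i *s f i))"
    if L: "homothety_class L \<in> \<sigma>" for L
  proof -
    obtain b where b: "homothety_class L = lattice_class e (\<lambda>i. tvar powi b i *s f i)"
      using f(2) L unfolding apartment_def by blast
    let ?f = "\<lambda>i. tvar powi b i *s f i"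
    have op: "lattice_class (opp e) ?f \<in> \<tau>"
      unfolding f(3)[symmetric] using L b unfolding op_graph_def by blast
    obtain c where c: "c \<noteq> 0" "L = scale_set c (lincombs (val_ring e) ?f)"
      using b unfolding lattice_class_def by (rule homothety_class_eq)
    define m where "m = val e c"
    define a where "a i = m + tsign e * b i" for i
    have a: "(unif e powi a i :: 'k ratfun) = unif e powi m * tvar powi b i" for i
      unfolding a_def tvar_powi[of "b i" e] by (simp add: power_int_add)
    have sc: "scale_set (unif e powi m) (lincombs S ?f) = lincombs S (\<lambda>i. unif e powi a i *s f i)" for S
      unfolding scale_lincombs by (simp add: a vector_smult_assoc)
    have sub: "submodule_over (val_ring e) (lincombs (val_ring e) ?f)"
      unfolding lincombs_colmat by (rule submodule_image[OF submodule_std[OF subring_val_ring]])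
    have "scale_set (c / unif e powi m) (lincombs (val_ring e) ?f) = lincombs (val_ring e) ?f"
      using c(1) by (intro scale_set_unit[OF sub]) (simp_all add: divide_inverse val_mult val_inverse val_unif_powi m_def)
    then have "scale_set (unif e powi m) (scale_set (c / unif e powi m) (lincombs (val_ring e) ?f))
        = scale_set (unif e powi m) (lincombs (val_ring e) ?f)" by simp
    then have "L = lincombs (val_ring e) (\<lambda>i. unif e powi a i *s f i)"
      unfolding sc c(2) scale_set_compose by simp
    moreover have "lincombs (val_ring (opp e)) (\<lambda>i. unif e powi a i *s f i) \<in> lattice_class (opp e) ?f"
      unfolding lattice_class_def homothety_class_def using sc[of "val_ring (opp e)", symmetric]
      by (intro CollectI exI[of _ "unif e powi m"]) simp
    then have "invariant_under \<Gamma> (lincombs (val_ring (opp e)) (\<lambda>i. unif e powi a i *s f i))"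
      using fixed_simplex_lattice[OF \<tau>(1) det1 op] by blast
    ultimately show ?thesis by blast
  qed
  then show ?thesis using that f(1) by blast
qed

lemma laurent_basis_scaled:
  fixes f :: "'n::finite \<Rightarrow> 'k::field ratfun ^ 'n"
  assumes "basis_over laurent f free_laurent"
  shows "basis_over laurent (\<lambda>i. unif e powi a i *s f i) free_laurent"
proof -
  have det: "det (colmat f) \<noteq> 0" and f: "free_laurent = lincombs laurent f"
    using assms unfolding basis_over_laurent by auto
  have inv: "inverse (unif e powi m) \<in> (laurent :: 'k ratfun set)" for m
    using unif_powi_in_laurent[of e "- m", where 'k='k] by (simp add: power_int_minus)
  have "lincombs laurent (\<lambda>i. unif e powi a i *s f i) = lincombs laurent (\<lambda>i. 1 *s f i)"
    using unif_powi_in_laurent inv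
    by (intro equalityI lincombs_scaled_mono[OF subring_laurent]) (auto simp: divide_inverse)
  then show ?thesis unfolding basis_over_laurent using f det_colmat_scaled[OF det, of "\<lambda>i. unif e powi a i"] by simp
qed

lemma cst_eq_unif_mult:
  assumes "cst c = unif e * y" "y \<in> val_ring e"
  shows "c = 0"
proof (rule ccontr)
  assume "c \<noteq> 0"
  then have nz: "cst c \<noteq> 0" by simp
  then have "y \<noteq> 0" using assms(1) by auto
  have "cst c * cst (inverse c) = 1" using \<open>c \<noteq> 0\<close> by (simp add: cst_mult[symmetric] cst_1 del: to_fract_mult)
  then have "inverse (cst c) = cst (inverse c)" by (rule inverse_unique)
  then have "0 \<le> val e (inverse (cst c))" using cst_in_val_ring[of "inverse c" e] by (simp add: val_ring_def)
  then have "val e (cst c) \<le> 0" by (simp add: val_inverse)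
  moreover have "val e (cst c) = 1 + val e y" unfolding assms(1) using \<open>y \<noteq> 0\<close> by (simp add: val_mult val_unif)
  ultimately show False using assms(2) by (simp add: val_ring_def)
qed

lemma submodule_lincombs: "subring_of S \<Longrightarrow> submodule_over S (lincombs S f)"
  unfolding lincombs_colmat by (rule submodule_image[OF submodule_std])

lemma lincombs_base: "subring_of S \<Longrightarrow> f i \<in> lincombs S f"
  using lincombs_single[of S 1 "\<lambda>_. 1" i f] by (simp add: subring_ofD)

text \<open>Reduction modulo \<open>\<pi> L\<close> is injective on the \<open>k\<close>-span of a basis of \<open>L\<close>.\<close>

lemma constants_meet_radical:
  fixes f :: "'n::finite \<Rightarrow> 'k::field ratfun ^ 'n"
  assumes det: "det (colmat f) \<noteq> 0" and v: "v \<in> lincombs consts_in f" "v = unif e *s l" "l \<in> lincombs (val_ring e) f"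
  shows "v = 0"
proof -
  obtain c where c: "v = (\<Sum>i\<in>UNIV. c i *s f i)" "\<forall>i. c i \<in> consts_in" using v(1) unfolding lincombs_iff by blast
  obtain d where d: "l = (\<Sum>i\<in>UNIV. d i *s f i)" "\<forall>i. d i \<in> val_ring e" using v(3) unfolding lincombs_iff by blast
  have eq: "(\<Sum>i\<in>UNIV. c i *s f i) = (\<Sum>i\<in>UNIV. (unif e * d i) *s f i)"
    using v(2) unfolding c(1) d(1) by (simp add: vec.scale_sum_right vector_smult_assoc)
  have "c i = 0" for i
  proof -
    obtain g where g: "c i = cst g" using c(2) by blast
    have "c i = unif e * d i" by (rule coeffs_unique[OF det eq])
    then have "g = 0" using cst_eq_unif_mult[of g e "d i"] d(2) g by simp
    then show ?thesis using g by simp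
  qed
  then show ?thesis unfolding c(1) by simp
qed

text \<open>Let \<open>V\<close> be the \<open>k\<close>-span of \<open>f0\<close> and \<open>L0\<close> its \<open>A\<^sub>e\<close>-span; reduction identifies \<open>V\<close> with \<open>L0 / \<pi> L0\<close>.
A nonzero proper stable subspace \<open>U\<close> gives the stable lattice \<open>L1 = U + \<pi> L0\<close> and a fixed edge. In a basis \<open>g\<close>
that exhibits an opposite fixed edge, \<open>L0\<close> is spanned by \<open>g\<close>, and \<open>L1\<close> and its opposite \<open>L1'\<close> by the
vectors \<open>\<pi>\<^sup>d g\<close> with exponents \<open>d\<close> in \<open>{0, 1}\<close>. The vectors of exponent \<open>0\<close> span the image of \<open>U\<close> in
the reduction. Those of exponent \<open>1\<close> span the space \<open>U2\<close> of all \<open>x\<close> in \<open>R\<^sup>n \<inter> L0\<close> with \<open>\<pi> x\<close> in \<open>L1'\<close>, a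
description that shows its stability; its image in the reduction complements that of \<open>U\<close>.\<close>

lemma constant_fibre_semisimple:
  fixes \<Gamma> :: "('k::field ratfun ^ 'n::finite ^ 'n) set" and f0 :: "'n \<Rightarrow> 'k ratfun ^ 'n"
  assumes CR: "completely_reducible \<Gamma>" and det1: "\<And>g. g \<in> \<Gamma> \<Longrightarrow> det g = 1"
    and R_inv: "invariant_under \<Gamma> free_laurent"
    and det: "det (colmat f0) \<noteq> 0"
    and L0_inv: "invariant_under \<Gamma> (lincombs (val_ring e) f0)"
    and V_inv: "invariant_under \<Gamma> (lincombs consts_in f0)"
    and U: "submodule_over consts_in U" "invariant_under \<Gamma> U" "U \<subseteq> lincombs consts_in f0"
  shows "\<exists>U'. stable_subspace \<Gamma> U' \<and> U' \<subseteq> lincombs consts_in f0 \<and>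
    U \<inter> U' \<subseteq> {0} \<and> lincombs consts_in f0 \<subseteq> msum U U'"
proof -
  define V where "V = lincombs consts_in f0"
  define L0 where "L0 = lincombs (val_ring e) f0"
  define \<pi>L0 where "\<pi>L0 = scale_set (unif e) L0"
  have V_sub: "submodule_over consts_in V" unfolding V_def by (rule submodule_lincombs[OF subring_consts])
  have L0_sub: "submodule_over (val_ring e) L0" unfolding L0_def by (rule submodule_lincombs[OF subring_val_ring])
  have \<pi>L0_sub: "submodule_over (val_ring e) \<pi>L0" unfolding \<pi>L0_def by (rule submodule_scale_set[OF L0_sub])
  note to_k = submodule_over_mono[OF _ consts_val_ring]
  have V_L0: "V \<subseteq> L0" unfolding V_def L0_def lincombs_def using consts_val_ring by blast
  have V_\<pi>L0: "v = 0" if "v \<in> V" "v \<in> \<pi>L0" for v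
    using that constants_meet_radical[OF det, of v e] unfolding V_def \<pi>L0_def L0_def scale_set_def by blast
  have L0_lat: "lattice_in e L0" unfolding L0_def by (rule lattice_lincombs[OF det])
  have zero: "submodule_over consts_in {0 :: 'k ratfun ^ 'n}" "invariant_under \<Gamma> {0}"
    by (auto simp: submodule_over_def invariant_under_def)
  show ?thesis
  proof (cases "U \<subseteq> {0} \<or> V \<subseteq> U")
    case True
    then show ?thesis
    proof
      assume U0: "U \<subseteq> {0}"
      have "V \<subseteq> msum U V" by (rule msum_upper(1)[OF U(1)])
      then show ?thesis using U0 V_sub V_inv unfolding V_def[symmetric] by (intro exI[of _ V]) auto
    next
      assume "V \<subseteq> U"
      moreover have "U \<subseteq> msum U {0}" by (rule msum_upper(2)[OF zero(1)])
      moreover have "{0} \<subseteq> V" using submodule_overD(1)[OF V_sub] by simp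
      ultimately show ?thesis using zero unfolding V_def[symmetric] by (intro exI[of _ "{0}"]) auto
    qed
  next
    case False
    \<comment> \<open>A basis of \<open>V\<close> that extends one of \<open>U\<close> shows that \<open>L1\<close> is a free module.\<close>
    obtain B1 where B1: "B1 \<subseteq> U" "kvec.independent B1" "U \<subseteq> kvec.span B1"
      by (rule kvec.maximal_independent_subset[of U])
    have "B1 \<subseteq> V" using B1(1) U(3) unfolding V_def by blast
    from kvec.maximal_independent_subset_extend[OF this B1(2)]
    obtain B where B: "B1 \<subseteq> B" "B \<subseteq> V" "kvec.independent B" "V \<subseteq> kvec.span B" by metis
    have "V \<subseteq> kvec.span (range f0)"
    proof (unfold V_def, rule lincombs_subset)
      show "submodule_over consts_in (kvec.span (range f0))" using kvec.subspace_span ksubspace_iff by blast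
      show "f0 i \<in> kvec.span (range f0)" for i by (rule kvec.span_base) simp
    qed
    then have bound: "finite B \<and> card B \<le> card (range f0)"
      using B(2) by (intro kvec.independent_span_bound[OF _ B(3)]) auto
    then have fin: "finite B" and "card B \<le> CARD('n)" using card_image_le[of UNIV f0] by auto
    have fin1: "finite B1" using fin B(1) by (rule rev_finite_subset)
    have V_eq: "V = combos consts_in B"
      unfolding combos_consts[OF fin] using B V_sub ksubspace_iff kvec.span_subspace by metis
    have U_eq: "U = combos consts_in B1"
      unfolding combos_consts[OF fin1] using B1 U(1) ksubspace_iff kvec.span_subspace by metis
    have f0_V: "f0 i \<in> V" for i unfolding V_def by (rule lincombs_base[OF subring_consts])
    have span: "vec.span B = UNIV"
    proof -
      have UR: "subring_of (UNIV :: 'k ratfun set)" by (simp add: subring_of_def)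
      have "f0 i \<in> vec.span B" for i
        using f0_V[of i] combos_mono[of consts_in UNIV B] unfolding V_eq combos_UNIV[OF fin] by blast
      then have "lincombs UNIV f0 \<subseteq> vec.span B"
        using subspace_submodule_over vec.subspace_span by (intro lincombs_subset[of UNIV]) blast+
      moreover have "x \<in> lincombs UNIV f0" for x
      proof -
        obtain G where "colmat f0 ** G = mat 1" using inverse_matrix[OF det] by blast
        then have "x = colmat f0 *v (G *v x)" by (simp add: matrix_vector_mul_assoc)
        then show ?thesis unfolding lincombs_colmat std_module_def by blast
      qed
      ultimately show ?thesis by blast
    qed
    have "vec.independent B"
      using span fin \<open>card B \<le> CARD('n)\<close>
      by (intro vec.card_le_dim_spanning[of B UNIV]) (auto simp: card_cart_basis)
    then obtain h :: "'n \<Rightarrow> 'k ratfun ^ 'n" where h: "bij_betw h UNIV B" and det_h: "det (colmat h) \<noteq> 0"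
      using basis_enumeration span by blast
    have L0_eq: "L0 = combos (val_ring e) B"
    proof
      show "L0 \<subseteq> combos (val_ring e) B" unfolding L0_def
        using f0_V combos_mono[OF consts_val_ring, of B] unfolding V_eq
        by (intro lincombs_subset submodule_combos subring_val_ring) blast
      show "combos (val_ring e) B \<subseteq> L0" using B(2) V_L0 by (intro combos_subset[OF L0_sub]) blast
    qed
    define lev :: "'k ratfun ^ 'n \<Rightarrow> nat" where "lev b = (if b \<in> B1 then 1 else 0)" for b
    define Q where "Q l = {x :: 'k ratfun. x / jump e l 1 \<in> val_ring e}" for l
    define L1 where "L1 = graded Q B lev"
    have "L1 = lincombs (val_ring e) (\<lambda>i. jump e (lev (h i)) 1 *s h i)"
      unfolding L1_def Q_def by (rule graded_lincombs[OF h jump_neq_0])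
    then have L1_lat: "lattice_in e L1" by (simp add: lattice_lincombs det_colmat_scaled det_h)
    have Q_closed: "0 \<in> Q l" "x \<in> Q l \<Longrightarrow> y \<in> Q l \<Longrightarrow> x + y \<in> Q l" for l x y
      by (simp_all add: Q_def val_ring_closed(1) add_divide_distrib val_ring_add)
    note L1_sub = lattice_submodule[OF L1_lat]
    have L1_eq: "L1 = msum U \<pi>L0"
    proof
      have P_sub: "submodule_over consts_in (msum U \<pi>L0)" by (rule submodule_msum[OF U(1) to_k[OF \<pi>L0_sub]])
      have b_\<pi>: "(unif e * y) *s b \<in> \<pi>L0" if "y \<in> val_ring e" "b \<in> B" for y b
      proof -
        have "y *s b \<in> L0" using that B(2) V_L0 by (intro submodule_overD(3)[OF L0_sub]) auto
        moreover have "(unif e * y) *s b = unif e *s (y *s b)" by (simp add: vector_smult_assoc)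
        ultimately show ?thesis unfolding \<pi>L0_def scale_set_def by blast
      qed
      show "L1 \<subseteq> msum U \<pi>L0"
      proof
        fix x assume "x \<in> L1"
        then obtain c where c: "\<forall>b\<in>B. c b \<in> Q (lev b)" "x = (\<Sum>b\<in>B. c b *s b)"
          unfolding L1_def graded_def by blast
        have "c b *s b \<in> msum U \<pi>L0" if b: "b \<in> B" for b
        proof (cases "b \<in> B1")
          case True
          then have "c b \<in> val_ring e" using c(1) b by (auto simp: Q_def lev_def jump_def)
          then obtain g y where gy: "y \<in> val_ring e" "c b = cst g + unif e * y" by (rule residue)
          have "cst g *s b \<in> U" using True B1(1) by (intro submodule_overD(3)[OF U(1)]) auto
          moreover have "c b *s b = cst g *s b + (unif e * y) *s b" unfolding gy(2) by (rule vec.scale_left_distrib)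
          ultimately show ?thesis using b_\<pi>[OF gy(1) b] unfolding msum_def by blast
        next
          case False
          then have "c b / unif e \<in> val_ring e" using c(1) b by (auto simp: Q_def lev_def jump_def)
          from b_\<pi>[OF this b] have "c b *s b \<in> \<pi>L0" by simp
          then show ?thesis using msum_upper(1)[OF U(1)] by blast
        qed
        then show "x \<in> msum U \<pi>L0" unfolding c(2) by (rule submodule_over_sum[OF P_sub])
      qed
      have base: "c *s b \<in> L1" if "c \<in> Q (lev b)" "b \<in> B" for c b
        unfolding L1_def using that by (intro graded_single fin Q_closed(1))
      have "b \<in> L1" if b: "b \<in> B1" for b
      proof -
        have "1 \<in> Q (lev b)" using b by (simp add: Q_def lev_def jump_def val_ring_closed(2))
        from base[OF this] show ?thesis using b B(1) by auto
      qed
      then have "U \<subseteq> L1" unfolding U_eq by (intro combos_subset[OF to_k[OF L1_sub]]) blast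
      moreover have "\<pi>L0 \<subseteq> L1"
      proof
        fix x assume "x \<in> \<pi>L0"
        then obtain c where c: "\<forall>b\<in>B. c b \<in> val_ring e" "x = unif e *s (\<Sum>b\<in>B. c b *s b)"
          unfolding \<pi>L0_def L0_eq scale_set_def combos_def by blast
        have "x = (\<Sum>b\<in>B. (unif e * c b) *s b)" unfolding c(2) by (simp add: vec.scale_sum_right vector_smult_assoc)
        moreover have "unif e * c b \<in> Q (lev b)" if "b \<in> B" for b
          using c(1) that by (auto simp: Q_def jump_def intro!: val_ring_mult unif_in_val_ring)
        ultimately show "x \<in> L1" unfolding L1_def by (intro gradedI)
      qed
      ultimately show "msum U \<pi>L0 \<subseteq> L1" unfolding msum_def using submodule_overD(2)[OF L1_sub] by blast
    qed
    have L1_inv: "invariant_under \<Gamma> L1"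
      unfolding L1_eq \<pi>L0_def L0_def by (intro invariant_msum U(2) invariant_scale_set L0_inv)
    have \<pi>L0_L0: "\<pi>L0 \<subset> L0" unfolding \<pi>L0_def by (rule unif_scale_strict[OF L0_lat])
    have \<pi>L0_L1: "\<pi>L0 \<subseteq> L1" unfolding L1_eq by (rule msum_upper(1)[OF U(1)])
    have U_L1: "U \<subseteq> L1" unfolding L1_eq by (rule msum_upper(2)[OF \<pi>L0_sub])
    have U_V: "U \<subseteq> V" using U(3) unfolding V_def .
    have L1_L0: "L1 \<subseteq> L0"
      unfolding L1_eq msum_def using U_V V_L0 \<pi>L0_L0 submodule_overD(2)[OF L0_sub] by blast
    have strict1: "\<pi>L0 \<noteq> L1"
    proof
      assume "\<pi>L0 = L1"
      then have "U \<subseteq> {0}" using U_L1 U_V V_\<pi>L0 by blast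
      then show False using False by blast
    qed
    have strict2: "L1 \<noteq> L0"
    proof
      assume eq: "L1 = L0"
      have "V \<subseteq> U"
      proof
        fix v assume v: "v \<in> V"
        then have "v \<in> msum U \<pi>L0" using V_L0 eq L1_eq by blast
        then obtain u l where ul: "v = u + l" "u \<in> U" "l \<in> \<pi>L0" unfolding msum_def by blast
        have "v - u \<in> V" using submodule_over_diff[OF V_sub subring_consts v] U_V ul(2) by blast
        then have "v - u = 0" using V_\<pi>L0 ul by simp
        then show "v \<in> U" using ul by simp
      qed
      then show False using False by blast
    qed
    define chain where "chain i = (if i = 0 then L0 else L1)" for i :: nat
    have fixed: "(\<lambda>i. homothety_class (chain i)) ` {..1} \<in> fixed_complex \<Gamma> e"
      using L0_lat L1_lat L0_inv L1_inv \<pi>L0_L1 strict1 L1_L0 strict2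
      by (intro fixed_complexI[OF det1]) (auto simp: chain_def L0_def[symmetric] \<pi>L0_def[symmetric])
    obtain f :: "'n \<Rightarrow> 'k ratfun ^ 'n" where f: "basis_over laurent f free_laurent"
      and f_lat: "\<And>L. homothety_class L \<in> (\<lambda>i. homothety_class (chain i)) ` {..1} \<Longrightarrow>
        \<exists>a. L = lincombs (val_ring e) (\<lambda>i. unif e powi a i *s f i) \<and>
         invariant_under \<Gamma> (lincombs (val_ring (opp e)) (\<lambda>i. unif e powi a i *s f i))"
      using opposite_stable_basis[OF CR det1 fixed] by blast
    have "homothety_class L0 \<in> (\<lambda>i. homothety_class (chain i)) ` {..1}"
      by (rule image_eqI[of _ _ 0]) (simp_all add: chain_def)
    from f_lat[OF this] obtain a where a: "L0 = lincombs (val_ring e) (\<lambda>i. unif e powi a i *s f i)" by blast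
    have "homothety_class L1 \<in> (\<lambda>i. homothety_class (chain i)) ` {..1}"
      by (rule image_eqI[of _ _ 1]) (simp_all add: chain_def)
    from f_lat[OF this] obtain b where b: "L1 = lincombs (val_ring e) (\<lambda>i. unif e powi b i *s f i)"
      "invariant_under \<Gamma> (lincombs (val_ring (opp e)) (\<lambda>i. unif e powi b i *s f i))" by blast
    define g where "g i = unif e powi a i *s f i" for i
    define d where "d i = b i - a i" for i
    have g_basis: "basis_over laurent g free_laurent" unfolding g_def by (rule laurent_basis_scaled[OF f])
    then have det_g: "det (colmat g) \<noteq> 0" and R_g: "free_laurent = lincombs laurent g"
      unfolding basis_over_laurent by auto
    have bf: "(\<lambda>i. unif e powi b i *s f i) = (\<lambda>i. unif e powi d i *s g i)"
      unfolding g_def d_def by (simp add: vector_smult_assoc power_int_diff)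
    have L0_g: "L0 = lincombs (val_ring e) g" unfolding a g_def ..
    have L1_g: "L1 = lincombs (val_ring e) (\<lambda>i. unif e powi d i *s g i)" unfolding b(1) bf ..
    define L1' where "L1' = lincombs (val_ring (opp e)) (\<lambda>i. unif e powi d i *s g i)"
    have L1'_inv: "invariant_under \<Gamma> L1'" unfolding L1'_def bf[symmetric] by (rule b(2))
    have L1'_sub: "submodule_over (val_ring (opp e)) L1'"
      unfolding L1'_def by (rule submodule_lincombs[OF subring_val_ring])
    have d01: "d i = 0 \<or> d i = 1" for i
    proof -
      have "unif e powi d i / 1 \<in> (val_ring e :: 'k ratfun set)"
        using L1_L0 by (intro lincombs_scaled_monoD[OF subring_val_ring det_g,
            where s = "\<lambda>i. unif e powi d i" and u = "\<lambda>_. 1"]) (simp_all add: L0_g L1_g)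
      then have 1: "0 \<le> d i" by (simp add: val_ring_def val_unif_powi)
      have "unif e / unif e powi d i \<in> (val_ring e :: 'k ratfun set)"
        using \<pi>L0_L1 by (intro lincombs_scaled_monoD[OF subring_val_ring det_g,
            where s = "\<lambda>i. unif e" and u = "\<lambda>i. unif e powi d i"])
          (simp_all add: L0_g L1_g \<pi>L0_def scale_lincombs)
      then have "d i \<le> 1" by (simp add: val_ring_def divide_inverse val_mult val_inverse val_unif_powi val_unif)
      then show ?thesis using 1 by linarith
    qed
    define U2 where "U2 = (free_laurent \<inter> L0) \<inter> {x. unif e *s x \<in> L1'}"
    have U2_sub: "submodule_over consts_in U2" unfolding U2_def
      by (intro submodule_over_Int submodule_over_mono[OF submodule_free_laurent consts_laurent] to_k[OF L0_sub]
          submodule_scaled to_k[OF L1'_sub])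
    have U2_inv: "invariant_under \<Gamma> U2" unfolding U2_def
      by (intro invariant_Int R_inv invariant_scaled L1'_inv) (simp add: L0_def L0_inv)
    define U' where "U' = V \<inter> msum U2 \<pi>L0"
    have "submodule_over consts_in U'" unfolding U'_def
      by (intro submodule_over_Int V_sub submodule_msum U2_sub to_k[OF \<pi>L0_sub])
    moreover have "invariant_under \<Gamma> U'" unfolding U'_def \<pi>L0_def L0_def
      by (intro invariant_Int invariant_msum U2_inv invariant_scale_set L0_inv) (simp add: V_def V_inv)
    moreover have "U' \<subseteq> V" unfolding U'_def by blast
    moreover have "U \<inter> U' \<subseteq> {0}"
    proof
      fix v assume v: "v \<in> U \<inter> U'"
      then obtain x l where xl: "v = x + l" "x \<in> U2" "l \<in> \<pi>L0" unfolding U'_def msum_def by blast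
      have "x = v - l" using xl(1) by simp
      moreover have "v - l \<in> L1" using v U_L1 \<pi>L0_L1 xl(3) by (intro submodule_over_diff[OF L1_sub subring_val_ring]) auto
      ultimately have xL1: "x \<in> L1" by simp
      obtain c where c: "x = (\<Sum>i\<in>UNIV. c i *s g i)" "\<forall>i. c i \<in> laurent"
      proof -
        have "x \<in> lincombs laurent g" using xl(2) unfolding U2_def R_g by blast
        then show ?thesis using that unfolding lincombs_iff by blast
      qed
      obtain c' where c': "x = (\<Sum>i\<in>UNIV. c' i *s g i)" "\<forall>i. c' i / unif e powi d i \<in> val_ring e"
        using xL1 lincombs_scaled_iff[of "\<lambda>i. unif e powi d i" x "val_ring e" g] unfolding L1_g by auto
      obtain c'' where c'': "unif e *s x = (\<Sum>i\<in>UNIV. c'' i *s g i)" "\<forall>i. c'' i / unif e powi d i \<in> val_ring (opp e)"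
        using xl(2) lincombs_scaled_iff[of "\<lambda>i. unif e powi d i" "unif e *s x" "val_ring (opp e)" g]
        unfolding U2_def L1'_def by auto
      have "c i = 0" for i
      proof -
        have 1: "c i = c' i" using c(1) c'(1) by (intro coeffs_unique[OF det_g]) simp
        have "(\<Sum>i\<in>UNIV. (unif e * c i) *s g i) = (\<Sum>i\<in>UNIV. c'' i *s g i)"
          unfolding c''(1)[symmetric] c(1) by (simp add: vec.scale_sum_right vector_smult_assoc)
        then have 2: "unif e * c i = c'' i" by (rule coeffs_unique[OF det_g])
        have "inverse (unif e powi d i) \<in> (laurent :: 'k ratfun set)"
          using unif_powi_in_laurent[of e "- d i", where 'k='k] by (simp add: power_int_minus)
        then have "c i / unif e powi d i \<in> laurent" using c(2) by (simp add: divide_inverse laurent_closed(4))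
        moreover have "c i / unif e powi d i \<in> val_ring e" using c'(2) 1 by simp
        moreover have "unif e * (c i / unif e powi d i) \<in> val_ring (opp e)" using c''(2)[rule_format, of i] 2 by simp
        ultimately have "c i / unif e powi d i = 0" by (rule laurent_disjoint)
        then show ?thesis by simp
      qed
      then have "x = 0" unfolding c(1) by simp
      then show "v \<in> {0}" using V_\<pi>L0[of v] v xl U_V by auto
    qed
    moreover have "V \<subseteq> msum U U'"
    proof
      fix v assume v: "v \<in> V"
      then have "v \<in> lincombs (val_ring e) g" using V_L0 unfolding L0_g by blast
      then obtain c where c: "v = (\<Sum>i\<in>UNIV. c i *s g i)" "\<forall>i. c i \<in> val_ring e"
        unfolding lincombs_iff by blast
      have "\<exists>\<gamma> y. y \<in> val_ring e \<and> c i = cst \<gamma> + unif e * y" for i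
        by (rule residue[OF c(2)[rule_format, of i]]) blast
      then obtain \<gamma> y where gy: "\<And>i. y i \<in> val_ring e" "\<And>i. c i = cst (\<gamma> i) + unif e * y i" by metis
      \<comment> \<open>The residues of the coefficients of \<open>v\<close>, split according to the exponents.\<close>
      define s where "s i = (if d i = 1 then cst (\<gamma> i) else 0)" for i
      define s' where "s' i = (if d i = 1 then 0 else cst (\<gamma> i))" for i
      define x where "x = (\<Sum>i\<in>UNIV. s i *s g i)"
      define z where "z = (\<Sum>i\<in>UNIV. s' i *s g i)"
      define l where "l = (\<Sum>i\<in>UNIV. y i *s g i)"
      have "cst (\<gamma> i) = s i + s' i" for i by (simp add: s_def s'_def)
      then have v_eq: "v = x + z + unif e *s l"
        unfolding c(1) x_def z_def l_def
        by (simp add: gy(2) vec.scale_left_distrib sum.distrib vec.scale_sum_right vector_smult_assoc)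
      have "l \<in> L0" unfolding L0_g lincombs_iff l_def using gy(1) by blast
      then have l: "unif e *s l \<in> \<pi>L0" unfolding \<pi>L0_def scale_set_def by blast
      have "x \<in> U2"
      proof -
        have "s i \<in> laurent" "s i \<in> val_ring e" for i
          by (simp_all add: s_def cst_in_laurent cst_in_val_ring laurent_closed(1) val_ring_closed(1))
        then have "x \<in> free_laurent" "x \<in> L0" unfolding R_g L0_g lincombs_iff x_def by blast+
        moreover have "unif e *s x = (\<Sum>i\<in>UNIV. (unif e * s i) *s g i)"
          unfolding x_def by (simp add: vec.scale_sum_right vector_smult_assoc)
        moreover have "unif e * s i / unif e powi d i \<in> val_ring (opp e)" for i
          by (simp add: s_def cst_in_val_ring val_ring_closed(1))
        ultimately show ?thesis unfolding U2_def L1'_def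
          using lincombs_scaled_iff[of "\<lambda>i. unif e powi d i" "unif e *s x" "val_ring (opp e)" g] by auto
      qed
      have "z \<in> L1"
      proof -
        have "s' i / unif e powi d i \<in> val_ring e" for i
          using d01[of i] by (auto simp: s'_def cst_in_val_ring val_ring_closed(1))
        then show ?thesis unfolding L1_g z_def
          using lincombs_scaled_iff[of "\<lambda>i. unif e powi d i" z "val_ring e" g] unfolding z_def by auto
      qed
      then obtain u l2 where ul: "z = u + l2" "u \<in> U" "l2 \<in> \<pi>L0" unfolding L1_eq msum_def by blast
      have "v - u = x + (l2 + unif e *s l)" unfolding v_eq ul(1) by simp
      moreover have "l2 + unif e *s l \<in> \<pi>L0" by (rule submodule_overD(2)[OF \<pi>L0_sub ul(3) l])
      ultimately have "v - u \<in> msum U2 \<pi>L0" unfolding msum_def using \<open>x \<in> U2\<close> by blast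
      moreover have "v - u \<in> V" using submodule_over_diff[OF V_sub subring_consts v] U_V ul(2) by blast
      ultimately have "v - u \<in> U'" unfolding U'_def by blast
      moreover have "v = u + (v - u)" by simp
      ultimately show "v \<in> msum U U'" unfolding msum_def using ul(2) by blast
    qed
    ultimately show ?thesis unfolding V_def[symmetric] by blast
  qed
qed

text \<open>\<open>R\<^sup>n\<close> is the sum of its subspaces \<open>t\<^sup>m V\<close>, on each of which stable subspaces have stable complements by
hypothesis. If \<open>C\<close> is a maximal stable subspace that meets \<open>Z\<close> trivially, then \<open>Z + C\<close> contains every
\<open>t\<^sup>m V\<close>, since otherwise a complement of the intersection could be added to \<open>C\<close>.\<close>

lemma laurent_module_semisimple:
  fixes \<Gamma> :: "('k::field ratfun ^ 'n::finite ^ 'n) set" and f0 :: "'n \<Rightarrow> 'k ratfun ^ 'n"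
  assumes basis: "basis_over laurent f0 free_laurent"
    and ss: "\<And>U. submodule_over consts_in U \<Longrightarrow> invariant_under \<Gamma> U \<Longrightarrow> U \<subseteq> lincombs consts_in f0 \<Longrightarrow>
      \<exists>U'. stable_subspace \<Gamma> U' \<and> U' \<subseteq> lincombs consts_in f0 \<and>
        U \<inter> U' \<subseteq> {0} \<and> lincombs consts_in f0 \<subseteq> msum U U'"
    and V_inv: "invariant_under \<Gamma> (lincombs consts_in f0)"
    and Z: "submodule_over consts_in Z" "invariant_under \<Gamma> Z"
  obtains C where "submodule_over consts_in C" "invariant_under \<Gamma> C" "C \<subseteq> free_laurent"
    "Z \<inter> C \<subseteq> {0}" "free_laurent \<subseteq> msum Z C"
proof -
  define V where "V = lincombs consts_in f0"
  define \<C> where "\<C> = {C. submodule_over consts_in C \<and> invariant_under \<Gamma> C \<and> C \<subseteq> free_laurent \<and> Z \<inter> C \<subseteq> {0}}"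
  have R_f: "free_laurent = lincombs laurent f0" using basis unfolding basis_over_laurent by blast
  have V_sub: "submodule_over consts_in V" unfolding V_def by (rule submodule_lincombs[OF subring_consts])
  have "{0} \<in> \<C>" unfolding \<C>_def
    using submodule_overD(1)[OF submodule_free_laurent] by (auto simp: submodule_over_def invariant_under_def)
  then have "\<C> \<noteq> {}" by blast
  moreover have "\<Union>\<D> \<in> \<C>" if "\<D> \<noteq> {}" and chain: "subset.chain \<C> \<D>" for \<D>
  proof -
    have D: "submodule_over consts_in C \<and> invariant_under \<Gamma> C \<and> C \<subseteq> free_laurent \<and> Z \<inter> C \<subseteq> {0}" if "C \<in> \<D>" for C
      using chain that unfolding subset.chain_def \<C>_def by blast
    have "submodule_over consts_in (\<Union>\<D>)" unfolding submodule_over_def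
    proof (intro conjI ballI)
      show "0 \<in> \<Union>\<D>" using \<open>\<D> \<noteq> {}\<close> D submodule_overD(1) by blast
    next
      fix x y assume "x \<in> \<Union>\<D>" "y \<in> \<Union>\<D>"
      then obtain C C' where C: "x \<in> C" "C \<in> \<D>" "y \<in> C'" "C' \<in> \<D>" by blast
      then have "C \<subseteq> C' \<or> C' \<subseteq> C" using chain unfolding subset.chain_def by blast
      then show "x + y \<in> \<Union>\<D>"
      proof
        assume "C \<subseteq> C'"
        then have "x + y \<in> C'" using C D[of C'] submodule_overD(2)[of consts_in C' x y] by blast
        then show ?thesis using C(4) by blast
      next
        assume "C' \<subseteq> C"
        then have "x + y \<in> C" using C D[of C] submodule_overD(2)[of consts_in C x y] by blast
        then show ?thesis using C(2) by blast
      qed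
    next
      fix c :: "'k ratfun" and x assume c: "c \<in> consts_in" and "x \<in> \<Union>\<D>"
      then obtain C where C: "x \<in> C" "C \<in> \<D>" by blast
      then have "c *s x \<in> C" using D[of C] submodule_overD(3)[of consts_in C c x] c by blast
      then show "c *s x \<in> \<Union>\<D>" using C(2) by blast
    qed
    moreover have "invariant_under \<Gamma> (\<Union>\<D>)" using D unfolding invariant_under_def by blast
    ultimately show ?thesis unfolding \<C>_def using D by blast
  qed
  ultimately obtain C where C: "C \<in> \<C>" and max: "\<And>X. X \<in> \<C> \<Longrightarrow> C \<subseteq> X \<Longrightarrow> X = C"
    using subset_Zorn_nonempty[of \<C>] by metis
  have C': "submodule_over consts_in C" "invariant_under \<Gamma> C" "C \<subseteq> free_laurent" "Z \<inter> C \<subseteq> {0}"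
    using C unfolding \<C>_def by auto
  define P where "P = msum Z C"
  have P_sub: "submodule_over consts_in P" unfolding P_def by (rule submodule_msum[OF Z(1) C'(1)])
  have P_inv: "invariant_under \<Gamma> P" unfolding P_def by (rule invariant_msum[OF Z(2) C'(2)])
  have shift: "tvar powi m *s v \<in> P" if v: "v \<in> V" for m v
  proof -
    let ?t = "tvar powi m :: 'k ratfun"
    define U where "U = V \<inter> {x. ?t *s x \<in> P}"
    have U_sub: "submodule_over consts_in U" unfolding U_def
      by (intro submodule_over_Int V_sub submodule_scaled P_sub)
    have U_inv: "invariant_under \<Gamma> U" unfolding U_def
      by (intro invariant_Int invariant_scaled P_inv) (simp add: V_def V_inv)
    have "U \<subseteq> lincombs consts_in f0" unfolding U_def V_def by blast
    from ss[OF U_sub U_inv this] obtain U' where U': "submodule_over consts_in U'" "invariant_under \<Gamma> U'" "U' \<subseteq> V"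
      "U \<inter> U' \<subseteq> {0}" "V \<subseteq> msum U U'" unfolding V_def[symmetric] by blast
    define D where "D = scale_set ?t U'"
    have D_sub: "submodule_over consts_in D" unfolding D_def by (rule submodule_scale_set[OF U'(1)])
    have D_inv: "invariant_under \<Gamma> D" unfolding D_def by (rule invariant_scale_set[OF U'(2)])
    have "V \<subseteq> free_laurent" unfolding V_def R_f lincombs_def using consts_laurent by blast
    then have D_R: "D \<subseteq> free_laurent" unfolding D_def scale_set_def
      using U'(3) submodule_overD(3)[OF submodule_free_laurent tvar_powi_in_laurent] by blast
    have meet: "u = 0" if u: "u \<in> U'" "?t *s u \<in> P" for u
      using u U'(3,4) unfolding U_def by blast
    have "Z \<inter> msum C D \<subseteq> {0}"
    proof
      fix z assume "z \<in> Z \<inter> msum C D"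
      then obtain c u where z: "z \<in> Z" "z = c + ?t *s u" "c \<in> C" "u \<in> U'"
        unfolding msum_def D_def scale_set_def by blast
      have "?t *s u = z + - c" using z(2) by simp
      moreover have "- c \<in> C" by (rule submodule_over_minus[OF C'(1) subring_consts z(3)])
      ultimately have "?t *s u \<in> P" unfolding P_def msum_def using z(1) by blast
      then have "u = 0" by (rule meet[OF z(4)])
      then have "z \<in> Z \<inter> C" using z by simp
      then show "z \<in> {0}" using C'(4) by blast
    qed
    moreover have "msum C D \<subseteq> free_laurent"
      unfolding msum_def using C'(3) D_R submodule_overD(2)[OF submodule_free_laurent] by blast
    ultimately have "msum C D \<in> \<C>" unfolding \<C>_def
      using submodule_msum[OF C'(1) D_sub] invariant_msum[OF C'(2) D_inv] by blast
    then have "msum C D = C" by (rule max) (rule msum_upper(2)[OF D_sub])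
    then have DC: "D \<subseteq> C" using msum_upper(1)[OF C'(1), of D] by simp
    obtain u u' where uu: "v = u + u'" "u \<in> U" "u' \<in> U'" using v U'(5) unfolding msum_def by blast
    have "?t *s u' \<in> C" using DC uu(3) unfolding D_def scale_set_def by blast
    then have "?t *s u' \<in> P" using msum_upper(1)[OF Z(1), of C] unfolding P_def by blast
    then have "u' = 0" by (rule meet[OF uu(3)])
    then show ?thesis using uu(1,2) unfolding U_def by simp
  qed
  have coeff: "s *s v \<in> P" if "s \<in> laurent" "v \<in> V" for s v
    using that(1)
  proof (rule laurent_induct)
    show "(x + y) *s v \<in> P" if "x *s v \<in> P" "y *s v \<in> P" for x y
      unfolding vec.scale_left_distrib by (rule submodule_overD(2)[OF P_sub that])
    show "(cst c * tvar powi m) *s v \<in> P" for c m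
      using submodule_overD(3)[OF P_sub _ shift[OF that(2), of m], of "cst c"] by (simp add: vector_smult_assoc)
  qed
  have f0_V: "f0 i \<in> V" for i unfolding V_def by (rule lincombs_base[OF subring_consts])
  have "free_laurent \<subseteq> msum Z C"
  proof
    fix x :: "'k ratfun ^ 'n" assume "x \<in> free_laurent"
    then obtain c where c: "\<forall>i. c i \<in> laurent" "x = (\<Sum>i\<in>UNIV. c i *s f0 i)" unfolding R_f lincombs_iff by blast
    have "x \<in> P" unfolding c(2) by (intro submodule_over_sum[OF P_sub] coeff c(1)[rule_format] f0_V)
    then show "x \<in> msum Z C" unfolding P_def .
  qed
  then show ?thesis using that C' by blast
qed

text \<open>The global sections of a trivial bundle are constant. This describes the \<open>k\<close>-span of the basis by
lattices, so it is stable whenever they are.\<close>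

lemma constant_lincombs:
  fixes f :: "'n::finite \<Rightarrow> 'k::field ratfun ^ 'n"
  assumes "basis_over laurent f free_laurent"
  shows "free_laurent \<inter> lincombs (val_ring e) f \<inter> lincombs (val_ring (opp e)) f = lincombs consts_in f"
proof (intro equalityI subsetI)
  have det: "det (colmat f) \<noteq> 0" and R: "free_laurent = lincombs laurent f"
    using assms unfolding basis_over_laurent by auto
  fix x assume x: "x \<in> free_laurent \<inter> lincombs (val_ring e) f \<inter> lincombs (val_ring (opp e)) f"
  then have "x \<in> lincombs laurent f" "x \<in> lincombs (val_ring e) f" "x \<in> lincombs (val_ring (opp e)) f"
    unfolding R by blast+
  then obtain c c' c'' where c: "\<forall>i. c i \<in> laurent" "x = (\<Sum>i\<in>UNIV. c i *s f i)"
    "\<forall>i. c' i \<in> val_ring e" "x = (\<Sum>i\<in>UNIV. c' i *s f i)"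
    "\<forall>i. c'' i \<in> val_ring (opp e)" "x = (\<Sum>i\<in>UNIV. c'' i *s f i)"
    unfolding lincombs_iff by blast
  have "c i \<in> consts_in" for i
  proof -
    have 1: "c i = c' i" using c(2,4) by (intro coeffs_unique[OF det]) simp
    have 2: "c i = c'' i" using c(2,6) by (intro coeffs_unique[OF det]) simp
    have "c i \<in> val_ring e" using c(3) 1 by simp
    then obtain g y where gy: "y \<in> val_ring e" "c i = cst g + unif e * y" by (rule residue)
    have "c i \<in> laurent" using c(1) by blast
    moreover have "c i \<in> val_ring (opp e)" unfolding 2 using c(5) by blast
    moreover have "unif e * y = c i - cst g" using gy(2) by simp
    ultimately have "unif e * y \<in> laurent" "unif e * y \<in> val_ring (opp e)"
      using laurent_closed(6)[OF _ cst_in_laurent] val_ring_closed(6)[OF _ cst_in_val_ring] by simp_all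
    moreover have "unif (opp e) * (unif e * y) \<in> val_ring (opp (opp e))" using gy(1) by (simp add: unif_opp mult.assoc[symmetric])
    ultimately have "unif e * y = 0" by (rule laurent_disjoint)
    then show ?thesis using gy(2) by simp
  qed
  then show "x \<in> lincombs consts_in f" unfolding lincombs_iff using c(2) by blast
next
  have R: "free_laurent = lincombs laurent f" using assms unfolding basis_over_laurent by auto
  fix x assume "x \<in> lincombs consts_in f"
  then show "x \<in> free_laurent \<inter> lincombs (val_ring e) f \<inter> lincombs (val_ring (opp e)) f"
    unfolding R lincombs_def using consts_laurent consts_val_ring by blast
qed

lemma invariant_span_set: "invariant_under \<Gamma> M \<Longrightarrow> invariant_under \<Gamma> (vec.span M)"
  unfolding invariant_under_def
proof (intro ballI)
  fix g x assume M: "\<forall>g\<in>\<Gamma>. \<forall>x\<in>M. g *v x \<in> M" and g: "g \<in> \<Gamma>" and "x \<in> vec.span M"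
  from this(3) show "g *v x \<in> vec.span M"
  proof (induction rule: vec.span_induct_alt)
    case (step c a y)
    then show ?case using M g
      by (auto simp: matrix_vector_right_distrib vec.scale intro!: vec.span_add vec.span_scale intro: vec.span_base)
  qed (simp add: vec.span_zero)
qed

section \<open>The equivalence\<close>

lemma completely_reducible_imp_complement:
  fixes \<Gamma> :: "('k::field ratfun ^ 'n::finite ^ 'n) set"
  assumes CR: "completely_reducible \<Gamma>" and det1: "\<And>g. g \<in> \<Gamma> \<Longrightarrow> det g = 1"
    and R_inv: "invariant_under \<Gamma> free_laurent"
    and M: "direct_summand M" "invariant_under \<Gamma> M"
  shows "\<exists>N. submodule_over laurent N \<and> invariant_under \<Gamma> N \<and> complementary M N"
proof -
  let ?e = SPlus
  have "fixed_complex \<Gamma> ?e \<noteq> {}" using CR unfolding completely_reducible_def by blast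
  then obtain L where L: "lattice_in ?e L" "invariant_under \<Gamma> L" by (rule fixed_lattice_exists[OF _ det1])
  have vertex: "(\<lambda>i::nat. homothety_class L) ` {..0} \<in> fixed_complex \<Gamma> ?e"
    using L unif_scale_strict[OF L(1)] by (intro fixed_complexI[OF det1, where L = "\<lambda>_. L"]) auto
  obtain f :: "'n \<Rightarrow> 'k ratfun ^ 'n" where f: "basis_over laurent f free_laurent"
    "\<And>M. homothety_class M \<in> (\<lambda>i::nat. homothety_class L) ` {..0} \<Longrightarrow> \<exists>a. M = lincombs (val_ring ?e) (\<lambda>i. unif ?e powi a i *s f i) \<and>
       invariant_under \<Gamma> (lincombs (val_ring (opp ?e)) (\<lambda>i. unif ?e powi a i *s f i))"
    using opposite_stable_basis[OF CR det1 vertex] by blast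
  from f(2)[of L] obtain a where a: "L = lincombs (val_ring ?e) (\<lambda>i. unif ?e powi a i *s f i)"
    "invariant_under \<Gamma> (lincombs (val_ring (opp ?e)) (\<lambda>i. unif ?e powi a i *s f i))" by blast
  define f0 where "f0 i = unif ?e powi a i *s f i" for i
  have f0: "basis_over laurent f0 free_laurent" unfolding f0_def by (rule laurent_basis_scaled[OF f(1)])
  then have det: "det (colmat f0) \<noteq> 0" unfolding basis_over_laurent by blast
  have L_f0: "L = lincombs (val_ring ?e) f0" unfolding a(1) f0_def ..
  define L' where "L' = lincombs (val_ring (opp ?e)) f0"
  have L'_inv: "invariant_under \<Gamma> L'" using a(2) unfolding L'_def f0_def .
  have V_inv: "invariant_under \<Gamma> (lincombs consts_in f0)"
    unfolding constant_lincombs[OF f0, of ?e, symmetric]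
    by (intro invariant_Int R_inv) (use L(2) L_f0 L'_inv L'_def in simp_all)
  have ss: "\<exists>U'. stable_subspace \<Gamma> U' \<and> U' \<subseteq> lincombs consts_in f0 \<and>
        U \<inter> U' \<subseteq> {0} \<and> lincombs consts_in f0 \<subseteq> msum U U'"
    if "submodule_over consts_in U" "invariant_under \<Gamma> U" "U \<subseteq> lincombs consts_in f0" for U
    using L(2) unfolding L_f0 by (intro constant_fibre_semisimple[OF CR det1 R_inv det _ V_inv that])
  interpret stable_chain ?e \<Gamma> "\<lambda>_. L" 0 L' "vec.span M"
  proof
    show "lattice_in (opp ?e) L'" unfolding L'_def by (rule lattice_lincombs[OF det])
    show "scale_set (unif ?e) L \<subseteq> L" using unif_scale_strict[OF L(1)] by blast
    show "invariant_under \<Gamma> (vec.span M)" by (rule invariant_span_set[OF M(2)])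
    fix W X :: "('k ratfun ^ 'n) set"
    assume W: "vec.subspace W" "invariant_under \<Gamma> W" and X: "stable_subspace \<Gamma> X"
      "free_laurent \<inter> W \<subseteq> X" "X \<subseteq> free_laurent" "\<not> X \<subseteq> W"
    have Z: "submodule_over consts_in (free_laurent \<inter> W)" "invariant_under \<Gamma> (free_laurent \<inter> W)"
      by (intro submodule_over_Int submodule_over_mono[OF submodule_free_laurent consts_laurent]
          submodule_over_subspace W invariant_Int R_inv)+
    obtain C where C: "submodule_over consts_in C" "invariant_under \<Gamma> C" "C \<subseteq> free_laurent"
      "(free_laurent \<inter> W) \<inter> C \<subseteq> {0}" "free_laurent \<subseteq> msum (free_laurent \<inter> W) C"
      by (rule laurent_module_semisimple[OF f0 ss V_inv Z])
    show "\<exists>C. stable_subspace \<Gamma> C \<and> C \<subseteq> X \<and> C \<noteq> {0} \<and> C \<inter> W \<subseteq> {0}"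
      by (rule stable_complement_within[OF X conjI[OF C(1,2)] C(4,5)])
  qed (use L R_inv L'_inv in auto)
  obtain B lev where B: "adapted B lev" "Wspan B = UNIV" by (rule adapted_basis_exists)
  show ?thesis using adapted_complement[OF B] unfolding direct_summand_saturated[OF M(1)] by blast
qed

lemma complements_imp_completely_reducible:
  fixes \<Gamma> :: "('k::field ratfun ^ 'n::finite ^ 'n) set"
  assumes det1: "\<And>g. g \<in> \<Gamma> \<Longrightarrow> det g = 1" and R_inv: "invariant_under \<Gamma> free_laurent"
    and ne: "\<And>e. fixed_complex \<Gamma> e \<noteq> {}"
    and compl: "\<And>M. direct_summand M \<Longrightarrow> invariant_under \<Gamma> M \<Longrightarrow>
       \<exists>N. submodule_over laurent N \<and> invariant_under \<Gamma> N \<and> complementary M N"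
  shows "completely_reducible \<Gamma>"
  unfolding completely_reducible_def
proof (intro conjI allI ballI ne)
  fix e \<sigma> assume \<sigma>: "\<sigma> \<in> fixed_complex \<Gamma> e"
  then have "\<sigma> \<in> simplices e" unfolding fixed_complex_def by blast
  then obtain L r where \<sigma>_eq: "\<sigma> = (\<lambda>i. homothety_class (L i)) ` {..r}"
    and lat: "\<And>i. i \<le> r \<Longrightarrow> lattice_in e (L i)" and dec: "\<And>i. i < r \<Longrightarrow> L (Suc i) \<subset> L i"
    and per: "scale_set (unif e) (L 0) \<subset> L r"
    by (rule simplicesE) (rule that, assumption+)
  obtain L' where L': "lattice_in (opp e) L'" "invariant_under \<Gamma> L'"
    by (rule fixed_lattice_exists[OF ne det1])
  interpret stable_chain e \<Gamma> L r L' "{0}"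
  proof
    show "invariant_under \<Gamma> (L i)" if "i \<le> r" for i
      using that in_homothety_class by (intro fixed_simplex_lattice[OF \<sigma> det1, of "homothety_class (L i)"]) (auto simp: \<sigma>_eq)
    show "L (Suc i) \<subseteq> L i" if "i < r" for i using dec[OF that] by blast
    show "scale_set (unif e) (L 0) \<subseteq> L r" using per by blast
    show "vec.subspace {0 :: 'k ratfun ^ 'n}" by (rule vec.subspace_single_0)
    show "invariant_under \<Gamma> {0}" by (simp add: invariant_under_def)
    fix W X :: "('k ratfun ^ 'n) set"
    assume W: "vec.subspace W" "invariant_under \<Gamma> W" and X: "stable_subspace \<Gamma> X"
      "free_laurent \<inter> W \<subseteq> X" "X \<subseteq> free_laurent" "\<not> X \<subseteq> W"
    obtain N where N: "submodule_over laurent N" "invariant_under \<Gamma> N" "complementary (free_laurent \<inter> W) N"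
      using compl[OF saturated_direct_summand[OF W(1)] invariant_Int[OF R_inv W(2)]] by blast
    have "(free_laurent \<inter> W) \<inter> N \<subseteq> {0}" "free_laurent \<subseteq> msum (free_laurent \<inter> W) N"
      using N(3) unfolding complementary_def msum_def by blast+
    then show "\<exists>C. stable_subspace \<Gamma> C \<and> C \<subseteq> X \<and> C \<noteq> {0} \<and> C \<inter> W \<subseteq> {0}"
      by (rule stable_complement_within[OF X conjI[OF submodule_over_mono[OF N(1) consts_laurent] N(2)]])
  qed (use lat L' R_inv in auto)
  show "\<exists>\<tau>\<in>fixed_complex \<Gamma> (opp e). opposite e \<sigma> \<tau>"
    unfolding \<sigma>_eq by (rule opposite_fixed_simplex[OF refl det1 dec per])
qed

theorem proposition36:
  fixes \<Gamma> :: "('k::field ratfun ^ 'n::finite ^ 'n) set"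
  assumes "CARD('n) \<ge> 2"
    and "subgroup \<Gamma> SL_laurent"
    and "\<And>e. fixed_complex \<Gamma> e \<noteq> {}"
  shows "completely_reducible \<Gamma> \<longleftrightarrow>
    (\<forall>M. direct_summand M \<and> invariant_under \<Gamma> M \<longrightarrow>
       (\<exists>N. submodule_over laurent N \<and> invariant_under \<Gamma> N \<and> complementary M N))"
proof -
  have \<Gamma>: "\<Gamma> \<subseteq> {g. (\<forall>i j. g $ i $ j \<in> laurent) \<and> det g = 1}"
    using subgroup.subset[OF assms(2)] by (simp add: SL_laurent_def)
  then have det1: "\<And>g. g \<in> \<Gamma> \<Longrightarrow> det g = 1" by blast
  have R_inv: "invariant_under \<Gamma> free_laurent"
    unfolding invariant_under_def
  proof (intro ballI)
    fix g and x :: "'k ratfun ^ 'n" assume g: "g \<in> \<Gamma>" and x: "x \<in> free_laurent"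
    have "(\<Sum>j\<in>J. g $ i $ j * x $ j) \<in> laurent" if "finite J" for i and J :: "'n set"
      using that
    proof induction
      case (insert j J)
      moreover have "g $ i $ j \<in> laurent" "x $ j \<in> laurent" using \<Gamma> g x by (auto simp: free_laurent_def)
      ultimately show ?case by (simp add: laurent_closed(3,4))
    qed (simp add: laurent_closed(1))
    then show "g *v x \<in> free_laurent" by (simp add: free_laurent_def matrix_vector_mult_def)
  qed
  show ?thesis
    using completely_reducible_imp_complement[OF _ det1 R_inv]
      complements_imp_completely_reducible[OF det1 R_inv assms(3)] by blast
qed

end
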